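(* Let $d\ge 1$ and let $\Gamma$ be a graph. Then $\Gamma$ is generically globally rigid in $\mathbb C^d$ if and only if $\Gamma$ is generically globally rigid in $\mathbb E^d$.
   Context: $\mathbb E^d$ is $\mathbb R^d$ with the usual squared length $|w|^2=\sum_{i=1}^d w_i^2$. In $\mathbb C^d$ the squared length of a vector $w$ is $|w|^2=\sum_{i=1}^d w_i^2$ (no complex conjugation; squared lengths are complex numbers). A graph $\Gamma$ has a finite vertex set $\mathcal V$ with $v$ vertices and edge set $\mathcal E$ of two-element subsets of $\mathcal V$. For $\mathbb F\in\{\mathbb E,\mathbb C\}$, a configuration is a map $p:\mathcal V\to\mathbb F^d$, and a framework of $\Gamma$ in $\mathbb F^d$ is a pair $(p,\Gamma)$; write $\rho(t)$ for the position of vertex $t$. Two frameworks $\rho,\sigma$ of $\Gamma$ are equivalent if $|\rho(t)-\rho(u)|^2=|\sigma(t)-\sigma(u)|^2$ for every edge $\{t,u\}\in\mathcal E$, and congruent if this holds for every pair of vertices $t,u$. A framework is globally rigid in $\mathbb F^d$ if every framework of $\Gamma$ in $\mathbb F^d$ equivalent to it is congruent to it; otherwise it is globally flexible. A configuration/framework is generic if its coordinates (real coordinates in $\mathbb E^d$, complex coordinates in $\mathbb C^d$) satisfy no nonzero polynomial equation with rational coefficients. $\Gamma$ is generically globally rigid (GGR) in $\mathbb F^d$ if every generic framework of $\Gamma$ in $\mathbb F^d$ is globally rigid. *)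

theory Defs
  imports "HOL-Analysis.Analysis"
begin

text \<open>Vectors in F^d are 'a ^ 'n with 'n a finite index type (d = CARD('n) \<ge> 1).
  Squared length without complex conjugation: sum of squares of coordinates.\<close>
definition sqlen :: "'a::comm_ring_1 ^ 'n \<Rightarrow> 'a" where
  "sqlen w = (\<Sum>i\<in>UNIV. (w $ i) ^ 2)"

definition is_graph :: "'v set set \<Rightarrow> bool" where
  "is_graph E \<longleftrightarrow> (\<forall>e\<in>E. card e = 2)"

definition equivalent_fw :: "'v set set \<Rightarrow> ('v \<Rightarrow> 'a::comm_ring_1 ^ 'n) \<Rightarrow> ('v \<Rightarrow> 'a ^ 'n) \<Rightarrow> bool" where
  "equivalent_fw E p q \<longleftrightarrow>
     (\<forall>t u. {t, u} \<in> E \<longrightarrow> sqlen (p t - p u) = sqlen (q t - q u))"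

definition congruent_fw :: "('v \<Rightarrow> 'a::comm_ring_1 ^ 'n) \<Rightarrow> ('v \<Rightarrow> 'a ^ 'n) \<Rightarrow> bool" where
  "congruent_fw p q \<longleftrightarrow> (\<forall>t u. sqlen (p t - p u) = sqlen (q t - q u))"

definition globally_rigid :: "'v set set \<Rightarrow> ('v \<Rightarrow> 'a::comm_ring_1 ^ 'n) \<Rightarrow> bool" where
  "globally_rigid E p \<longleftrightarrow> (\<forall>q. equivalent_fw E p q \<longrightarrow> congruent_fw p q)"

text \<open>Polynomials with rational coefficients in variables indexed by a finite type 'i:
  a coefficient function on monomials (exponent vectors 'i \<Rightarrow> nat) with finite support.\<close>
definition rat_poly_eval :: "(('i::finite \<Rightarrow> nat) \<Rightarrow> rat) \<Rightarrow> ('i \<Rightarrow> 'a::field_char_0) \<Rightarrow> 'a" where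
  "rat_poly_eval c x = (\<Sum>m\<in>{m. c m \<noteq> 0}. of_rat (c m) * (\<Prod>i\<in>UNIV. x i ^ m i))"

definition generic_family :: "('i::finite \<Rightarrow> 'a::field_char_0) \<Rightarrow> bool" where
  "generic_family x \<longleftrightarrow>
     (\<forall>c :: ('i \<Rightarrow> nat) \<Rightarrow> rat. finite {m. c m \<noteq> 0} \<and> (\<exists>m. c m \<noteq> 0) \<longrightarrow> rat_poly_eval c x \<noteq> 0)"

definition generic_config :: "('v::finite \<Rightarrow> 'a::field_char_0 ^ 'n) \<Rightarrow> bool" where
  "generic_config p \<longleftrightarrow> generic_family (\<lambda>(t, i). p t $ i)"

text \<open>Generic global rigidity in F^d, where the field F and d are fixed by the type argument.\<close>
definition GGR :: "'v::finite set set \<Rightarrow> ('v \<Rightarrow> 'a::field_char_0 ^ 'n) itself \<Rightarrow> bool" where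
  "GGR E _ \<longleftrightarrow> (\<forall>p :: 'v \<Rightarrow> 'a ^ 'n. generic_config p \<longrightarrow> globally_rigid E p)"

end

theory Submission
  imports Defs "HOL-Computational_Algebra.Fundamental_Theorem_Algebra"
begin

text \<open>
  Real to complex. For a generic real configuration \<open>p\<close>, derivations of subfields of the reals with
  prescribed values on \<open>p\<close> replace tangent-space arguments. Choosing a generic equilibrium stress \<open>w\<close> of
  \<open>p\<close>, they show that the measurement map sends the configurations having \<open>w\<close> as a stress into a
  linear space \<open>L\<close>, submersively at \<open>p\<close>. Hence generic global rigidity forces infinitesimal rigidity. If
  the kernel of the stress matrix were larger than the affine functions of \<open>p\<close>, then modulo congruence
  the measurement map would be a proper quadratic map between spaces of equal dimension whose degenerate
  configurations have codimension at least two. A line in \<open>L\<close> with generic offset must leave the image,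
  since squared lengths are nonnegative; where it does, the map has corank one and folds, so an open set
  of configurations is globally flexible, a contradiction. Therefore the stress kernel consists of the affine
  functions of \<open>p\<close>. A field embedding moves any generic complex framework to \<open>p\<close>; every complex
  framework equivalent to \<open>p\<close> has the same stresses, hence is an affine image of \<open>p\<close>, and infinitesimal
  rigidity makes it congruent to \<open>p\<close>.
\<close>

section \<open>Subfields and partial homomorphisms\<close>

text \<open>Why derivations: a number algebraic over the coordinates of \<open>p\<close> is locally
  a smooth function of them, and a derivation with \<open>\<delta> p = u\<close> differentiates it
  in direction \<open>u\<close>. Since derivations extend to any finite set of further numbers,
  identities between quantities attached to \<open>p\<close> can be differentiated without choosing
  such functions or proving constant rank. A derivation is a homomorphism into dual numbers, so one
  extension theory serves derivations and field embeddings alike. The fields over which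
  transcendental numbers are chosen are kept countable.

  The obstacle is to produce an open set of flexible configurations when the stress kernel is too
  large. On a line in \<open>L\<close> all coordinates but one are generic, hence at each preimage
  of a point of the line the derivative misses at most one dimension: the line avoids whatever has
  codimension two, and on the boundary of the image exactly one dimension is lost.

  On the complex side the second framework need not be generic. One inclusion of stress spaces comes
  from a derivation, the other from a limit of generic frameworks.\<close>

definition subfld :: "'a::field set \<Rightarrow> bool" where
  "subfld S \<longleftrightarrow> 1 \<in> S \<and> (\<forall>x\<in>S. \<forall>y\<in>S. x + y \<in> S \<and> x * y \<in> S) \<and> (\<forall>x\<in>S. - x \<in> S \<and> inverse x \<in> S)"

lemma subfldD:
  assumes "subfld S"
  shows "1 \<in> S" "0 \<in> S" "x \<in> S \<Longrightarrow> y \<in> S \<Longrightarrow> x + y \<in> S" "x \<in> S \<Longrightarrow> y \<in> S \<Longrightarrow> x * y \<in> S"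
    "x \<in> S \<Longrightarrow> - x \<in> S" "x \<in> S \<Longrightarrow> inverse x \<in> S" "x \<in> S \<Longrightarrow> y \<in> S \<Longrightarrow> x - y \<in> S"
    "x \<in> S \<Longrightarrow> y \<in> S \<Longrightarrow> x / y \<in> S"
proof -
  show 1: "1 \<in> S" and a: "x \<in> S \<Longrightarrow> y \<in> S \<Longrightarrow> x + y \<in> S" and m: "x \<in> S \<Longrightarrow> y \<in> S \<Longrightarrow> x * y \<in> S"
    and u: "x \<in> S \<Longrightarrow> - x \<in> S" and i: "x \<in> S \<Longrightarrow> inverse x \<in> S" for x y
    using assms by (auto simp: subfld_def)
  show "0 \<in> S" using a[OF 1 u[OF 1]] by simp
  show "x \<in> S \<Longrightarrow> y \<in> S \<Longrightarrow> x - y \<in> S" using a[of x "-y"] u[of y] by simp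
  show "x \<in> S \<Longrightarrow> y \<in> S \<Longrightarrow> x / y \<in> S" using m[of x "inverse y"] i[of y] by (simp add: divide_inverse)
qed

lemma subfld_sum: "subfld S \<Longrightarrow> (\<And>i. i \<in> I \<Longrightarrow> f i \<in> S) \<Longrightarrow> sum f I \<in> S"
  by (induction I rule: infinite_finite_induct) (auto simp: subfldD)

lemma subfld_power: "subfld S \<Longrightarrow> x \<in> S \<Longrightarrow> x ^ n \<in> S"
  by (induction n) (auto simp: subfldD)

section \<open>Generated subfields and their countability\<close>

inductive_set fld :: "'a::field set \<Rightarrow> 'a set" for S where
  base: "x \<in> S \<Longrightarrow> x \<in> fld S"
| one: "1 \<in> fld S"
| add: "x \<in> fld S \<Longrightarrow> y \<in> fld S \<Longrightarrow> x + y \<in> fld S"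
| mult: "x \<in> fld S \<Longrightarrow> y \<in> fld S \<Longrightarrow> x * y \<in> fld S"
| uminus: "x \<in> fld S \<Longrightarrow> - x \<in> fld S"
| inverse: "x \<in> fld S \<Longrightarrow> inverse x \<in> fld S"

lemma subfld_fld [simp]: "subfld (fld S)"
  by (auto simp: subfld_def intro: fld.intros)

lemma fld_least: "subfld T \<Longrightarrow> S \<subseteq> T \<Longrightarrow> fld S \<subseteq> T"
proof
  fix x assume T: "subfld T" "S \<subseteq> T" and "x \<in> fld S"
  from this(3) show "x \<in> T" by induction (use T in \<open>auto simp: subfldD\<close>)
qed

lemma fld_mono: "S \<subseteq> T \<Longrightarrow> fld S \<subseteq> fld T"
  by (rule fld_least) (auto intro: fld.base)

lemma fld_superset: "S \<subseteq> fld S"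
  by (auto intro: fld.base)

text \<open>Names for the elements of a generated field, as expressions over enumerated generators.
  There are countably many names, so countably many generators give a countable field.\<close>

datatype fexp = FLeaf nat | FOne | FAdd fexp fexp | FMult fexp fexp | FNeg fexp | FInv fexp

instance fexp :: countable
  by countable_datatype

primrec feval :: "(nat \<Rightarrow> 'a::field) \<Rightarrow> fexp \<Rightarrow> 'a" where
  "feval v (FLeaf n) = v n"
| "feval v FOne = 1"
| "feval v (FAdd a b) = feval v a + feval v b"
| "feval v (FMult a b) = feval v a * feval v b"
| "feval v (FNeg a) = - feval v a"
| "feval v (FInv a) = inverse (feval v a)"

lemma countable_fld:
  assumes "countable S"
  shows "countable (fld S)"
proof -
  have "fld S \<subseteq> range (feval (from_nat_into S))"
  proof
    fix x assume "x \<in> fld S"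
    then show "x \<in> range (feval (from_nat_into S))"
    proof induction
      case (base x)
      then have "x = feval (from_nat_into S) (FLeaf (to_nat_on S x))" using assms by simp
      then show ?case by blast
    next
      case one
      have "1 = feval (from_nat_into S) FOne" by simp
      then show ?case by blast
    next
      case (add x y)
      then obtain a b where "x = feval (from_nat_into S) a" "y = feval (from_nat_into S) b" by blast
      then have "x + y = feval (from_nat_into S) (FAdd a b)" by simp
      then show ?case by blast
    next
      case (mult x y)
      then obtain a b where "x = feval (from_nat_into S) a" "y = feval (from_nat_into S) b" by blast
      then have "x * y = feval (from_nat_into S) (FMult a b)" by simp
      then show ?case by blast
    next
      case (uminus x)
      then obtain a where "x = feval (from_nat_into S) a" by blast
      then have "- x = feval (from_nat_into S) (FNeg a)" by simp
      then show ?case by blast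
    next
      case (inverse x)
      then obtain a where "x = feval (from_nat_into S) a" by blast
      then have "inverse x = feval (from_nat_into S) (FInv a)" by simp
      then show ?case by blast
    qed
  qed
  then show ?thesis by (rule countable_subset) simp
qed

section \<open>Polynomials over a subfield and transcendental elements\<close>

definition polys_over :: "'a::field set \<Rightarrow> 'a poly set" where
  "polys_over S = {P. \<forall>i. coeff P i \<in> S}"

lemma polys_over_pCons [simp]:
  "subfld S \<Longrightarrow> pCons a P \<in> polys_over S \<longleftrightarrow> a \<in> S \<and> P \<in> polys_over S"
  by (auto simp: polys_over_def coeff_pCons split: nat.splits)

lemma polys_over_0 [simp]: "subfld S \<Longrightarrow> 0 \<in> polys_over S"
  by (auto simp: polys_over_def subfldD)

lemma polys_over_1 [simp]: "subfld S \<Longrightarrow> 1 \<in> polys_over S"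
  by (simp add: one_pCons subfldD)

lemma polys_over_add: "subfld S \<Longrightarrow> P \<in> polys_over S \<Longrightarrow> Q \<in> polys_over S \<Longrightarrow> P + Q \<in> polys_over S"
  by (auto simp: polys_over_def subfldD)

lemma polys_over_diff: "subfld S \<Longrightarrow> P \<in> polys_over S \<Longrightarrow> Q \<in> polys_over S \<Longrightarrow> P - Q \<in> polys_over S"
  by (auto simp: polys_over_def subfldD)

lemma polys_over_uminus: "subfld S \<Longrightarrow> P \<in> polys_over S \<Longrightarrow> - P \<in> polys_over S"
  by (auto simp: polys_over_def subfldD)

lemma polys_over_mult: "subfld S \<Longrightarrow> P \<in> polys_over S \<Longrightarrow> Q \<in> polys_over S \<Longrightarrow> P * Q \<in> polys_over S"
  by (auto simp: polys_over_def coeff_mult intro!: subfld_sum subfldD)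

lemma polys_over_monom: "subfld S \<Longrightarrow> c \<in> S \<Longrightarrow> monom c n \<in> polys_over S"
  by (auto simp: polys_over_def subfldD)

lemma polys_over_pderiv: "subfld S \<Longrightarrow> P \<in> polys_over S \<Longrightarrow> pderiv P \<in> polys_over (S :: 'a::field_char_0 set)"
proof -
  assume S: "subfld S" and P: "P \<in> polys_over S"
  have "of_nat n \<in> S" for n by (induction n) (auto simp: subfldD[OF S])
  then show ?thesis using P by (auto simp: polys_over_def coeff_pderiv intro!: subfldD(4)[OF S] simp flip: of_nat_Suc)
qed

lemma poly_in_subfld: "subfld S \<Longrightarrow> P \<in> polys_over S \<Longrightarrow> x \<in> S \<Longrightarrow> poly P x \<in> S"
  by (auto simp: polys_over_def poly_altdef intro!: subfld_sum subfldD(4) subfld_power)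

definition trans_over :: "'a::field set \<Rightarrow> 'a \<Rightarrow> bool" where
  "trans_over S x \<longleftrightarrow> (\<forall>P\<in>polys_over S. poly P x = 0 \<longrightarrow> P = 0)"

lemma countable_polys_over:
  assumes "countable S" "subfld S"
  shows "countable (polys_over S)"
proof -
  have "polys_over S \<subseteq> Poly ` lists S"
  proof
    fix P assume P: "P \<in> polys_over S"
    have "set (coeffs P) \<subseteq> S"
    proof
      fix x assume "x \<in> set (coeffs P)"
      then obtain i where "x = coeff P i" by (auto simp: coeffs_def split: if_splits)
      then show "x \<in> S" using P by (simp add: polys_over_def)
    qed
    then have "coeffs P \<in> lists S" by (simp add: in_lists_conv_set subset_eq)
    then show "P \<in> Poly ` lists S" by (metis Poly_coeffs image_eqI)
  qed
  then show ?thesis using assms(1) by (meson countable_image countable_lists countable_subset)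
qed

lemma countable_algebraic:
  assumes "countable S" "subfld S"
  shows "countable {x. \<not> trans_over S x}"
proof -
  have "{x. \<not> trans_over S x} = (\<Union>P\<in>polys_over S - {0}. {x. poly P x = 0})"
    by (auto simp: trans_over_def)
  moreover have "countable \<dots>"
    using countable_polys_over[OF assms] by (intro countable_UN) (auto intro: countable_finite poly_roots_finite)
  ultimately show ?thesis by simp
qed

section \<open>Homomorphisms defined on a subfield\<close>

definition hom_on :: "'a::field set \<Rightarrow> ('a \<Rightarrow> 'b::comm_ring_1) \<Rightarrow> bool" where
  "hom_on S h \<longleftrightarrow> subfld S \<and> h 1 = 1 \<and> (\<forall>x\<in>S. \<forall>y\<in>S. h (x + y) = h x + h y \<and> h (x * y) = h x * h y)"

lemma hom_onD:
  assumes "hom_on S h"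
  shows "subfld S" "h 1 = 1" "h 0 = 0" "x \<in> S \<Longrightarrow> y \<in> S \<Longrightarrow> h (x + y) = h x + h y"
    "x \<in> S \<Longrightarrow> y \<in> S \<Longrightarrow> h (x * y) = h x * h y" "x \<in> S \<Longrightarrow> h (- x) = - h x"
    "x \<in> S \<Longrightarrow> y \<in> S \<Longrightarrow> h (x - y) = h x - h y" "x \<in> S \<Longrightarrow> x \<noteq> 0 \<Longrightarrow> h x * h (inverse x) = 1"
proof -
  show S: "subfld S" and h1: "h 1 = 1" and a: "x \<in> S \<Longrightarrow> y \<in> S \<Longrightarrow> h (x + y) = h x + h y"
    and m: "x \<in> S \<Longrightarrow> y \<in> S \<Longrightarrow> h (x * y) = h x * h y" for x y
    using assms by (auto simp: hom_on_def)
  show h0: "h 0 = 0" using a[of 0 0] subfldD[OF S] by simp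
  show u: "x \<in> S \<Longrightarrow> h (- x) = - h x" for x
    using a[of x "-x"] subfldD[OF S] h0 by (simp add: eq_neg_iff_add_eq_0 add.commute)
  show "x \<in> S \<Longrightarrow> y \<in> S \<Longrightarrow> h (x - y) = h x - h y"
    using a[of x "-y"] u[of y] subfldD[OF S] by simp
  show "x \<in> S \<Longrightarrow> x \<noteq> 0 \<Longrightarrow> h x * h (inverse x) = 1"
    using m[of x "inverse x"] subfldD[OF S] h1 by simp
qed

lemma hom_on_sum: "hom_on S h \<Longrightarrow> (\<And>i. i \<in> I \<Longrightarrow> f i \<in> S) \<Longrightarrow> h (sum f I) = (\<Sum>i\<in>I. h (f i))"
  by (induction I rule: infinite_finite_induct) (auto simp: hom_onD subfld_sum)

lemma hom_on_subset: "hom_on T h \<Longrightarrow> subfld S \<Longrightarrow> S \<subseteq> T \<Longrightarrow> hom_on S h"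
  by (auto simp: hom_on_def)

text \<open>The image of a nonzero element is a unit, and \<open>0\<close> is not a unit because
  \<open>0 \<noteq> 1\<close> in the codomain.\<close>

lemma hom_on_inj:
  fixes h :: "'a::field \<Rightarrow> 'b::comm_ring_1"
  assumes "hom_on S h" "x \<in> S" "h x = 0"
  shows "x = 0"
  using hom_onD(8)[OF assms(1,2)] assms(3) by fastforce

lemma hom_on_cong: "hom_on S h \<Longrightarrow> (\<And>x. x \<in> S \<Longrightarrow> h x = g x) \<Longrightarrow> hom_on S g"
  unfolding hom_on_def using subfldD by metis

lemma map_poly_hom_add:
  assumes "hom_on S h" "P \<in> polys_over S" "Q \<in> polys_over S"
  shows "map_poly h (P + Q) = map_poly h P + map_poly h Q"
  using assms by (intro poly_eqI) (auto simp: coeff_map_poly hom_onD polys_over_def)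

lemma map_poly_hom_diff:
  assumes "hom_on S h" "P \<in> polys_over S" "Q \<in> polys_over S"
  shows "map_poly h (P - Q) = map_poly h P - map_poly h Q"
  using assms by (intro poly_eqI) (auto simp: coeff_map_poly hom_onD polys_over_def)

lemma map_poly_hom_mult:
  assumes "hom_on S h" "P \<in> polys_over S" "Q \<in> polys_over S"
  shows "map_poly h (P * Q) = map_poly h P * map_poly h Q"
proof (intro poly_eqI)
  fix n
  have "\<And>i j. coeff P i * coeff Q j \<in> S"
    using assms hom_onD(1)[OF assms(1)] by (auto simp: polys_over_def subfldD)
  then have "h (coeff (P * Q) n) = (\<Sum>i\<le>n. h (coeff P i) * h (coeff Q (n - i)))"
    using assms by (simp add: coeff_mult hom_on_sum hom_onD polys_over_def)
  then show "coeff (map_poly h (P * Q)) n = coeff (map_poly h P * map_poly h Q) n"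
    using assms by (simp add: coeff_map_poly hom_onD coeff_mult)
qed

text \<open>\<open>R\<close> is the graph of a ring homomorphism from a subring; it extends to the fraction field.\<close>
lemma fraction_hom:
  fixes R :: "('a::field \<times> 'b::comm_ring_1) set"
  assumes one: "(1, 1) \<in> R"
    and add: "\<And>a a' b b'. (a, a') \<in> R \<Longrightarrow> (b, b') \<in> R \<Longrightarrow> (a + b, a' + b') \<in> R"
    and mult: "\<And>a a' b b'. (a, a') \<in> R \<Longrightarrow> (b, b') \<in> R \<Longrightarrow> (a * b, a' * b') \<in> R"
    and neg: "\<And>a a'. (a, a') \<in> R \<Longrightarrow> (- a, - a') \<in> R"
    and zero: "\<And>a'. (0, a') \<in> R \<Longrightarrow> a' = 0"
    and unit: "\<And>a a'. (a, a') \<in> R \<Longrightarrow> a \<noteq> 0 \<Longrightarrow> a' dvd 1"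
  obtains h where "hom_on (fld (fst ` R)) h" "\<And>a a'. (a, a') \<in> R \<Longrightarrow> h a = a'"
proof -
  \<comment> \<open>\<open>w\<close> plays the role of \<open>p' / q'\<close> when
    \<open>y = p / q\<close>; equations replace the quotient because the codomain has no division.
    It exists and is unique because images of denominators are units.\<close>
  define rel where "rel y w \<longleftrightarrow> (\<exists>p p' q q'. (p, p') \<in> R \<and> (q, q') \<in> R \<and> q \<noteq> 0 \<and> y * q = p \<and> w * q' = p')" for y w
  have relI: "rel y w" if "(p, p') \<in> R" "(q, q') \<in> R" "q \<noteq> 0" "y * q = p" "w * q' = p'" for y w p p' q q'
    using that by (auto simp: rel_def)
  have unique: "w = v" if "rel y w" "rel y v" for y w v
  proof -
    from that obtain p p' q q' r r' s s' where R: "(p, p') \<in> R" "(q, q') \<in> R" "(r, r') \<in> R" "(s, s') \<in> R"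
      and nz: "q \<noteq> 0" "s \<noteq> 0" and eq: "y * q = p" "w * q' = p'" "y * s = r" "v * s' = r'"
      unfolding rel_def by blast
    have "(p * s + - (r * q), p' * s' + - (r' * q')) \<in> R" using R by (intro add mult neg)
    moreover have "p * s + - (r * q) = 0" using eq by (auto simp: algebra_simps)
    ultimately have "p' * s' + - (r' * q') = 0" using zero by metis
    then have "(w - v) * (q' * s') = 0" using eq by (auto simp: algebra_simps)
    moreover have "q' * s' dvd 1" using mult_dvd_mono[OF unit[OF R(2) nz(1)] unit[OF R(4) nz(2)]] by simp
    then obtain k where "q' * s' * k = 1" by (metis dvdE)
    ultimately show ?thesis by (metis mult.assoc mult.left_neutral mult.commute mult_zero_left eq_iff_diff_eq_0)
  qed
  define h where "h y = (THE w. rel y w)" for y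
  have heq: "h y = w" if "rel y w" for y w
    unfolding h_def using that unique by blast
  define D where "D = {y. \<exists>w. rel y w}"
  have DI: "y \<in> D" if "(p, p') \<in> R" "(q, q') \<in> R" "q \<noteq> 0" "y * q = p" for y p p' q q'
  proof -
    have "q' dvd 1" using unit[OF that(2,3)] .
    then obtain k where "1 = q' * k" by (metis dvdE)
    then have "(p' * k) * q' = p'" by (metis mult.assoc mult.commute mult_1)
    then show ?thesis using relI[OF that] by (auto simp: D_def)
  qed
  have DE: "rel y (h y)" if "y \<in> D" for y
    using that heq by (auto simp: D_def)
  have addr: "rel (y + z) (w + v)" if "rel y w" "rel z v" for y w z v
  proof -
    from that obtain p p' q q' r r' s s' where R: "(p, p') \<in> R" "(q, q') \<in> R" "(r, r') \<in> R" "(s, s') \<in> R"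
      and nz: "q \<noteq> 0" "s \<noteq> 0" and eq: "y * q = p" "w * q' = p'" "z * s = r" "v * s' = r'"
      unfolding rel_def by blast
    show ?thesis
    proof (rule relI)
      show "(p * s + r * q, p' * s' + r' * q') \<in> R" "(q * s, q' * s') \<in> R" using R by (simp_all add: add mult)
    qed (use nz eq in \<open>auto simp: algebra_simps\<close>)
  qed
  have multr: "rel (y * z) (w * v)" if "rel y w" "rel z v" for y w z v
  proof -
    from that obtain p p' q q' r r' s s' where R: "(p, p') \<in> R" "(q, q') \<in> R" "(r, r') \<in> R" "(s, s') \<in> R"
      and nz: "q \<noteq> 0" "s \<noteq> 0" and eq: "y * q = p" "w * q' = p'" "z * s = r" "v * s' = r'"
      unfolding rel_def by blast
    show ?thesis
    proof (rule relI)
      show "(p * r, p' * r') \<in> R" "(q * s, q' * s') \<in> R" using R by (simp_all add: mult)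
    qed (use nz eq in \<open>auto simp: algebra_simps\<close>)
  qed
  have cr: "rel a a'" if "(a, a') \<in> R" for a a'
    using relI[OF that one] by simp
  have D: "subfld D"
    unfolding subfld_def
  proof (intro conjI ballI)
    show "1 \<in> D" using cr[OF one] by (auto simp: D_def)
  next
    fix y y' assume "y \<in> D" "y' \<in> D"
    then show "y + y' \<in> D" "y * y' \<in> D" using addr multr by (fastforce simp: D_def)+
  next
    fix y assume "y \<in> D"
    then obtain p p' q q' where R: "(p, p') \<in> R" "(q, q') \<in> R" "q \<noteq> 0" "y * q = p" by (auto simp: D_def rel_def)
    show "- y \<in> D" using R(4) by (intro DI[OF neg[OF R(1)] R(2,3)]) simp
    show "inverse y \<in> D"
    proof (cases "y = 0")
      case True then show ?thesis using \<open>y \<in> D\<close> by simp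
    next
      case False
      then have "p \<noteq> 0" using R by auto
      then show ?thesis using R False by (intro DI[OF R(2) R(1)]) (auto simp: field_simps)
    qed
  qed
  have "hom_on D h"
    unfolding hom_on_def
  proof (intro conjI ballI D)
    show "h 1 = 1" using heq[OF cr[OF one]] .
  next
    fix y z assume "y \<in> D" "z \<in> D"
    then show "h (y + z) = h y + h z" "h (y * z) = h y * h z"
      using heq[OF addr[OF DE DE]] heq[OF multr[OF DE DE]] by auto
  qed
  moreover have "fst ` R \<subseteq> D" unfolding D_def using cr by fastforce
  ultimately have "hom_on (fld (fst ` R)) h"
    using D by (meson fld_least hom_on_subset subfld_fld)
  then show ?thesis using heq[OF cr] that by blast
qed

text \<open>Pairing the value of \<open>P\<close> at \<open>x\<close> with the value of its image
  under \<open>h\<close> at \<open>b\<close> gives the graph of a ring homomorphism on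
  \<open>S[x]\<close>: \<open>z\<close> makes it single valued, and \<open>u\<close> turns nonzero
  elements into units, so that it passes to fractions.\<close>

lemma hom_extend:
  fixes h :: "'a::field \<Rightarrow> 'b::comm_ring_1"
  assumes h: "hom_on S h"
    and z: "\<And>P. P \<in> polys_over S \<Longrightarrow> poly P x = 0 \<Longrightarrow> poly (map_poly h P) b = 0"
    and u: "\<And>P. P \<in> polys_over S \<Longrightarrow> poly P x \<noteq> 0 \<Longrightarrow> poly (map_poly h P) b dvd 1"
  obtains h' where "hom_on (fld (insert x S)) h'" "\<And>y. y \<in> S \<Longrightarrow> h' y = h y" "h' x = b"
proof -
  note S = hom_onD(1)[OF h]
  let ?g = "\<lambda>P. (poly P x, poly (map_poly h P) b)"
  define R where "R = ?g ` polys_over S"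
  have RE: "\<exists>P. P \<in> polys_over S \<and> a = poly P x \<and> a' = poly (map_poly h P) b" if "(a, a') \<in> R" for a a'
    using that by (auto simp: R_def)
  have RI: "(a, a') \<in> R" if "P \<in> polys_over S" "a = poly P x" "a' = poly (map_poly h P) b" for a a' P
    using that by (auto simp: R_def)
  obtain h' where h': "hom_on (fld (fst ` R)) h'" "\<And>a a'. (a, a') \<in> R \<Longrightarrow> h' a = a'"
  proof (rule fraction_hom[of R])
    show "(1, 1) \<in> R" using S by (intro RI[of 1]) (auto simp: map_poly_1 hom_onD[OF h])
  next
    fix a a' c c' assume "(a, a') \<in> R" "(c, c') \<in> R"
    then obtain P Q where P: "P \<in> polys_over S" "a = poly P x" "a' = poly (map_poly h P) b"
      and Q: "Q \<in> polys_over S" "c = poly Q x" "c' = poly (map_poly h Q) b" by (meson RE)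
    show "(a + c, a' + c') \<in> R"
      using P Q S by (intro RI[of "P + Q"]) (auto simp: map_poly_hom_add[OF h] polys_over_add)
    show "(a * c, a' * c') \<in> R"
      using P Q S by (intro RI[of "P * Q"]) (auto simp: map_poly_hom_mult[OF h] polys_over_mult)
  next
    fix a a' assume "(a, a') \<in> R"
    then obtain P where P: "P \<in> polys_over S" "a = poly P x" "a' = poly (map_poly h P) b" by (meson RE)
    show "(- a, - a') \<in> R"
      using P S map_poly_hom_diff[OF h, of 0 P] by (intro RI[of "- P"]) (auto simp: polys_over_uminus)
    show "a' dvd 1" if "a \<noteq> 0" using u P that by simp
  next
    fix a' assume "(0, a') \<in> R"
    then show "a' = 0" using z by (metis RE)
  qed (use that in blast)
  have c: "(y, h y) \<in> R" if "y \<in> S" for y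
    using that S by (intro RI[of "[:y:]"]) (auto simp: map_poly_pCons hom_onD[OF h])
  have x: "(x, b) \<in> R"
    using S by (intro RI[of "[:0, 1:]"]) (auto simp: map_poly_pCons hom_onD[OF h] subfldD)
  have "insert x S \<subseteq> fst ` R" using c x by force
  then have "hom_on (fld (insert x S)) h'" using h'(1) by (meson fld_mono hom_on_subset subfld_fld)
  then show ?thesis using h'(2) c x that by blast
qed

section \<open>Extending homomorphisms and derivations\<close>

text \<open>Division by \<open>m\<close> leaves a remainder in \<open>Z\<close> of smaller degree.
  \<open>Z\<close> is kept abstract because it serves both for the polynomials vanishing at
  \<open>x\<close> and for those whose image under \<open>h\<close> vanishes at
  \<open>b\<close>.\<close>

lemma ideal_principal:
  assumes S: "subfld S" and Z: "Z \<subseteq> polys_over S" and m: "m \<in> Z" "m \<noteq> 0"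
    and min: "\<And>P. P \<in> Z \<Longrightarrow> P \<noteq> 0 \<Longrightarrow> degree m \<le> degree P"
    and ideal: "\<And>P Q R. P \<in> Z \<Longrightarrow> Q \<in> Z \<Longrightarrow> R \<in> polys_over S \<Longrightarrow> P - R * Q \<in> Z"
    and P: "P \<in> Z"
  obtains Q where "Q \<in> polys_over S" "P = m * Q"
proof -
  have "\<exists>Q\<in>polys_over S. P = m * Q" using P
  proof (induction "degree P" arbitrary: P rule: less_induct)
    case less
    show ?case
    proof (cases "P = 0")
      case True
      then show ?thesis using S by (intro bexI[of _ 0]) auto
    next
      case False
      define R where "R = monom (lead_coeff P / lead_coeff m) (degree P - degree m)"
      have R: "R \<in> polys_over S"
        using less.prems m(1) Z S by (auto simp: R_def polys_over_def intro!: polys_over_monom subfldD(8,2))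
      have Z': "P - R * m \<in> Z" using ideal[OF less.prems m(1) R] .
      have c: "lead_coeff P / lead_coeff m \<noteq> 0" using False m by simp
      then have "R \<noteq> 0" by (simp add: R_def)
      have le: "degree m \<le> degree P" using min less.prems False by blast
      have d: "degree (R * m) = degree P"
        using le \<open>R \<noteq> 0\<close> m(2) c by (simp add: degree_mult_eq R_def degree_monom_eq)
      have lc: "lead_coeff (R * m) = lead_coeff P"
        using m(2) c by (simp add: lead_coeff_mult R_def degree_monom_eq)
      show ?thesis
      proof (cases "P - R * m = 0")
        case True
        then show ?thesis using R by (intro bexI[of _ R]) (auto simp: mult.commute)
      next
        case nz: False
        have "degree (P - R * m) \<le> degree P" using d degree_diff_le_max[of P "R * m"] by simp
        moreover have "coeff (P - R * m) (degree P) = 0" using d lc by simp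
        ultimately have "degree (P - R * m) < degree P"
          using nz by (metis leading_coeff_0_iff nat_less_le)
        from less.hyps[OF this Z'] obtain Q where "Q \<in> polys_over S" "P - R * m = m * Q" by blast
        then have "P = m * (Q + R)" "Q + R \<in> polys_over S"
          using R S by (auto simp: algebra_simps polys_over_add)
        then show ?thesis by blast
      qed
    qed
  qed
  then show ?thesis using that by blast
qed

lemma min_poly:
  assumes S: "subfld S" and x: "\<not> trans_over S x"
  obtains m where "m \<in> polys_over S" "m \<noteq> 0" "poly m x = 0"
    "\<And>P. P \<in> polys_over S \<Longrightarrow> poly P x = 0 \<Longrightarrow> P \<noteq> 0 \<Longrightarrow> degree m \<le> degree P"
    "\<And>P. P \<in> polys_over S \<Longrightarrow> poly P x = 0 \<Longrightarrow> \<exists>Q\<in>polys_over S. P = m * Q"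
proof -
  let ?A = "\<lambda>P. P \<in> polys_over S \<and> poly P x = 0 \<and> P \<noteq> 0"
  obtain P0 where "?A P0" using x by (auto simp: trans_over_def)
  define m where "m = arg_min degree ?A"
  have m: "?A m" and min: "\<And>P. ?A P \<Longrightarrow> degree m \<le> degree P"
    using arg_min_nat_lemma[of ?A P0 degree, OF \<open>?A P0\<close>] by (auto simp: m_def)
  have "\<exists>Q\<in>polys_over S. P = m * Q" if "P \<in> polys_over S" "poly P x = 0" for P
  proof (rule ideal_principal[of S "{P \<in> polys_over S. poly P x = 0}" m P])
    show "P - R * Q \<in> {P \<in> polys_over S. poly P x = 0}"
      if "P \<in> {P \<in> polys_over S. poly P x = 0}" "Q \<in> {P \<in> polys_over S. poly P x = 0}" "R \<in> polys_over S" for P Q R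
      using that S by (auto intro!: polys_over_diff polys_over_mult)
  qed (use S m min that in auto)
  then show ?thesis using m min that by blast
qed

text \<open>A transcendental \<open>x\<close> satisfies no relation that \<open>b\<close> would have
  to respect; transcendence of \<open>b\<close> over the image keeps nonzero polynomials
  nonzero.\<close>

lemma hom_extend_trans:
  fixes h :: "'a::field \<Rightarrow> 'b::field"
  assumes h: "hom_on S h" and x: "trans_over S x" and b: "trans_over (fld (h ` S)) b"
  obtains h' where "hom_on (fld (insert x S)) h'" "\<And>y. y \<in> S \<Longrightarrow> h' y = h y" "h' x = b"
proof (rule hom_extend[OF h, of x b])
  fix P assume P: "P \<in> polys_over S"
  { assume "poly P x = 0"
    then show "poly (map_poly h P) b = 0" using x P by (auto simp: trans_over_def) }
  { assume nz: "poly P x \<noteq> 0"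
    have "map_poly h P \<in> polys_over (fld (h ` S))"
      using P h by (auto simp: polys_over_def coeff_map_poly hom_onD intro!: fld.base)
    moreover have "map_poly h P \<noteq> 0"
    proof
      assume "map_poly h P = 0"
      then have "h (coeff P i) = 0" for i
        by (metis coeff_0 coeff_map_poly hom_onD(3)[OF h])
      then have "coeff P i = 0" for i using hom_on_inj[OF h] P by (auto simp: polys_over_def)
      then show False using nz by (metis poly_0 poly_eqI coeff_0)
    qed
    ultimately show "poly (map_poly h P) b dvd 1" using b by (auto simp: trans_over_def dvd_field_iff) }
qed (use that in blast)

text \<open>The new element is sent to a complex root \<open>b\<close> of the transported minimal
  polynomial. What needs proof is that no polynomial nonzero at \<open>x\<close> is transported to
  one that vanishes at \<open>b\<close>.\<close>

lemma hom_extend_alg_complex: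
  fixes h :: "'a::field_char_0 \<Rightarrow> complex"
  assumes h: "hom_on S h" and x: "\<not> trans_over S x"
  obtains h' where "hom_on (fld (insert x S)) h'" "\<And>y. y \<in> S \<Longrightarrow> h' y = h y"
proof -
  note S = hom_onD(1)[OF h]
  obtain m where m: "m \<in> polys_over S" "m \<noteq> 0" "poly m x = 0"
    "\<And>P. P \<in> polys_over S \<Longrightarrow> poly P x = 0 \<Longrightarrow> P \<noteq> 0 \<Longrightarrow> degree m \<le> degree P"
    "\<And>P. P \<in> polys_over S \<Longrightarrow> poly P x = 0 \<Longrightarrow> \<exists>Q\<in>polys_over S. P = m * Q"
    using min_poly[OF S x] by blast
  have hne: "h (lead_coeff m) \<noteq> 0" using hom_on_inj[OF h, of "lead_coeff m"] m by (auto simp: polys_over_def)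
  have "degree m \<noteq> 0"
  proof
    assume "degree m = 0"
    then obtain c where "m = [:c:]" by (metis degree_eq_zeroE)
    then show False using m by simp
  qed
  moreover have "coeff (map_poly h m) (degree m) \<noteq> 0" using hne by (simp add: coeff_map_poly hom_onD[OF h])
  ultimately have "degree (map_poly h m) \<noteq> 0" using le_degree by force
  then have "\<not> constant (poly (map_poly h m))" by (simp add: constant_degree)
  then obtain b where b: "poly (map_poly h m) b = 0" using fundamental_theorem_of_algebra by blast
  \<comment> \<open>A generator \<open>m2\<close> of this ideal divides \<open>m\<close>. If
    \<open>m2\<close> did not vanish at \<open>x\<close>, the cofactor would, and minimality of
    \<open>m\<close> would make \<open>m2\<close> a nonzero constant, which cannot vanish at
    \<open>b\<close>.\<close>
  let ?Z = "{P \<in> polys_over S. poly (map_poly h P) b = 0}"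
  let ?A = "\<lambda>P. P \<in> ?Z \<and> P \<noteq> 0"
  define m2 where "m2 = arg_min degree ?A"
  have "?A m" using m b by simp
  then have m2: "?A m2" and min2: "\<And>P. ?A P \<Longrightarrow> degree m2 \<le> degree P"
    using arg_min_nat_lemma[of ?A m degree, OF \<open>?A m\<close>] by (auto simp: m2_def)
  have dvd2: "\<exists>Q\<in>polys_over S. P = m2 * Q" if "P \<in> ?Z" for P
  proof (rule ideal_principal[of S ?Z m2 P])
    show "P - R * Q \<in> ?Z" if "P \<in> ?Z" "Q \<in> ?Z" "R \<in> polys_over S" for P Q R
      using that S map_poly_hom_diff[OF h, of P "R * Q"] map_poly_hom_mult[OF h, of R Q]
      by (auto intro!: polys_over_diff polys_over_mult simp: polys_over_mult)
  qed (use S m2 min2 that in auto)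
  have m2x: "poly m2 x = 0"
  proof (rule ccontr)
    assume nz: "poly m2 x \<noteq> 0"
    obtain R where R: "R \<in> polys_over S" "m = m2 * R" using dvd2[of m] \<open>?A m\<close> by blast
    then have "poly R x = 0" "R \<noteq> 0" using m nz by auto
    then have "degree m \<le> degree R" using m(4) R by blast
    then have "degree m2 = 0" using R m2 \<open>R \<noteq> 0\<close> by (auto simp: degree_mult_eq)
    then obtain c where c: "m2 = [:c:]" by (metis degree_eq_zeroE)
    then have "c \<in> S" "c \<noteq> 0" "h c = 0" using m2 S h by (auto simp: map_poly_pCons hom_onD)
    then show False using hom_on_inj[OF h] by blast
  qed
  show ?thesis
  proof (rule hom_extend[OF h, of x b])
    fix P assume P: "P \<in> polys_over S"
    { assume "poly P x = 0"
      then obtain Q where "Q \<in> polys_over S" "P = m * Q" using m(5) P by blast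
      then show "poly (map_poly h P) b = 0" using map_poly_hom_mult[OF h m(1)] b by simp }
    { assume "poly P x \<noteq> 0"
      then have "P \<notin> ?Z" using dvd2[of P] m2x by auto
      then show "poly (map_poly h P) b dvd 1" using P by (auto simp: dvd_field_iff) }
  qed (use that in blast)
qed

lemma uncountable_trans:
  assumes "countable S" "subfld (S :: complex set)"
  obtains b where "trans_over S b"
proof -
  have "{x. \<not> trans_over S x} \<noteq> (UNIV :: complex set)"
    using countable_algebraic[OF assms] uncountable_UNIV_complex by metis
  then show ?thesis using that by blast
qed

text \<open>Elements are adjoined one at a time. Countability is part of the induction, since a
  transcendental element needs a complex target transcendental over the image so far.\<close>

lemma hom_extend_complex:
  fixes h :: "'a::field_char_0 \<Rightarrow> complex"
  assumes "hom_on S h" "countable S" "finite X"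
  obtains T h' where "hom_on T h'" "countable T" "S \<union> X \<subseteq> T" "\<And>y. y \<in> S \<Longrightarrow> h' y = h y"
proof -
  have "\<exists>T h'. hom_on T h' \<and> countable T \<and> S \<union> X \<subseteq> T \<and> (\<forall>y\<in>S. h' y = h y)"
    using assms(3)
  proof induction
    case empty
    then show ?case using assms by auto
  next
    case (insert x X)
    then obtain T h' where T: "hom_on T h'" "countable T" "S \<union> X \<subseteq> T" "\<forall>y\<in>S. h' y = h y" by blast
    have "\<exists>h''. hom_on (fld (insert x T)) h'' \<and> (\<forall>y\<in>T. h'' y = h' y)"
    proof (cases "trans_over T x")
      case True
      have "countable (fld (h' ` T))" using T by (intro countable_fld) auto
      then obtain b where "trans_over (fld (h' ` T)) b" using uncountable_trans by (metis subfld_fld)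
      from hom_extend_trans[OF T(1) True this] show ?thesis by metis
    next
      case False
      from hom_extend_alg_complex[OF T(1) False] show ?thesis by metis
    qed
    then obtain h'' where h'': "hom_on (fld (insert x T)) h''" "\<forall>y\<in>T. h'' y = h' y" by blast
    have "countable (fld (insert x T))" using T by (intro countable_fld) auto
    moreover have "S \<union> insert x X \<subseteq> fld (insert x T)" using T fld_superset[of "insert x T"] by auto
    ultimately show ?case using h'' T by (intro exI[of _ "fld (insert x T)"] exI[of _ h'']) auto
  qed
  then show ?thesis using that by blast
qed

section \<open>Dual numbers and the extension of derivations\<close>

text \<open>\<open>Dual a b\<close> stands for \<open>a + b \<epsilon>\<close> with square-zero
  \<open>\<epsilon>\<close>.\<close>

datatype 'a dual = Dual (std: 'a) (eps: 'a)

instantiation dual :: (comm_ring_1) comm_ring_1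
begin
definition "0 = Dual 0 0"
definition "1 = Dual 1 0"
definition "x + y = Dual (std x + std y) (eps x + eps y)"
definition "x - y = Dual (std x - std y) (eps x - eps y)"
definition "- x = Dual (- std x) (- eps x)"
definition "x * y = Dual (std x * std y) (std x * eps y + std y * eps x)"
instance
  by standard
    (auto simp: zero_dual_def one_dual_def plus_dual_def minus_dual_def uminus_dual_def times_dual_def
      algebra_simps dual.expand)
end

lemmas dual_defs = zero_dual_def one_dual_def plus_dual_def minus_dual_def uminus_dual_def times_dual_def

lemma dual_unit:
  fixes x :: "'a::field dual"
  assumes "std x \<noteq> 0"
  shows "x dvd 1"
proof
  show "1 = x * Dual (inverse (std x)) (- eps x * inverse (std x)^2)"
    using assms by (auto simp: dual_defs field_simps power2_eq_square)
qed

text \<open>The product rule is multiplicativity of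
  \<open>x \<mapsto> x + \<delta> x \<epsilon>\<close>, so derivations extend by the results on
  homomorphisms.\<close>

definition deriv_on :: "'a::field set \<Rightarrow> ('a \<Rightarrow> 'a) \<Rightarrow> bool" where
  "deriv_on S \<delta> \<longleftrightarrow> hom_on S (\<lambda>x. Dual x (\<delta> x))"

lemma deriv_onD:
  assumes "deriv_on S \<delta>"
  shows "subfld S" "\<delta> 0 = 0" "\<delta> 1 = 0"
    "x \<in> S \<Longrightarrow> y \<in> S \<Longrightarrow> \<delta> (x + y) = \<delta> x + \<delta> y" "x \<in> S \<Longrightarrow> y \<in> S \<Longrightarrow> \<delta> (x - y) = \<delta> x - \<delta> y"
    "x \<in> S \<Longrightarrow> y \<in> S \<Longrightarrow> \<delta> (x * y) = x * \<delta> y + y * \<delta> x" "x \<in> S \<Longrightarrow> \<delta> (- x) = - \<delta> x"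
proof -
  note h = assms[unfolded deriv_on_def]
  show "subfld S" using hom_onD(1)[OF h] .
  show "\<delta> 0 = 0" "\<delta> 1 = 0" using hom_onD(2,3)[OF h] by (simp_all add: dual_defs)
  show "x \<in> S \<Longrightarrow> y \<in> S \<Longrightarrow> \<delta> (x + y) = \<delta> x + \<delta> y" "x \<in> S \<Longrightarrow> y \<in> S \<Longrightarrow> \<delta> (x - y) = \<delta> x - \<delta> y"
    "x \<in> S \<Longrightarrow> y \<in> S \<Longrightarrow> \<delta> (x * y) = x * \<delta> y + y * \<delta> x"
    using hom_onD(4,5,7)[OF h, of x y] by (simp_all add: dual_defs)
  show "x \<in> S \<Longrightarrow> \<delta> (- x) = - \<delta> x" using hom_onD(6)[OF h, of x] by (simp add: dual_defs)
qed

lemma deriv_on_sum: "deriv_on S \<delta> \<Longrightarrow> (\<And>i. i \<in> I \<Longrightarrow> f i \<in> S) \<Longrightarrow> \<delta> (sum f I) = (\<Sum>i\<in>I. \<delta> (f i))"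
  by (induction I rule: infinite_finite_induct) (auto simp: deriv_onD subfld_sum)

lemma deriv_on_zero: "subfld S \<Longrightarrow> deriv_on S (\<lambda>_. 0)"
  by (auto simp: deriv_on_def hom_on_def dual_defs)

lemma deriv_on_subset: "deriv_on T \<delta> \<Longrightarrow> subfld S \<Longrightarrow> S \<subseteq> T \<Longrightarrow> deriv_on S \<delta>"
  unfolding deriv_on_def by (rule hom_on_subset)

text \<open>First-order Taylor expansion: the infinitesimal part collects the derivatives of the
  coefficients and \<open>c\<close> times the formal derivative. It decides which values
  \<open>c\<close> a derivation may take at \<open>x\<close>.\<close>

lemma poly_map_dual:
  fixes S :: "'a::field_char_0 set"
  assumes "deriv_on S \<delta>" "P \<in> polys_over S"
  shows "poly (map_poly (\<lambda>x. Dual x (\<delta> x)) P) (Dual x c)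
    = Dual (poly P x) (poly (map_poly \<delta> P) x + c * poly (pderiv P) x)"
proof -
  note S = deriv_onD(1)[OF assms(1)]
  have 0: "Dual 0 (\<delta> 0) = 0" using deriv_onD(2)[OF assms(1)] by (simp add: dual_defs)
  show ?thesis using assms(2)
  proof (induction P)
    case 0
    then show ?case by (simp add: dual_defs)
  next
    case (pCons a P)
    then have "P \<in> polys_over S" using S by simp
    then show ?case
      using pCons.IH 0 deriv_onD(2)[OF assms(1)]
      by (simp add: map_poly_pCons pderiv_pCons) (simp add: dual_defs algebra_simps)
  qed
qed

lemma hom_on_fld_eq:
  assumes g: "hom_on (fld S) g" and g': "hom_on (fld S) g'" and eq: "\<And>x. x \<in> S \<Longrightarrow> g x = g' x" and x: "x \<in> fld S"
  shows "g x = g' x"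
  using x
proof induction
  case (inverse x)
  show ?case
  proof (cases "x = 0")
    case True
    then show ?thesis using inverse by simp
  next
    case False
    have "g x * g (inverse x) = 1" "g x * g' (inverse x) = 1"
      using hom_onD(8)[OF g inverse.hyps False] hom_onD(8)[OF g' inverse.hyps False] inverse.IH by auto
    then show ?thesis by (metis mult.assoc mult.commute mult_1)
  qed
qed (auto simp: eq hom_onD[OF g] hom_onD[OF g'])

text \<open>The standard part of \<open>h\<close> is itself a homomorphism fixing the generators,
  hence the identity on the generated field.\<close>

lemma deriv_of_dual_hom:
  fixes S :: "'a::field set"
  assumes h: "hom_on (fld S) h" and s: "\<And>x. x \<in> S \<Longrightarrow> std (h x) = x"
  shows "deriv_on (fld S) (\<lambda>x. eps (h x))"
proof -
  have 1: "hom_on (fld S) (\<lambda>x. std (h x))" using h by (auto simp: hom_on_def dual_defs)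
  have 2: "hom_on (fld S) (\<lambda>x. x)" by (simp add: hom_on_def)
  have "std (h x) = x" if "x \<in> fld S" for x using hom_on_fld_eq[OF 1 2 s that] .
  then show ?thesis unfolding deriv_on_def by (intro hom_on_cong[OF h]) (simp add: dual.expand)
qed

lemma deriv_extend_trans:
  fixes S :: "'a::field_char_0 set"
  assumes \<delta>: "deriv_on S \<delta>" and x: "trans_over S x"
  obtains \<delta>' where "deriv_on (fld (insert x S)) \<delta>'" "\<And>y. y \<in> S \<Longrightarrow> \<delta>' y = \<delta> y" "\<delta>' x = c"
proof -
  let ?h = "\<lambda>x. Dual x (\<delta> x)"
  have 0: "poly (map_poly ?h P) (Dual x c) = 0" if "P \<in> polys_over S" "poly P x = 0" for P
    using that x by (auto simp: trans_over_def)
  have 1: "poly (map_poly ?h P) (Dual x c) dvd 1" if "P \<in> polys_over S" "poly P x \<noteq> 0" for P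
    using that by (intro dual_unit) (simp add: poly_map_dual[OF \<delta>])
  obtain h' where h': "hom_on (fld (insert x S)) h'" "\<And>y. y \<in> S \<Longrightarrow> h' y = ?h y" "h' x = Dual x c"
    using hom_extend[OF \<delta>[unfolded deriv_on_def], of x "Dual x c"] 0 1 by blast
  have "deriv_on (fld (insert x S)) (\<lambda>x. eps (h' x))"
    using h'(2,3) by (intro deriv_of_dual_hom[OF h'(1)]) auto
  then show ?thesis using h' by (intro that[of "\<lambda>x. eps (h' x)"]) auto
qed

lemma deriv_extend_alg:
  fixes S :: "'a::field_char_0 set"
  assumes \<delta>: "deriv_on S \<delta>" and x: "\<not> trans_over S x"
  obtains \<delta>' where "deriv_on (fld (insert x S)) \<delta>'" "\<And>y. y \<in> S \<Longrightarrow> \<delta>' y = \<delta> y"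
proof -
  let ?h = "\<lambda>x. Dual x (\<delta> x)"
  note S = deriv_onD(1)[OF \<delta>]
  note h = \<delta>[unfolded deriv_on_def]
  obtain m where m: "m \<in> polys_over S" "m \<noteq> 0" "poly m x = 0"
    "\<And>P. P \<in> polys_over S \<Longrightarrow> poly P x = 0 \<Longrightarrow> P \<noteq> 0 \<Longrightarrow> degree m \<le> degree P"
    "\<And>P. P \<in> polys_over S \<Longrightarrow> poly P x = 0 \<Longrightarrow> \<exists>Q\<in>polys_over S. P = m * Q"
    using min_poly[OF S x] by blast
  have "degree m \<noteq> 0"
  proof
    assume "degree m = 0"
    then obtain c where "m = [:c:]" by (metis degree_eq_zeroE)
    then show False using m by simp
  qed
  then have "pderiv m \<noteq> 0" "degree (pderiv m) < degree m" by (auto simp: pderiv_eq_0_iff degree_pderiv)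
  then have nz: "poly (pderiv m) x \<noteq> 0" using m(4)[of "pderiv m"] polys_over_pderiv[OF S m(1)] by auto
  \<comment> \<open>The only value compatible with the minimal equation of \<open>x\<close>:
    differentiating it gives this linear equation for \<open>c\<close>, solvable because minimality
    and characteristic zero make the formal derivative nonzero at \<open>x\<close>.\<close>
  define c where "c = - poly (map_poly \<delta> m) x / poly (pderiv m) x"
  have root: "poly (map_poly ?h m) (Dual x c) = 0"
    using nz by (simp add: poly_map_dual[OF \<delta> m(1)] c_def m(3)) (simp add: dual_defs)
  have 0: "poly (map_poly ?h P) (Dual x c) = 0" if "P \<in> polys_over S" "poly P x = 0" for P
  proof -
    from m(5)[OF that] obtain Q where "Q \<in> polys_over S" "P = m * Q" by blast
    then show ?thesis using map_poly_hom_mult[OF h m(1)] root by simp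
  qed
  have 1: "poly (map_poly ?h P) (Dual x c) dvd 1" if "P \<in> polys_over S" "poly P x \<noteq> 0" for P
    using that by (intro dual_unit) (simp add: poly_map_dual[OF \<delta>])
  obtain h' where h': "hom_on (fld (insert x S)) h'" "\<And>y. y \<in> S \<Longrightarrow> h' y = ?h y" "h' x = Dual x c"
    using hom_extend[OF h, of x "Dual x c"] 0 1 by blast
  have "deriv_on (fld (insert x S)) (\<lambda>x. eps (h' x))"
    using h'(2,3) by (intro deriv_of_dual_hom[OF h'(1)]) auto
  then show ?thesis using h' by (intro that[of "\<lambda>x. eps (h' x)"]) auto
qed

text \<open>This brings any finitely many further numbers, such as the coordinates of an equivalent
  framework, into the domain of a given derivation.\<close>

lemma deriv_extend:
  fixes S :: "'a::field_char_0 set"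
  assumes "deriv_on S \<delta>" "finite X"
  obtains \<delta>' where "deriv_on (fld (S \<union> X)) \<delta>'" "\<And>y. y \<in> S \<Longrightarrow> \<delta>' y = \<delta> y"
proof -
  have "\<exists>\<delta>'. deriv_on (fld (S \<union> X)) \<delta>' \<and> (\<forall>y\<in>S. \<delta>' y = \<delta> y)"
    using assms(2)
  proof induction
    case empty
    have "fld S \<subseteq> S" using deriv_onD(1)[OF assms(1)] by (simp add: fld_least)
    then show ?case using assms(1) deriv_on_subset by (metis Un_empty_right subfld_fld)
  next
    case (insert x X)
    then obtain \<delta>' where d: "deriv_on (fld (S \<union> X)) \<delta>'" "\<forall>y\<in>S. \<delta>' y = \<delta> y" by blast
    have "\<exists>\<delta>''. deriv_on (fld (insert x (fld (S \<union> X)))) \<delta>'' \<and> (\<forall>y\<in>fld (S \<union> X). \<delta>'' y = \<delta>' y)"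
      using deriv_extend_alg[OF d(1)] deriv_extend_trans[OF d(1)] by metis
    then obtain \<delta>'' where d'': "deriv_on (fld (insert x (fld (S \<union> X)))) \<delta>''" "\<forall>y\<in>fld (S \<union> X). \<delta>'' y = \<delta>' y"
      by blast
    have "fld (S \<union> insert x X) \<subseteq> fld (insert x (fld (S \<union> X)))"
      using fld_superset[of "S \<union> X"] by (intro fld_mono) auto
    then have "deriv_on (fld (S \<union> insert x X)) \<delta>''" using d''(1) deriv_on_subset subfld_fld by blast
    moreover have "\<forall>y\<in>S. \<delta>'' y = \<delta> y" using d d'' fld_superset[of "S \<union> X"] by auto
    ultimately show ?case by blast
  qed
  then show ?thesis using that by blast
qed

text \<open>Were \<open>x\<close> algebraic, differentiating its minimal equation, whose
  coefficients \<delta> kills, would give \<open>m'(x) * \<delta> x = 0\<close> with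
  \<open>m'(x) \<noteq> 0\<close>. Freedom of derivations is thereby turned back into
  transcendence.\<close>

lemma trans_over_if_deriv:
  fixes S :: "'a::field_char_0 set"
  assumes \<delta>: "deriv_on T \<delta>" and S: "subfld S" "S \<subseteq> T" and x: "x \<in> T"
    and 0: "\<And>y. y \<in> S \<Longrightarrow> \<delta> y = 0" and 1: "\<delta> x \<noteq> 0"
  shows "trans_over S x"
proof (rule ccontr)
  assume "\<not> trans_over S x"
  then obtain m where m: "m \<in> polys_over S" "m \<noteq> 0" "poly m x = 0"
    "\<And>P. P \<in> polys_over S \<Longrightarrow> poly P x = 0 \<Longrightarrow> P \<noteq> 0 \<Longrightarrow> degree m \<le> degree P"
    using min_poly[OF S(1)] by metis
  have "degree m \<noteq> 0"
  proof
    assume "degree m = 0"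
    then obtain c where "m = [:c:]" by (metis degree_eq_zeroE)
    then show False using m by simp
  qed
  then have "pderiv m \<noteq> 0" "degree (pderiv m) < degree m" by (auto simp: pderiv_eq_0_iff degree_pderiv)
  then have nz: "poly (pderiv m) x \<noteq> 0" using m(4)[of "pderiv m"] polys_over_pderiv[OF S(1) m(1)] by auto
  have pair_form: "\<delta> (poly P x) = poly (pderiv P) x * \<delta> x" if "P \<in> polys_over S" for P
    using that
  proof (induction P)
    case 0
    then show ?case by (simp add: deriv_onD[OF \<delta>])
  next
    case (pCons a P)
    have P: "P \<in> polys_over S" and a: "a \<in> S" using pCons.prems S by auto
    then have "poly P x \<in> T" using S(2) x deriv_onD(1)[OF \<delta>] by (intro poly_in_subfld) (auto simp: polys_over_def)
    then show ?case
      using pCons.IH[OF P] a S(2) x 0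
      by (simp add: deriv_onD[OF \<delta>] subfldD(4)[OF deriv_onD(1)[OF \<delta>]] subset_iff pderiv_pCons algebra_simps)
  qed
  show False using pair_form[OF m(1)] m(3) nz 1 deriv_onD(2)[OF \<delta>] by simp
qed

section \<open>Generic families\<close>

text \<open>Genericity speaks of coefficient functions, while the ring generated by a family is
  handled through expressions that can be evaluated in every commutative ring. Denominators enter
  only with the passage to fractions.\<close>

datatype 'i pexp = PConst int | PVar 'i | PAdd "'i pexp" "'i pexp" | PMult "'i pexp" "'i pexp"

primrec peval :: "('i \<Rightarrow> 'b::comm_ring_1) \<Rightarrow> 'i pexp \<Rightarrow> 'b" where
  "peval x (PConst k) = of_int k"
| "peval x (PVar i) = x i"
| "peval x (PAdd a b) = peval x a + peval x b"
| "peval x (PMult a b) = peval x a * peval x b"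

primrec pnf :: "'i pexp \<Rightarrow> (int \<times> ('i \<Rightarrow> nat)) list" where
  "pnf (PConst k) = [(k, \<lambda>_. 0)]"
| "pnf (PVar i) = [(1, \<lambda>j. if j = i then 1 else 0)]"
| "pnf (PAdd a b) = pnf a @ pnf b"
| "pnf (PMult a b) = concat (map (\<lambda>(k, m). map (\<lambda>(l, n). (k * l, \<lambda>i. m i + n i)) (pnf b)) (pnf a))"

definition mono_eval :: "('i::finite \<Rightarrow> 'b::comm_ring_1) \<Rightarrow> ('i \<Rightarrow> nat) \<Rightarrow> 'b" where
  "mono_eval x m = (\<Prod>i\<in>UNIV. x i ^ m i)"

lemma mono_eval_add: "mono_eval x (\<lambda>i. m i + n i) = mono_eval x m * mono_eval x n"
  by (simp add: mono_eval_def power_add prod.distrib)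

lemma peval_pnf: "peval x e = (\<Sum>(k, m)\<leftarrow>pnf e. of_int k * mono_eval x m)"
proof (induction e)
  case (PVar i)
  have "mono_eval x (\<lambda>j. if j = i then 1 else 0) = (\<Prod>j\<in>UNIV. if j = i then x j else 1)"
    unfolding mono_eval_def by (rule prod.cong) auto
  then show ?case by (simp add: prod.delta)
next
  case (PMult a b)
  have inner: "(\<Sum>(l, n)\<leftarrow>map (\<lambda>(l, n). (k * l, \<lambda>i. m i + n i)) L. of_int l * mono_eval x n)
     = of_int k * mono_eval x m * (\<Sum>(l, n)\<leftarrow>L. of_int l * mono_eval x n)" for k m L
    by (induction L) (auto simp: mono_eval_add algebra_simps)
  have "(\<Sum>(k, m)\<leftarrow>concat (map (\<lambda>(k, m). map (\<lambda>(l, n). (k * l, \<lambda>i. m i + n i)) M) L). of_int k * mono_eval x m)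
     = (\<Sum>(k, m)\<leftarrow>L. of_int k * mono_eval x m) * (\<Sum>(k, m)\<leftarrow>M. of_int k * mono_eval x m)" for L M
  proof (induction L)
    case (Cons p L)
    obtain k m where "p = (k, m)" by (cases p)
    then show ?case using Cons inner[of k m M] by (simp add: distrib_right)
  qed simp
  then show ?case using PMult by simp
qed (simp_all add: mono_eval_def)

definition list_coeff :: "(int \<times> ('i \<Rightarrow> nat)) list \<Rightarrow> ('i \<Rightarrow> nat) \<Rightarrow> int" where
  "list_coeff L m = (\<Sum>(k, n)\<leftarrow>L. if n = m then k else 0)"

lemma sum_list_coeff:
  fixes x :: "'i::finite \<Rightarrow> 'b::comm_ring_1"
  assumes "finite M" "snd ` set L \<subseteq> M"
  shows "(\<Sum>(k, m)\<leftarrow>L. of_int k * mono_eval x m) = (\<Sum>m\<in>M. of_int (list_coeff L m) * mono_eval x m)"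
  using assms(2)
proof (induction L)
  case Nil
  then show ?case by (simp add: list_coeff_def)
next
  case (Cons p L)
  obtain k n where p: "p = (k, n)" by (cases p)
  have "(\<Sum>m\<in>M. of_int (list_coeff (p # L) m) * mono_eval x m)
    = (\<Sum>m\<in>M. (if n = m then of_int k * mono_eval x m else 0) + of_int (list_coeff L m) * mono_eval x m)"
    by (rule sum.cong) (auto simp: p list_coeff_def algebra_simps)
  also have "\<dots> = of_int k * mono_eval x n + (\<Sum>m\<in>M. of_int (list_coeff L m) * mono_eval x m)"
    using Cons.prems assms(1) p by (simp add: sum.distrib)
  finally show ?case using Cons p by simp
qed

text \<open>After collecting monomials, vanishing at a generic point makes every coefficient zero,
  so \<open>e\<close> is a polynomial identity and holds in every commutative ring, dual numbers
  included.\<close>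

lemma generic_peval_eq_0:
  fixes p :: "'i::finite \<Rightarrow> 'a::field_char_0" and x :: "'i \<Rightarrow> 'b::comm_ring_1"
  assumes "generic_family p" "peval p e = 0"
  shows "peval x e = 0"
proof -
  let ?M = "snd ` set (pnf e)"
  let ?c = "\<lambda>m. rat_of_int (list_coeff (pnf e) m)"
  have M: "finite ?M" by simp
  have sup: "{m. ?c m \<noteq> 0} \<subseteq> ?M"
  proof
    fix m assume "m \<in> {m. ?c m \<noteq> 0}"
    then have "list_coeff (pnf e) m \<noteq> 0" by simp
    moreover have "list_coeff L m = 0" if "m \<notin> snd ` set L" for L :: "(int \<times> ('i \<Rightarrow> nat)) list"
      using that by (induction L) (auto simp: list_coeff_def)
    ultimately show "m \<in> ?M" by blast
  qed
  have "rat_poly_eval ?c p = (\<Sum>m\<in>?M. of_int (list_coeff (pnf e) m) * mono_eval p m)"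
    unfolding rat_poly_eval_def mono_eval_def[symmetric]
    using sup M by (intro sum.mono_neutral_cong_left) auto
  also have "\<dots> = 0" using assms(2) sum_list_coeff[OF M, of "pnf e" p] peval_pnf[of p e] by simp
  finally have "\<not> (finite {m. ?c m \<noteq> 0} \<and> (\<exists>m. ?c m \<noteq> 0))"
    using assms(1)[unfolded generic_family_def, THEN spec, of ?c] by blast
  then have "?c m = 0" for m using finite_subset[OF sup M] by blast
  then have "list_coeff (pnf e) m = 0" for m by (simp only: of_int_eq_0_iff)
  then show ?thesis using sum_list_coeff[OF M, of "pnf e" x] peval_pnf[of x e] by simp
qed

text \<open>Algebraic independence leaves no relation among the \<open>p i\<close>, so their images
  can be prescribed freely; \<open>unit\<close> allows the passage to the fraction field.\<close>

lemma generic_hom: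
  fixes p :: "'i::finite \<Rightarrow> 'a::field_char_0" and x :: "'i \<Rightarrow> 'b::comm_ring_1"
  assumes p: "generic_family p" and unit: "\<And>e. peval p e \<noteq> 0 \<Longrightarrow> peval x e dvd 1"
  obtains h where "hom_on (fld (range p)) h" "\<And>i. h (p i) = x i"
proof -
  define R where "R = range (\<lambda>e. (peval p e, peval x e))"
  have RE: "\<exists>e. a = peval p e \<and> a' = peval x e" if "(a, a') \<in> R" for a a'
    using that by (auto simp: R_def)
  have RI: "(a, a') \<in> R" if "a = peval p e" "a' = peval x e" for a a' e
    using that by (auto simp: R_def)
  obtain h where h: "hom_on (fld (fst ` R)) h" "\<And>a a'. (a, a') \<in> R \<Longrightarrow> h a = a'"
  proof (rule fraction_hom[of R])
    show "(1, 1) \<in> R" by (rule RI[of _ "PConst 1"]) auto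
  next
    fix a a' c c' assume "(a, a') \<in> R" "(c, c') \<in> R"
    then obtain e f where "a = peval p e" "a' = peval x e" "c = peval p f" "c' = peval x f" by (meson RE)
    then show "(a + c, a' + c') \<in> R" "(a * c, a' * c') \<in> R"
      using RI[of _ "PAdd e f"] RI[of _ "PMult e f"] by simp_all
  next
    fix a a' assume "(a, a') \<in> R"
    then obtain e where e: "a = peval p e" "a' = peval x e" by (meson RE)
    show "(- a, - a') \<in> R" using e RI[of _ "PMult (PConst (-1)) e"] by simp
    show "a' dvd 1" if "a \<noteq> 0" using unit e that by simp
  next
    fix a' assume "(0, a') \<in> R"
    then show "a' = 0" using generic_peval_eq_0[OF p] by (metis RE)
  qed (use that in blast)
  have r: "(p i, x i) \<in> R" for i by (rule RI[of _ "PVar i"]) auto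
  then have "range p \<subseteq> fst ` R" by force
  then have "hom_on (fld (range p)) h" using h(1) by (meson fld_mono hom_on_subset subfld_fld)
  then show ?thesis using h(2)[OF r] that by blast
qed

lemma generic_transfer:
  fixes p :: "'i::finite \<Rightarrow> 'a::field_char_0" and q :: "'i \<Rightarrow> 'b::field_char_0"
  assumes "generic_family p" "generic_family q"
  obtains h where "hom_on (fld (range p)) h" "\<And>i. h (p i) = q i"
  using generic_hom[OF assms(1), of q] generic_peval_eq_0[OF assms(2), where x = p]
  by (metis dvd_field_iff one_neq_zero)

text \<open>Evaluation at the dual point \<open>p + u \<epsilon>\<close>: an expression nonzero at
  \<open>p\<close> has nonzero standard part there and is a unit.\<close>

lemma generic_deriv:
  fixes p u :: "'i::finite \<Rightarrow> 'a::field_char_0"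
  assumes "generic_family p"
  obtains \<delta> where "deriv_on (fld (range p)) \<delta>" "\<And>i. \<delta> (p i) = u i"
proof -
  let ?x = "\<lambda>i. Dual (p i) (u i)"
  have int: "std (of_int k :: 'a dual) = of_int k" for k
  proof -
    have nat: "std (of_nat n :: 'a dual) = of_nat n" for n by (induction n) (auto simp: dual_defs)
    show ?thesis by (cases k rule: int_cases2) (auto simp: nat dual_defs)
  qed
  have std: "std (peval ?x e) = peval p e" for e
    by (induction e) (auto simp: int plus_dual_def times_dual_def)
  obtain h where h: "hom_on (fld (range p)) h" "\<And>i. h (p i) = ?x i"
    using generic_hom[OF assms, of ?x] dual_unit std by metis
  have "deriv_on (fld (range p)) (\<lambda>x. eps (h x))"
    using h(2) by (intro deriv_of_dual_hom[OF h(1)]) auto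
  then show ?thesis using h(2) by (intro that[of "\<lambda>x. eps (h x)"]) auto
qed

section \<open>Existence and abundance of generic points\<close>

lemma countable_finite_support:
  "countable {c :: ('i::finite \<Rightarrow> nat) \<Rightarrow> rat. finite {m. c m \<noteq> 0}}"
proof -
  let ?g = "\<lambda>c :: ('i \<Rightarrow> nat) \<Rightarrow> rat. (\<lambda>m. (m, c m)) ` {m. c m \<noteq> 0}"
  have "countable {F :: (('i \<Rightarrow> nat) \<times> rat) set. finite F}" by (rule countable_Collect_finite)
  moreover have "?g ` {c. finite {m. c m \<noteq> 0}} \<subseteq> {F. finite F}" by auto
  ultimately have "countable (?g ` {c. finite {m. c m \<noteq> 0}})" by (rule countable_subset[rotated])
  moreover have "inj_on ?g {c. finite {m. c m \<noteq> 0}}"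
  proof (rule inj_onI, rule ext)
    fix c d m assume eq: "?g c = ?g d"
    have "(m, r) \<in> ?g c \<longleftrightarrow> c m = r \<and> r \<noteq> 0" "(m, r) \<in> ?g d \<longleftrightarrow> d m = r \<and> r \<noteq> 0" for r by auto
    then have "(c m = r \<and> r \<noteq> 0) = (d m = r \<and> r \<noteq> 0)" for r using eq by simp
    from this[of "c m"] this[of "d m"] show "c m = d m" by auto
  qed
  ultimately show ?thesis by (rule countable_image_inj_on)
qed

text \<open>On the line a nonzero rational polynomial becomes a polynomial in \<open>s\<close> that
  is nonzero at \<open>s = 0\<close>, so each excludes finitely many \<open>s\<close>. The other end
  \<open>o'\<close> is arbitrary, hence generic points exist close to any given point.\<close>

lemma generic_line:
  fixes p o' :: "'i::finite \<Rightarrow> 'a::field_char_0"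
  assumes p: "generic_family p"
  shows "countable {s. \<not> generic_family (\<lambda>i. (1 - s) * p i + s * o' i)}"
proof -
  let ?C = "{c :: ('i \<Rightarrow> nat) \<Rightarrow> rat. finite {m. c m \<noteq> 0} \<and> (\<exists>m. c m \<noteq> 0)}"
  define Q where "Q c = (\<Sum>m\<in>{m. c m \<noteq> 0}. [:of_rat (c m):] * (\<Prod>i\<in>UNIV. [:p i, o' i - p i:] ^ m i))" for c :: "('i \<Rightarrow> nat) \<Rightarrow> rat"
  have Q: "poly (Q c) s = rat_poly_eval c (\<lambda>i. (1 - s) * p i + s * o' i)" for c s
    by (simp add: Q_def rat_poly_eval_def poly_sum poly_prod algebra_simps)
  have nz: "Q c \<noteq> 0" if "c \<in> ?C" for c
  proof
    assume "Q c = 0"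
    then have "rat_poly_eval c p = 0" using Q[of c 0] by simp
    then show False using p that by (auto simp: generic_family_def)
  qed
  have "{s. \<not> generic_family (\<lambda>i. (1 - s) * p i + s * o' i)} \<subseteq> (\<Union>c\<in>?C. {s. poly (Q c) s = 0})"
    by (auto simp: generic_family_def Q)
  moreover have "countable \<dots>"
  proof (rule countable_UN)
    show "countable ?C" by (rule countable_subset[OF _ countable_finite_support]) auto
    show "countable {s. poly (Q c) s = 0}" if "c \<in> ?C" for c
      using nz[OF that] by (simp add: countable_finite poly_roots_finite)
  qed
  ultimately show ?thesis by (rule countable_subset)
qed

text \<open>Induction on the occurring variables: one variable is fixed so as to avoid countably
  many roots, and the substituted polynomials stay nonzero. Coefficients are real because the
  substituted value enters them.\<close>

lemma exists_nonzero_value: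
  fixes C :: "(('i::finite \<Rightarrow> nat) \<Rightarrow> real) set"
  assumes "finite F" "countable C"
    and "\<And>c. c \<in> C \<Longrightarrow> finite {m. c m \<noteq> 0} \<and> (\<exists>m. c m \<noteq> 0) \<and> (\<forall>m i. c m \<noteq> 0 \<longrightarrow> i \<notin> F \<longrightarrow> m i = 0)"
  shows "\<exists>x. \<forall>c\<in>C. (\<Sum>m\<in>{m. c m \<noteq> 0}. c m * mono_eval x m) \<noteq> 0"
  using assms
proof (induction F arbitrary: C)
  case empty
  have "(\<Sum>m\<in>{m. c m \<noteq> 0}. c m * mono_eval (\<lambda>_. 0) m) \<noteq> 0" if "c \<in> C" for c
  proof -
    have "{m. c m \<noteq> 0} = {\<lambda>_. 0}" using empty(2)[OF that] by (auto simp: fun_eq_iff)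
    moreover from this have "c (\<lambda>_. 0) \<noteq> 0" by blast
    ultimately show ?thesis by (simp add: mono_eval_def)
  qed
  then show ?case by blast
next
  case (insert i F)
  \<comment> \<open>A chosen monomial of \<open>c\<close>. The coefficients of \<open>c\<close>
    along the line through it in direction \<open>i\<close> form the nonzero univariate polynomial
    \<open>q c\<close>; if \<open>s\<close> is not a root, a coefficient of the substituted
    polynomial \<open>r c\<close> survives.\<close>
  define mc where "mc c = (SOME m. c m \<noteq> 0)" for c :: "('i \<Rightarrow> nat) \<Rightarrow> real"
  have mc: "c (mc c) \<noteq> 0" if "c \<in> C" for c using someI_ex[of "\<lambda>m. c m \<noteq> 0"] insert.prems(2)[OF that] unfolding mc_def by blast
  have finK: "finite {k. c (m(i := k)) \<noteq> 0}" if "c \<in> C" for c m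
  proof -
    have "inj_on (\<lambda>k. m(i := k)) {k. c (m(i := k)) \<noteq> 0}" by (rule inj_onI) (metis fun_upd_same)
    moreover have "finite ((\<lambda>k. m(i := k)) ` {k. c (m(i := k)) \<noteq> 0})"
      by (rule finite_subset[of _ "{m. c m \<noteq> 0}"]) (use insert.prems(2)[OF that] in auto)
    ultimately show ?thesis using finite_imageD by blast
  qed
  define q where "q c = (\<Sum>k\<in>{k. c ((mc c)(i := k)) \<noteq> 0}. monom (c ((mc c)(i := k))) k)" for c
  have qc: "coeff (q c) (mc c i) = c (mc c)" if "c \<in> C" for c
    unfolding q_def coeff_sum coeff_monom using finK[OF that] by (simp add: sum.delta if_distrib fun_upd_triv cong: if_cong)
  have "countable (\<Union>c\<in>C. {s. poly (q c) s = 0})"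
  proof (rule countable_UN[OF insert.prems(1)])
    fix c assume "c \<in> C"
    then have "q c \<noteq> 0" using qc mc by (metis coeff_0)
    then show "countable {s. poly (q c) s = 0}" by (simp add: countable_finite poly_roots_finite)
  qed
  then have "(\<Union>c\<in>C. {s. poly (q c) s = 0}) \<noteq> UNIV" using uncountable_UNIV_real by metis
  then obtain s where s: "poly (q c) s \<noteq> 0" if "c \<in> C" for c by auto
  define r where "r c m = (if m i = 0 then \<Sum>k\<in>{k. c (m(i := k)) \<noteq> 0}. c (m(i := k)) * s ^ k else 0)" for c m
  have rsub: "{m. r c m \<noteq> 0} \<subseteq> (\<lambda>m. m(i := 0)) ` {m. c m \<noteq> 0}" for c
  proof
    fix m assume "m \<in> {m. r c m \<noteq> 0}"
    then have m0: "m i = 0" and "(\<Sum>k\<in>{k. c (m(i := k)) \<noteq> 0}. c (m(i := k)) * s ^ k) \<noteq> 0"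
      by (auto simp: r_def split: if_splits)
    then obtain k where "c (m(i := k)) \<noteq> 0" by (metis (mono_tags, lifting) mem_Collect_eq sum.not_neutral_contains_not_neutral)
    moreover have "m = (m(i := k))(i := 0)" using m0 by (simp add: fun_eq_iff)
    ultimately show "m \<in> (\<lambda>m. m(i := 0)) ` {m. c m \<noteq> 0}" by (metis (mono_tags) image_eqI mem_Collect_eq)
  qed
  have fin: "finite ((\<lambda>m. m(i := 0)) ` {m. c m \<noteq> 0})" if "c \<in> C" for c using insert.prems(2)[OF that] by auto
  have "\<exists>x. \<forall>c\<in>r ` C. (\<Sum>m\<in>{m. c m \<noteq> 0}. c m * mono_eval x m) \<noteq> 0"
  proof (rule insert.IH)
    show "countable (r ` C)" using insert.prems by simp
    fix c' assume "c' \<in> r ` C"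
    then obtain c where c: "c \<in> C" "c' = r c" by blast
    have "finite {m. r c m \<noteq> 0}" using finite_subset[OF rsub fin[OF c(1)]] .
    moreover have "r c ((mc c)(i := 0)) = poly (q c) s"
      by (simp add: r_def q_def poly_sum poly_monom)
    then have "\<exists>m. r c m \<noteq> 0" using s[OF c(1)] by metis
    moreover have "m j = 0" if "r c m \<noteq> 0" "j \<notin> F" for m j
    proof (cases "j = i")
      case True then show ?thesis using that by (auto simp: r_def split: if_splits)
    next
      case False
      from rsub[of c] that(1) obtain m' where "c m' \<noteq> 0" "m = m'(i := 0)" by blast
      then show ?thesis using insert.prems(2)[OF c(1)] that(2) False by auto
    qed
    ultimately show "finite {m. c' m \<noteq> 0} \<and> (\<exists>m. c' m \<noteq> 0) \<and> (\<forall>m i. c' m \<noteq> 0 \<longrightarrow> i \<notin> F \<longrightarrow> m i = 0)"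
      using c by blast
  qed
  then obtain x where x: "\<forall>c\<in>C. (\<Sum>m\<in>{m. r c m \<noteq> 0}. r c m * mono_eval x m) \<noteq> 0" by auto
  have me: "mono_eval (x(i := s)) m = s ^ m i * mono_eval x (m(i := 0))" for m
  proof -
    have rem: "mono_eval y n = y i ^ n i * (\<Prod>j\<in>UNIV - {i}. y j ^ n j)" for y :: "'i \<Rightarrow> real" and n
      unfolding mono_eval_def by (rule prod.remove) auto
    have "(\<Prod>j\<in>UNIV - {i}. (x(i := s)) j ^ m j) = (\<Prod>j\<in>UNIV - {i}. x j ^ (m(i := 0)) j)"
      by (rule prod.cong) auto
    then show ?thesis using rem[of "x(i := s)" m] rem[of x "m(i := 0)"] by simp
  qed
  have "(\<Sum>m\<in>{m. c m \<noteq> 0}. c m * mono_eval (x(i := s)) m) = (\<Sum>m\<in>{m. r c m \<noteq> 0}. r c m * mono_eval x m)" if c: "c \<in> C" for c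
  proof -
    let ?A = "{m. c m \<noteq> 0}" and ?g = "\<lambda>m :: 'i \<Rightarrow> nat. m(i := 0)"
    have "(\<Sum>m\<in>?A. c m * mono_eval (x(i := s)) m) = (\<Sum>m'\<in>?g ` ?A. \<Sum>m\<in>{m \<in> ?A. ?g m = m'}. c m * mono_eval (x(i := s)) m)"
      using insert.prems(2)[OF c] by (intro sum.image_gen) auto
    also have "\<dots> = (\<Sum>m'\<in>?g ` ?A. r c m' * mono_eval x m')"
    proof (rule sum.cong[OF refl])
      fix m' assume "m' \<in> ?g ` ?A"
      then have 0: "m' i = 0" by auto
      have "(\<Sum>m\<in>{m \<in> ?A. ?g m = m'}. c m * mono_eval (x(i := s)) m)
        = (\<Sum>k\<in>{k. c (m'(i := k)) \<noteq> 0}. c (m'(i := k)) * s ^ k * mono_eval x m')"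
      proof (rule sum.reindex_bij_witness[of _ "\<lambda>k. m'(i := k)" "\<lambda>m. m i"])
        fix m assume m: "m \<in> {m \<in> ?A. ?g m = m'}"
        then show "m'(i := m i) = m" by auto
        then show "m i \<in> {k. c (m'(i := k)) \<noteq> 0}" using m by auto
        show "c (m'(i := m i)) * s ^ m i * mono_eval x m' = c m * mono_eval (x(i := s)) m"
          using \<open>m'(i := m i) = m\<close> m me[of m] by simp
      next
        fix k assume k: "k \<in> {k. c (m'(i := k)) \<noteq> 0}"
        show "(m'(i := k)) i = k" by simp
        show "m'(i := k) \<in> {m \<in> ?A. ?g m = m'}" using k 0 by (auto simp: fun_upd_idem)
      qed
      then show "(\<Sum>m\<in>{m \<in> ?A. ?g m = m'}. c m * mono_eval (x(i := s)) m) = r c m' * mono_eval x m'"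
        using 0 by (simp add: r_def sum_distrib_right)
    qed
    also have "\<dots> = (\<Sum>m\<in>{m. r c m \<noteq> 0}. r c m * mono_eval x m)"
      using rsub[of c] fin[OF c] by (intro sum.mono_neutral_right) auto
    finally show ?thesis .
  qed
  then have "\<forall>c\<in>C. (\<Sum>m\<in>{m. c m \<noteq> 0}. c m * mono_eval (x(i := s)) m) \<noteq> 0" using x by (simp del: fun_upd_apply)
  then show ?case by blast
qed

lemma exists_generic_real: "\<exists>p :: 'i::finite \<Rightarrow> real. generic_family p"
proof -
  let ?C = "{c :: ('i \<Rightarrow> nat) \<Rightarrow> rat. finite {m. c m \<noteq> 0} \<and> (\<exists>m. c m \<noteq> 0)}"
  have "countable ?C" by (rule countable_subset[OF _ countable_finite_support]) auto
  then have "\<exists>x. \<forall>c\<in>(\<lambda>c m. real_of_rat (c m)) ` ?C. (\<Sum>m\<in>{m. c m \<noteq> 0}. c m * mono_eval x m) \<noteq> 0"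
    by (intro exists_nonzero_value[of UNIV]) auto
  then obtain x :: "'i \<Rightarrow> real" where "\<forall>c\<in>?C. (\<Sum>m\<in>{m. c m \<noteq> 0}. of_rat (c m) * mono_eval x m) \<noteq> 0" by auto
  then have "generic_family x" by (auto simp: generic_family_def rat_poly_eval_def mono_eval_def)
  then show ?thesis by blast
qed

lemma generic_of_real: "generic_family (\<lambda>i. complex_of_real (x i)) \<longleftrightarrow> generic_family x"
proof -
  have "complex_of_real (of_rat r) = of_rat r" for r
    by (cases r) (simp add: of_rat_rat)
  then have "rat_poly_eval c (\<lambda>i. complex_of_real (x i)) = of_real (rat_poly_eval c x)" for c
    by (simp add: rat_poly_eval_def)
  then show ?thesis by (simp add: generic_family_def)
qed

section \<open>Independent parameters and their specialization\<close>

text \<open>Algebraic independence of the \<open>c i\<close> over \<open>D\<close>, in the form in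
  which it is applied: every derivation of \<open>D\<close> extends with arbitrary values on
  them.\<close>

definition deriv_free :: "'a::field set \<Rightarrow> ('k \<Rightarrow> 'a) \<Rightarrow> 'k set \<Rightarrow> bool" where
  "deriv_free D c I \<longleftrightarrow> (\<forall>\<delta> v. deriv_on D \<delta> \<longrightarrow>
     (\<exists>\<delta>'. deriv_on (fld (D \<union> c ` I)) \<delta>' \<and> (\<forall>y\<in>D. \<delta>' y = \<delta> y) \<and> (\<forall>i\<in>I. \<delta>' (c i) = v i)))"

lemma exists_trans_real:
  assumes "countable S" "subfld (S :: real set)" "a < b"
  obtains x where "a < x" "x < b" "trans_over S x"
proof -
  have "\<not> {a<..<b} \<subseteq> {x. \<not> trans_over S x}"
    using countable_subset[OF _ countable_algebraic[OF assms(1,2)]] uncountable_open_interval[of a b] assms(3) by blast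
  then show ?thesis using that by auto
qed

text \<open>Each parameter is taken transcendental over the countable field generated so far. Only
  countably many numbers are excluded, so every interval contains a choice.\<close>

lemma exists_deriv_free:
  fixes D :: "real set"
  assumes "finite I" "countable D" "subfld D" "\<And>i. i \<in> I \<Longrightarrow> lo i < hi i"
  shows "\<exists>c. deriv_free D c I \<and> (\<forall>i\<in>I. lo i < c i \<and> c i < hi i)"
  using assms
proof (induction I arbitrary: D)
  case empty
  have "fld D \<subseteq> D" using empty by (simp add: fld_least)
  then have "deriv_free D c {}" for c :: "'a \<Rightarrow> real"
    unfolding deriv_free_def using deriv_on_subset[OF _ subfld_fld] by (metis empty_iff image_empty sup_bot.right_neutral)
  then show ?case by blast
next
  case (insert i I)
  obtain x where x: "lo i < x" "x < hi i" "trans_over D x"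
    using exists_trans_real insert.prems by (metis insertI1)
  let ?D = "fld (insert x D)"
  have "countable ?D" using insert.prems by (simp add: countable_fld)
  then obtain c where c: "deriv_free ?D c I" "\<forall>i\<in>I. lo i < c i \<and> c i < hi i"
    using insert.IH[of ?D] insert.prems by auto
  let ?c = "c(i := x)"
  have im: "?c ` insert i I = insert x (c ` I)" using insert.hyps by (auto simp: image_iff)
  have "deriv_free D ?c (insert i I)"
    unfolding deriv_free_def
  proof (intro allI impI)
    fix \<delta> v assume "deriv_on D \<delta>"
    then obtain d1 where d1: "deriv_on ?D d1" "\<And>y. y \<in> D \<Longrightarrow> d1 y = \<delta> y" "d1 x = v i"
      using deriv_extend_trans[OF _ x(3)] by metis
    then obtain d2 where d2: "deriv_on (fld (?D \<union> c ` I)) d2" "\<forall>y\<in>?D. d2 y = d1 y" "\<forall>i\<in>I. d2 (c i) = v i"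
      using c(1) unfolding deriv_free_def by metis
    have "D \<union> ?c ` insert i I \<subseteq> ?D \<union> c ` I"
      unfolding im using fld_superset[of "insert x D"] by blast
    then have "fld (D \<union> ?c ` insert i I) \<subseteq> fld (?D \<union> c ` I)" by (rule fld_mono)
    then have "deriv_on (fld (D \<union> ?c ` insert i I)) d2" using deriv_on_subset[OF d2(1)] by simp
    moreover have "\<forall>y\<in>D. d2 y = \<delta> y" "d2 x = v i"
      using d1 d2 fld_superset[of "insert x D"] by auto
    moreover have "\<forall>j\<in>insert i I. d2 (?c j) = v j" using d2(3) \<open>d2 x = v i\<close> by auto
    ultimately show "\<exists>\<delta>'. deriv_on (fld (D \<union> ?c ` insert i I)) \<delta>' \<and> (\<forall>y\<in>D. \<delta>' y = \<delta> y) \<and>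
      (\<forall>j\<in>insert i I. \<delta>' (?c j) = v j)" by blast
  qed
  moreover have "\<forall>j\<in>insert i I. lo j < ?c j \<and> ?c j < hi j" using c x by auto
  ultimately show ?case by blast
qed

text \<open>The solution is transported by extending \<open>h\<close> to its entries, and
  injectivity keeps the entry at \<open>j0\<close> nonzero. This carries singularity of a matrix
  across \<open>h\<close> without minors or ranks.\<close>

lemma hom_singular_system:
  fixes h :: "'a::field_char_0 \<Rightarrow> complex"
  assumes h: "hom_on S h" "countable S" and fin: "finite J" and M: "\<And>i j. i \<in> I \<Longrightarrow> j \<in> J \<Longrightarrow> M i j \<in> S"
    and eq: "\<And>i. i \<in> I \<Longrightarrow> (\<Sum>j\<in>J. M i j * g j) = 0" and nz: "j0 \<in> J" "g j0 \<noteq> 0"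
  obtains g' where "\<And>i. i \<in> I \<Longrightarrow> (\<Sum>j\<in>J. h (M i j) * g' j) = 0" "g' j0 \<noteq> 0"
proof -
  obtain T h' where T: "hom_on T h'" "S \<union> g ` J \<subseteq> T" "\<And>y. y \<in> S \<Longrightarrow> h' y = h y"
    using hom_extend_complex[OF h finite_imageI[OF fin, of g]] by metis
  have sub: "subfld T" using hom_onD(1)[OF T(1)] .
  have "(\<Sum>j\<in>J. h (M i j) * h' (g j)) = 0" if "i \<in> I" for i
  proof -
    have "(\<Sum>j\<in>J. h (M i j) * h' (g j)) = (\<Sum>j\<in>J. h' (M i j * g j))"
      using T M[OF that] by (intro sum.cong) (auto simp: hom_onD(5)[OF T(1)] subset_iff)
    also have "\<dots> = h' (\<Sum>j\<in>J. M i j * g j)"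
      using T M[OF that] by (subst hom_on_sum[OF T(1)]) (auto intro!: subfldD(4)[OF sub])
    finally show ?thesis using eq[OF that] hom_onD(3)[OF T(1)] by simp
  qed
  moreover have "h' (g j0) \<noteq> 0" using hom_on_inj[OF T(1), of "g j0"] T(2) nz by blast
  ultimately show ?thesis using that[of "\<lambda>j. h' (g j)"] by blast
qed

lemma countable_of_real_vimage:
  assumes "countable A"
  shows "countable (complex_of_real -` A)"
proof -
  have "complex_of_real ` (complex_of_real -` A) \<subseteq> A" by auto
  then have "countable (complex_of_real ` (complex_of_real -` A))" using assms countable_subset by blast
  then show ?thesis by (rule countable_image_inj_on) (simp add: inj_on_def)
qed

text \<open>Prescribable derivations make each \<open>\<alpha> i\<close> transcendental over
  \<open>F\<close> and the earlier ones, so it can be sent to a real number in its interval that is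
  transcendental over the image so far. The target is complex so that the result can be extended
  further to solutions of linear systems.\<close>

lemma deriv_generic_hom:
  fixes F :: "real set"
  assumes "finite I" "countable F" "subfld F"
    and "\<And>v. \<exists>D \<delta>. deriv_on D \<delta> \<and> F \<union> \<alpha> ` I \<subseteq> D \<and> (\<forall>y\<in>F. \<delta> y = 0) \<and> (\<forall>i\<in>I. \<delta> (\<alpha> i) = v i)"
    and "\<And>i. i \<in> I \<Longrightarrow> lo i < hi i"
  shows "\<exists>(h :: real \<Rightarrow> complex) \<beta>. hom_on (fld (F \<union> \<alpha> ` I)) h \<and> (\<forall>y\<in>F. h y = of_real y) \<and>
    (\<forall>i\<in>I. h (\<alpha> i) = of_real (\<beta> i) \<and> lo i < \<beta> i \<and> \<beta> i < hi i)"
  using assms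
proof (induction I)
  case empty
  have "hom_on (fld F) complex_of_real" by (simp add: hom_on_def)
  then show ?case by auto
next
  case (insert i I)
  have "\<exists>D \<delta>. deriv_on D \<delta> \<and> F \<union> \<alpha> ` I \<subseteq> D \<and> (\<forall>y\<in>F. \<delta> y = 0) \<and> (\<forall>i\<in>I. \<delta> (\<alpha> i) = v i)" for v
    using insert.prems(3)[of v] by blast
  then obtain h :: "real \<Rightarrow> complex" and \<beta> where h: "hom_on (fld (F \<union> \<alpha> ` I)) h" "\<forall>y\<in>F. h y = of_real y"
    "\<forall>i\<in>I. h (\<alpha> i) = of_real (\<beta> i) \<and> lo i < \<beta> i \<and> \<beta> i < hi i"
    using insert.IH insert.prems by auto
  let ?E = "fld (F \<union> \<alpha> ` I)"
  \<comment> \<open>A derivation that is \<open>1\<close> at the new element and kills everything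
    treated before.\<close>
  obtain D \<delta> where D: "deriv_on D \<delta>" "F \<union> \<alpha> ` insert i I \<subseteq> D" "\<forall>y\<in>F. \<delta> y = 0"
    "\<forall>j\<in>insert i I. \<delta> (\<alpha> j) = (if j = i then 1 else 0)"
    using insert.prems(3)[of "\<lambda>j. if j = i then 1 else 0"] by blast
  have ED: "?E \<subseteq> D" using D deriv_onD(1)[OF D(1)] by (intro fld_least) auto
  have generic_conf: "\<delta> y = 0" if "y \<in> F \<union> \<alpha> ` I" for y
    using that D insert.hyps by fastforce
  have "Dual y (\<delta> y) = Dual y 0" if "y \<in> ?E" for y
  proof (rule hom_on_fld_eq[of "F \<union> \<alpha> ` I" "\<lambda>y. Dual y (\<delta> y)" "\<lambda>y. Dual y 0" y])
    show "hom_on ?E (\<lambda>y. Dual y (\<delta> y))"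
      using deriv_on_subset[OF D(1) _ ED] by (simp add: deriv_on_def)
    show "hom_on ?E (\<lambda>y. Dual y 0)" using deriv_on_zero[of ?E] by (simp add: deriv_on_def)
  qed (use generic_conf that in auto)
  then have "trans_over ?E (\<alpha> i)"
    using D ED by (intro trans_over_if_deriv[OF D(1)]) auto
  moreover have "countable {x. \<not> trans_over (fld (h ` ?E)) x}"
    using insert.hyps insert.prems(1) by (intro countable_algebraic countable_fld countable_image) (auto intro: countable_finite)
  then have "countable (complex_of_real -` {x. \<not> trans_over (fld (h ` ?E)) x})"
    by (rule countable_of_real_vimage)
  then have "\<not> {lo i<..<hi i} \<subseteq> complex_of_real -` {x. \<not> trans_over (fld (h ` ?E)) x}"
    using uncountable_open_interval[of "lo i" "hi i"] insert.prems(4)[OF insertI1]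
      countable_subset[of "{lo i<..<hi i}" "complex_of_real -` {x. \<not> trans_over (fld (h ` ?E)) x}"] by metis
  then obtain x where x: "lo i < x" "x < hi i" "trans_over (fld (h ` ?E)) (complex_of_real x)" by auto
  ultimately obtain h' where h': "hom_on (fld (insert (\<alpha> i) ?E)) h'" "\<And>y. y \<in> ?E \<Longrightarrow> h' y = h y" "h' (\<alpha> i) = of_real x"
    using hom_extend_trans[OF h(1)] by metis
  have "F \<union> \<alpha> ` insert i I \<subseteq> insert (\<alpha> i) ?E" using fld_superset[of "F \<union> \<alpha> ` I"] by auto
  then have "fld (F \<union> \<alpha> ` insert i I) \<subseteq> fld (insert (\<alpha> i) ?E)" by (rule fld_mono)
  then have 1: "hom_on (fld (F \<union> \<alpha> ` insert i I)) h'" using hom_on_subset[OF h'(1)] by simp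
  have 2: "\<forall>y\<in>F. h' y = of_real y" "\<forall>j\<in>I. h' (\<alpha> j) = of_real (\<beta> j)"
    using h'(2) h fld_superset[of "F \<union> \<alpha> ` I"] by auto
  show ?case
    using 1 2 h(3) h'(3) x insert.hyps by (intro exI[of _ h'] exI[of _ "\<beta>(i := x)"]) auto
qed

section \<open>Measurement map and stresses\<close>

text \<open>The polarization of squared distance. Configurations are stored coordinate first,
  \<open>x $ j $ t\<close> being coordinate \<open>j\<close> of vertex \<open>t\<close>, because a
  stress acts on each function \<open>x $ j\<close> separately.\<close>

definition pair_form :: "'a::comm_ring_1 ^ 'v ^ 'n \<Rightarrow> 'a ^ 'v ^ 'n \<Rightarrow> 'v \<Rightarrow> 'v \<Rightarrow> 'a" where
  "pair_form x y t u = (\<Sum>j\<in>UNIV. (x $ j $ t - x $ j $ u) * (y $ j $ t - y $ j $ u))"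

text \<open>The measurement map is \<open>x \<mapsto> edge_form E x x\<close>. With values in
  matrices indexed by vertex pairs, an inner product with a matrix \<open>w\<close> weights the
  edges.\<close>

definition edge_form :: "'v set set \<Rightarrow> 'a::comm_ring_1 ^ 'v ^ 'n \<Rightarrow> 'a ^ 'v ^ 'n \<Rightarrow> 'a ^ 'v ^ 'v" where
  "edge_form E x y = (\<chi> t u. if {t, u} \<in> E then pair_form x y t u else 0)"

definition generic_conf :: "'a::field_char_0 ^ 'v::finite ^ 'n \<Rightarrow> bool" where
  "generic_conf x \<longleftrightarrow> generic_family (\<lambda>(t, i). x $ i $ t)"

lemma GGR_iff:
  "GGR E TYPE('v::finite \<Rightarrow> 'a::field_char_0 ^ 'n) \<longleftrightarrow>
    (\<forall>x :: 'a ^ 'v ^ 'n. generic_conf x \<longrightarrow> (\<forall>y :: 'a ^ 'v ^ 'n. edge_form E x x = edge_form E y y \<longrightarrow> (\<forall>t u. pair_form x x t u = pair_form y y t u)))"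
proof -
  define cf :: "('v \<Rightarrow> 'a ^ 'n) \<Rightarrow> 'a ^ 'v ^ 'n" where "cf p = (\<chi> i t. p t $ i)" for p
  have surj: "\<exists>p. x = cf p" for x
    by (rule exI[of _ "\<lambda>t. \<chi> i. x $ i $ t"]) (simp add: cf_def vec_eq_iff)
  have sq: "sqlen (p t - p u) = pair_form (cf p) (cf p) t u" for p t u
    by (simp add: sqlen_def pair_form_def cf_def power2_eq_square)
  have eq: "equivalent_fw E p q \<longleftrightarrow> edge_form E (cf p) (cf p) = edge_form E (cf q) (cf q)" for p q
    by (auto simp: equivalent_fw_def edge_form_def vec_eq_iff sq)
  have co: "congruent_fw p q \<longleftrightarrow> (\<forall>t u. pair_form (cf p) (cf p) t u = pair_form (cf q) (cf q) t u)" for p q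
    by (simp add: congruent_fw_def sq)
  have ge: "generic_config p \<longleftrightarrow> generic_conf (cf p)" for p
    by (simp add: generic_config_def generic_conf_def cf_def)
  show ?thesis
    unfolding GGR_def globally_rigid_def eq co ge
  proof (rule iffI, goal_cases)
    case 1
    show ?case
    proof (intro allI impI)
      fix x y :: "'a ^ 'v ^ 'n" and t u
      assume x: "generic_conf x" "edge_form E x x = edge_form E y y"
      obtain p q where "x = cf p" "y = cf q" using surj by metis
      then show "pair_form x x t u = pair_form y y t u" using 1 x by metis
    qed
  next
    case 2
    then show ?case by blast
  qed
qed

lemma pair_form_commute: "pair_form x y t u = pair_form y x t u"
  by (simp add: pair_form_def mult.commute)

lemma edge_form_commute: "edge_form E x y = edge_form E y x"
proof -
  have eq: "pair_form x y = pair_form y x" by (intro ext pair_form_commute)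
  show ?thesis unfolding edge_form_def by (subst eq) (rule refl)
qed

lemma pair_form_linear:
  "pair_form (x + x') y t u = pair_form x y t u + pair_form x' y t u" "pair_form x (y + y') t u = pair_form x y t u + pair_form x y' t u"
  "pair_form (x - x') y t u = pair_form x y t u - pair_form x' y t u" "pair_form x (y - y') t u = pair_form x y t u - pair_form x y' t u"
  "pair_form 0 y t u = 0" "pair_form x 0 t u = 0"
  by (simp_all add: pair_form_def sum.distrib[symmetric] sum_subtractf[symmetric] algebra_simps)

lemma pair_form_scaleR:
  fixes x :: "real ^ 'v ^ 'n"
  shows "pair_form (c *\<^sub>R x) y t u = c * pair_form x y t u" "pair_form x (c *\<^sub>R y) t u = c * pair_form x y t u"
  by (simp_all add: pair_form_def sum_distrib_left algebra_simps)

lemma edge_form_linear: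
  "edge_form E (x + x') y = edge_form E x y + edge_form E x' y" "edge_form E x (y + y') = edge_form E x y + edge_form E x y'"
  "edge_form E (x - x') y = edge_form E x y - edge_form E x' y" "edge_form E x (y - y') = edge_form E x y - edge_form E x y'"
  "edge_form E 0 y = 0" "edge_form E x 0 = 0"
  by (simp_all add: edge_form_def pair_form_linear vec_eq_iff)

lemma edge_form_scaleR:
  fixes x :: "real ^ 'v ^ 'n"
  shows "edge_form E (c *\<^sub>R x) y = c *\<^sub>R edge_form E x y" "edge_form E x (c *\<^sub>R y) = c *\<^sub>R edge_form E x y"
  by (simp_all add: edge_form_def pair_form_scaleR vec_eq_iff)

lemma bounded_bilinear_edge_form: "bounded_bilinear (edge_form E :: real ^ 'v::finite ^ 'n::finite \<Rightarrow> _)"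
proof -
  have "bilinear (edge_form E :: real ^ 'v ^ 'n \<Rightarrow> real ^ 'v ^ 'n \<Rightarrow> _)"
    unfolding bilinear_def by (auto intro!: linearI simp: edge_form_linear edge_form_scaleR)
  then show ?thesis by (simp add: bilinear_conv_bounded_bilinear)
qed

lemma linear_edge_form: "linear (edge_form E (x :: real ^ 'v::finite ^ 'n::finite))"
  by (auto intro!: linearI simp: edge_form_linear edge_form_scaleR)

lemma has_derivative_edge_form:
  fixes x :: "real ^ 'v::finite ^ 'n::finite"
  shows "((\<lambda>x. edge_form E x x) has_derivative (\<lambda>y. 2 *\<^sub>R edge_form E x y)) (at x)"
proof -
  have "((\<lambda>x. edge_form E x x) has_derivative (\<lambda>y. edge_form E x y + edge_form E y x)) (at x)"
    by (rule bounded_bilinear.FDERIV[OF bounded_bilinear_edge_form]) (auto intro: derivative_eq_intros)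
  moreover have "edge_form E x y + edge_form E y x = 2 *\<^sub>R edge_form E x y" for y by (metis edge_form_commute scaleR_2)
  ultimately show ?thesis by simp
qed

lemma continuous_edge_form: "continuous_on S (\<lambda>x :: real ^ 'v::finite ^ 'n::finite. edge_form E x x)"
  by (rule continuous_at_imp_continuous_on, intro ballI, rule has_derivative_continuous, rule has_derivative_edge_form)

section \<open>Derivations acting entrywise\<close>

definition entries :: "'a ^ 'b ^ 'c \<Rightarrow> 'a set" where
  "entries x = range (\<lambda>(i, j). x $ i $ j)"

definition map_entries :: "('a \<Rightarrow> 'd) \<Rightarrow> 'a ^ 'b ^ 'c \<Rightarrow> 'd ^ 'b ^ 'c" where
  "map_entries \<delta> x = (\<chi> i j. \<delta> (x $ i $ j))"

lemma map_entries_nth [simp]: "map_entries \<delta> x $ i $ j = \<delta> (x $ i $ j)"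
  by (simp add: map_entries_def)

lemma entsD: "entries x \<subseteq> D \<Longrightarrow> x $ i $ j \<in> D"
  by (auto simp: entries_def)

lemma entries_iff: "entries x \<subseteq> D \<longleftrightarrow> (\<forall>i j. x $ i $ j \<in> D)"
  by (auto simp: entries_def)

lemma finite_entries [simp]: "finite (entries (x :: 'a ^ 'b::finite ^ 'c::finite))"
  by (simp add: entries_def)

lemma deriv_pair_form:
  fixes x y :: "'a::field ^ 'v ^ 'n"
  assumes d: "deriv_on D \<delta>" and "entries x \<subseteq> D" "entries y \<subseteq> D"
  shows "\<delta> (pair_form x y t u) = pair_form (map_entries \<delta> x) y t u + pair_form x (map_entries \<delta> y) t u" "pair_form x y t u \<in> D"
proof -
  note D = deriv_onD(1)[OF d]
  have e: "x $ j $ t - x $ j $ u \<in> D" "y $ j $ t - y $ j $ u \<in> D" for j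
    using assms by (auto simp: subfldD(7)[OF D] entsD)
  show "pair_form x y t u \<in> D" unfolding pair_form_def using e by (intro subfld_sum D) (auto simp: subfldD(4)[OF D])
  have "\<delta> (pair_form x y t u) = (\<Sum>j\<in>UNIV. \<delta> ((x $ j $ t - x $ j $ u) * (y $ j $ t - y $ j $ u)))"
    unfolding pair_form_def using e by (intro deriv_on_sum[OF d]) (auto simp: subfldD(4)[OF D])
  also have "\<dots> = (\<Sum>j\<in>UNIV. (\<delta> (x $ j $ t) - \<delta> (x $ j $ u)) * (y $ j $ t - y $ j $ u) + (x $ j $ t - x $ j $ u) * (\<delta> (y $ j $ t) - \<delta> (y $ j $ u)))"
    using assms e by (intro sum.cong refl, subst deriv_onD(6)[OF d]) (auto simp: deriv_onD(5)[OF d] entsD algebra_simps)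
  finally show "\<delta> (pair_form x y t u) = pair_form (map_entries \<delta> x) y t u + pair_form x (map_entries \<delta> y) t u"
    by (simp add: pair_form_def sum.distrib)
qed

lemma deriv_edge_form:
  fixes x y :: "'a::field ^ 'v ^ 'n"
  assumes d: "deriv_on D \<delta>" and "entries x \<subseteq> D" "entries y \<subseteq> D"
  shows "map_entries \<delta> (edge_form E x y) = edge_form E (map_entries \<delta> x) y + edge_form E x (map_entries \<delta> y)" "entries (edge_form E x y) \<subseteq> D"
  using deriv_pair_form[OF assms] subfldD(2)[OF deriv_onD(1)[OF d]] deriv_onD(2)[OF d]
  by (auto simp: vec_eq_iff edge_form_def entries_iff)

lemma inner_mat: "(w :: real ^ 'b::finite ^ 'c::finite) \<bullet> z = (\<Sum>i\<in>UNIV. \<Sum>j\<in>UNIV. w $ i $ j * z $ i $ j)"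
  by (simp add: inner_vec_def)

lemma deriv_inner:
  fixes w z :: "real ^ 'b::finite ^ 'c::finite"
  assumes d: "deriv_on D \<delta>" and "entries w \<subseteq> D" "entries z \<subseteq> D"
  shows "\<delta> (w \<bullet> z) = map_entries \<delta> w \<bullet> z + w \<bullet> map_entries \<delta> z" "w \<bullet> z \<in> D"
proof -
  note D = deriv_onD(1)[OF d]
  have e: "w $ i $ j * z $ i $ j \<in> D" for i j using assms by (auto simp: subfldD(4)[OF D] entsD)
  then have e': "(\<Sum>j\<in>UNIV. w $ i $ j * z $ i $ j) \<in> D" for i by (intro subfld_sum D)
  show "w \<bullet> z \<in> D" unfolding inner_mat using e' by (rule subfld_sum[OF D])
  have "\<delta> (w \<bullet> z) = (\<Sum>i\<in>UNIV. \<Sum>j\<in>UNIV. \<delta> (w $ i $ j * z $ i $ j))"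
    unfolding inner_mat using e e' by (simp add: deriv_on_sum[OF d])
  also have "\<dots> = (\<Sum>i\<in>UNIV. \<Sum>j\<in>UNIV. \<delta> (w $ i $ j) * z $ i $ j + w $ i $ j * \<delta> (z $ i $ j))"
    using assms by (intro sum.cong) (auto simp: deriv_onD[OF d] entsD algebra_simps)
  finally show "\<delta> (w \<bullet> z) = map_entries \<delta> w \<bullet> z + w \<bullet> map_entries \<delta> z" by (simp add: inner_mat sum.distrib)
qed

text \<open>The working form of genericity: any velocity \<open>u\<close> of \<open>p\<close> is
  realized by a derivation, and the finite set \<open>X\<close> of dependent quantities moves along
  with it.\<close>

lemma generic_conf_deriv:
  fixes p u :: "'a::field_char_0 ^ 'v::finite ^ 'n::finite"
  assumes "generic_conf p" "finite X"
  obtains D \<delta> where "deriv_on D \<delta>" "X \<subseteq> D" "entries p \<subseteq> D" "map_entries \<delta> p = u"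
proof -
  obtain d0 where d0: "deriv_on (fld (range (\<lambda>(t, i). p $ i $ t))) d0" "\<And>z. d0 ((\<lambda>(t, i). p $ i $ t) z) = (\<lambda>(t, i). u $ i $ t) z"
    using generic_deriv[OF assms(1)[unfolded generic_conf_def]] by metis
  let ?F = "fld (range (\<lambda>(t, i). p $ i $ t))"
  obtain \<delta> where d: "deriv_on (fld (?F \<union> X)) \<delta>" "\<And>y. y \<in> ?F \<Longrightarrow> \<delta> y = d0 y"
    using deriv_extend[OF d0(1) assms(2)] by metis
  have pF: "p $ i $ t \<in> ?F" for i t by (rule fld.base) (auto intro!: image_eqI[of _ _ "(t, i)"])
  have "X \<subseteq> fld (?F \<union> X)" "entries p \<subseteq> fld (?F \<union> X)"
    using fld_superset[of "?F \<union> X"] pF by (auto simp: entries_iff)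
  moreover have "map_entries \<delta> p = u"
    using d(2)[OF pF] d0(2)[of "(t, i)" for t i] by (simp add: vec_eq_iff)
  ultimately show ?thesis using d(1) that by blast
qed

section \<open>Projections and open mappings between subspaces\<close>

lemma subspace_projection:
  fixes S :: "'a::euclidean_space set"
  assumes "subspace S"
  obtains \<pi> where "linear \<pi>" "\<And>x. \<pi> x \<in> S" "\<And>x. x \<in> S \<Longrightarrow> \<pi> x = x" "\<And>x y. y \<in> S \<Longrightarrow> (x - \<pi> x) \<bullet> y = 0"
proof -
  obtain B where B: "B \<subseteq> S" "pairwise orthogonal B" "\<And>x. x \<in> B \<Longrightarrow> norm x = 1" "independent B" "span B = S"
    using orthonormal_basis_subspace[OF assms] by metis
  have fin: "finite B" using B(4) independent_bound by blast
  define \<pi> where "\<pi> x = (\<Sum>b\<in>B. (x \<bullet> b) *\<^sub>R b)" for x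
  have lin: "linear \<pi>"
    by (rule linearI) (auto simp: \<pi>_def inner_add_left scaleR_left_distrib sum.distrib scaleR_sum_right)
  have in_S: "\<pi> x \<in> S" for x
    unfolding \<pi>_def using B(1) assms by (auto intro!: subspace_sum subspace_scale)
  have "\<pi> x \<bullet> c = x \<bullet> c" if "c \<in> B" for x c
  proof -
    have "\<pi> x \<bullet> c = (\<Sum>b\<in>B. if b = c then x \<bullet> c else 0)"
      unfolding \<pi>_def inner_sum_left using that B(2,3)
      by (intro sum.cong) (auto simp: pairwise_def orthogonal_def norm_eq_1)
    then show ?thesis using fin that by simp
  qed
  then have orth_B: "(x - \<pi> x) \<bullet> c = 0" if "c \<in> B" for x c using that by (simp add: inner_diff_left)
  have orth: "(x - \<pi> x) \<bullet> y = 0" if "y \<in> S" for x y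
  proof -
    have "y \<in> span B" using that B by simp
    then show ?thesis
    proof (induction rule: span_induct_alt)
      case (step c b y)
      then show ?case using orth_B[of b x] by (simp add: inner_add_right)
    qed simp
  qed
  have "\<pi> x = x" if "x \<in> S" for x
  proof -
    have "x - \<pi> x \<in> S" using that in_S assms by (simp add: subspace_diff)
    from orth[OF this, of x] show ?thesis by simp
  qed
  then show ?thesis using lin in_S orth that by blast
qed

lemma subspace_open_mapping:
  fixes f :: "'a::euclidean_space \<Rightarrow> 'b::euclidean_space"
  assumes A: "subspace A" and L: "subspace L" and a: "a \<in> A" and fL: "\<And>x. x \<in> A \<Longrightarrow> f x \<in> L"
    and cont: "continuous_on UNIV f" and der: "(f has_derivative f') (at a)"
    and surj: "\<And>z. z \<in> L \<Longrightarrow> \<exists>y\<in>A. f' y = z"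
  obtains e where "e > 0" "\<And>z. z \<in> L \<Longrightarrow> dist z (f a) < e \<Longrightarrow> \<exists>x\<in>A. f x = z"
proof -
  obtain \<pi> where \<pi>: "linear \<pi>" "\<And>x. \<pi> x \<in> A" "\<And>x. x \<in> A \<Longrightarrow> \<pi> x = x"
    using subspace_projection[OF A] by metis
  obtain \<rho> where \<rho>: "linear \<rho>" "\<And>x. \<rho> x \<in> L" "\<And>x. x \<in> L \<Longrightarrow> \<rho> x = x"
    using subspace_projection[OF L] by metis
  \<comment> \<open>The directions missing from \<open>L\<close> are supplied by the second
    variable, so that \<open>F\<close> has surjective derivative onto the whole space. A value of
    \<open>F\<close> that lies in \<open>L\<close> forces the added component
    \<open>snd z - \<rho> (snd z)\<close> to vanish.\<close>
  define F where "F = (\<lambda>z :: 'a \<times> 'b. f (\<pi> (fst z)) + (snd z - \<rho> (snd z)))"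
  define F' where "F' = (\<lambda>z :: 'a \<times> 'b. f' (\<pi> (fst z)) + (snd z - \<rho> (snd z)))"
  have blin: "bounded_linear \<pi>" "bounded_linear \<rho>" using \<pi> \<rho> by (simp_all add: linear_conv_bounded_linear)
  have contF: "continuous_on UNIV F"
    unfolding F_def
    by (intro continuous_intros continuous_on_compose2[OF cont] bounded_linear.continuous_on[OF blin(1)] bounded_linear.continuous_on[OF blin(2)]) auto
  have d1: "((\<lambda>z :: 'a \<times> 'b. \<pi> (fst z)) has_derivative (\<lambda>z. \<pi> (fst z))) (at (a, 0))"
    by (intro bounded_linear.has_derivative[OF blin(1)] derivative_intros)
  have d2: "((\<lambda>z :: 'a \<times> 'b. \<rho> (snd z)) has_derivative (\<lambda>z. \<rho> (snd z))) (at (a, 0))"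
    by (intro bounded_linear.has_derivative[OF blin(2)] derivative_intros)
  have "(f has_derivative f') (at (\<pi> (fst (a, 0 :: 'b))))" using der \<pi>(3)[OF a] by simp
  from has_derivative_compose[OF d1 this]
  have d3: "((\<lambda>z :: 'a \<times> 'b. f (\<pi> (fst z))) has_derivative (\<lambda>z. f' (\<pi> (fst z)))) (at (a, 0))" .
  have derF: "(F has_derivative F') (at (a, 0))"
    unfolding F_def F'_def by (intro derivative_intros d2 d3)
  have lin': "linear F'" using has_derivative_linear[OF derF] .
  have "surj F'"
    unfolding surj_def
  proof
    fix z
    obtain y where "y \<in> A" "f' y = \<rho> z" using surj \<rho>(2) by blast
    then have "z = F' (y, z)" using \<pi>(3) by (simp add: F'_def)
    then show "\<exists>y. z = F' y" by blast
  qed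
  then obtain g where g: "linear g" "F' \<circ> g = id" using linear_surjective_right_inverse[OF lin'] by metis
  have "F (a, 0) \<in> interior (F ` UNIV)"
    using g by (intro sussmann_open_mapping[OF open_UNIV contF _ derF, of g]) (auto simp: linear_conv_bounded_linear)
  moreover have "F (a, 0) = f a" using \<pi>(3)[OF a] \<rho>(1) by (simp add: F_def linear_0)
  ultimately obtain e where e: "e > 0" "ball (f a) e \<subseteq> range F" by (auto simp: mem_interior)
  have "\<exists>x\<in>A. f x = z" if z: "z \<in> L" "dist z (f a) < e" for z
  proof -
    have "z \<in> range F" using e(2) z(2) by (auto simp: dist_commute)
    then obtain x y where "z = f (\<pi> x) + (y - \<rho> y)" by (auto simp: F_def)
    moreover from this have "y - \<rho> y \<in> L" using subspace_diff[OF L z(1) fL[OF \<pi>(2), of x]] by simp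
    then have "\<rho> (y - \<rho> y) = y - \<rho> y" using \<rho> by blast
    then have "y - \<rho> y = 0" using \<rho> by (simp add: linear_diff)
    ultimately show ?thesis using \<pi>(2) by auto
  qed
  then show ?thesis using e(1) that by blast
qed

section \<open>Stresses of generic configurations\<close>

text \<open>The configurations in equilibrium under \<open>w\<close>, that is, the kernel of the
  stress matrix taken in every coordinate.\<close>

definition stress_configs :: "'v set set \<Rightarrow> real ^ 'v::finite ^ 'v \<Rightarrow> (real ^ 'v ^ 'n::finite) set" where
  "stress_configs E w = {x. \<forall>y. w \<bullet> edge_form E x y = 0}"

lemma subspace_stress_configs: "subspace (stress_configs E w)"
  by (auto simp: stress_configs_def subspace_def edge_form_linear edge_form_scaleR inner_add_right)

lemma deriv_stress:
  fixes p u x y :: "real ^ 'v::finite ^ 'n::finite"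
  assumes d: "deriv_on D \<delta>" and D: "entries x \<subseteq> D" "entries y \<subseteq> D" "entries w \<subseteq> D" and 0: "w \<bullet> edge_form E x y = 0"
  shows "map_entries \<delta> w \<bullet> edge_form E x y + w \<bullet> edge_form E (map_entries \<delta> x) y + w \<bullet> edge_form E x (map_entries \<delta> y) = 0"
  using deriv_inner(1)[OF d D(3) deriv_edge_form(2)[OF d D(1,2)], of E] 0 deriv_onD(2)[OF d]
  by (simp add: deriv_edge_form(1)[OF d D(1,2)] inner_add_right)

text \<open>The stress is a combination of a basis of the stress space with coefficients that are algebraically
  independent over the field generated by \<open>p\<close> and that basis, so that derivations can move it freely.\<close>
lemma generic_stress_deriv:
  fixes p :: "real ^ 'v::finite ^ 'n::finite"
  assumes p: "generic_conf p"
  obtains w where "p \<in> stress_configs E w"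
    "\<forall>u \<eta>. \<forall>X :: real set. finite X \<longrightarrow> (\<forall>y. \<eta> \<bullet> edge_form E p y + w \<bullet> edge_form E u y = 0) \<longrightarrow>
      (\<exists>D \<delta>. deriv_on D \<delta> \<and> X \<subseteq> D \<and> entries p \<subseteq> D \<and> entries w \<subseteq> D \<and> map_entries \<delta> p = u \<and> map_entries \<delta> w = \<eta>)"
proof -
  define S where "S = {w. \<forall>y. w \<bullet> edge_form E p y = 0}"
  have subS: "subspace S" by (auto simp: S_def subspace_def inner_add_left)
  obtain Bs where Bs: "Bs \<subseteq> S" "independent Bs" "S \<subseteq> span Bs" using basis_exists by metis
  have fin: "finite Bs" using Bs(2) independent_bound by blast
  define D0 where "D0 = fld (entries p \<union> (\<Union>w\<in>Bs. entries w))"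
  have finU: "finite (entries p \<union> (\<Union>w\<in>Bs. entries w))" using fin by simp
  then have "countable D0" unfolding D0_def by (intro countable_fld countable_finite)
  then obtain c where c: "deriv_free D0 c Bs"
    using exists_deriv_free[OF fin, of D0 "\<lambda>_. 0" "\<lambda>_. 1"] by (auto simp: D0_def)
  define w where "w = (\<Sum>b\<in>Bs. c b *\<^sub>R b)"
  have wS: "w \<in> S" unfolding w_def using Bs(1) subS by (auto intro!: subspace_sum subspace_scale)
  have entsD0: "entries p \<subseteq> D0" "b \<in> Bs \<Longrightarrow> entries b \<subseteq> D0" for b
    using fld_superset[of "entries p \<union> (\<Union>w\<in>Bs. entries w)"] by (auto simp: D0_def)
  show ?thesis
  proof (rule that)
    show "p \<in> stress_configs E w" using wS by (simp add: stress_configs_def S_def)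
  next
    show "\<forall>u \<eta>. \<forall>X :: real set. finite X \<longrightarrow> (\<forall>y. \<eta> \<bullet> edge_form E p y + w \<bullet> edge_form E u y = 0) \<longrightarrow>
      (\<exists>D \<delta>. deriv_on D \<delta> \<and> X \<subseteq> D \<and> entries p \<subseteq> D \<and> entries w \<subseteq> D \<and> map_entries \<delta> p = u \<and> map_entries \<delta> w = \<eta>)"
    proof (intro allI impI)
    fix u \<eta> and X :: "real set"
    assume X: "finite X" and "\<forall>y. \<eta> \<bullet> edge_form E p y + w \<bullet> edge_form E u y = 0"
    then have eq: "\<And>y. \<eta> \<bullet> edge_form E p y + w \<bullet> edge_form E u y = 0" by blast
    obtain D1 d1 where d1: "deriv_on D1 d1" "entries p \<union> (\<Union>w\<in>Bs. entries w) \<subseteq> D1" "map_entries d1 p = u"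
      using generic_conf_deriv[OF p finU] by metis
    have D01: "D0 \<subseteq> D1" unfolding D0_def using d1 deriv_onD(1)[OF d1(1)] by (intro fld_least) auto
    have d0: "deriv_on D0 d1" using deriv_on_subset[OF d1(1) _ D01] by (simp add: D0_def)
    have b0: "map_entries d1 b \<bullet> edge_form E p y + b \<bullet> edge_form E u y = 0" if b: "b \<in> Bs" for b y
    proof -
      obtain d2 where d2: "deriv_on (fld (D0 \<union> entries y)) d2" "\<And>z. z \<in> D0 \<Longrightarrow> d2 z = d1 z"
        using deriv_extend[OF d0 finite_entries[of y]] by metis
      let ?D = "fld (D0 \<union> entries y)"
      have sub: "D0 \<subseteq> ?D" "entries y \<subseteq> ?D" using fld_superset[of "D0 \<union> entries y"] by auto
      have eqs: "map_entries d2 b = map_entries d1 b" "map_entries d2 p = u"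
        using d2(2) d1(3) entsD[OF entsD0(2)[OF b]] entsD[OF entsD0(1)] by (auto simp: vec_eq_iff)
      have S: "b \<bullet> edge_form E p z = 0" for z using b Bs(1) by (auto simp: S_def)
      have "map_entries d2 b \<bullet> edge_form E p y + b \<bullet> edge_form E (map_entries d2 p) y + b \<bullet> edge_form E p (map_entries d2 y) = 0"
        using entsD0 b sub S by (intro deriv_stress[OF d2(1)]) auto
      then show ?thesis using S by (simp add: eqs)
    qed
    \<comment> \<open>The velocity of \<open>w\<close> when its coefficients are held fixed. Both
      \<open>\<eta>\<close> and \<open>w'\<close> satisfy the differentiated equilibrium equation,
      so their difference is a stress of \<open>p\<close>, which the velocities of the free
      coefficients supply.\<close>
    define w' where "w' = (\<Sum>b\<in>Bs. c b *\<^sub>R map_entries d1 b)"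
    have "\<eta> - w' \<in> S"
      unfolding S_def
    proof (intro CollectI allI)
      fix y
      have "w' \<bullet> edge_form E p y + w \<bullet> edge_form E u y = (\<Sum>b\<in>Bs. c b * (map_entries d1 b \<bullet> edge_form E p y + b \<bullet> edge_form E u y))"
        by (simp add: w'_def w_def inner_sum_left sum.distrib distrib_left)
      also have "\<dots> = 0" using b0 by (simp add: sum.neutral)
      finally show "(\<eta> - w') \<bullet> edge_form E p y = 0" using eq[of y] by (simp add: inner_diff_left)
    qed
    then obtain v where v: "\<eta> - w' = (\<Sum>b\<in>Bs. v b *\<^sub>R b)" using Bs(3) by (auto simp: span_finite[OF fin])
    obtain d3 where d3: "deriv_on (fld (D0 \<union> c ` Bs)) d3" "\<forall>y\<in>D0. d3 y = d1 y" "\<forall>b\<in>Bs. d3 (c b) = v b"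
      using c d0 unfolding deriv_free_def by metis
    let ?D3 = "fld (D0 \<union> c ` Bs)"
    have sub3: "D0 \<subseteq> ?D3" "c ` Bs \<subseteq> ?D3" using fld_superset[of "D0 \<union> c ` Bs"] by auto
    note D3 = deriv_onD(1)[OF d3(1)]
    have cb: "c b * b $ i $ j \<in> ?D3" if "b \<in> Bs" for b i j
      using that sub3 entsD[OF entsD0(2)] by (intro subfldD(4)[OF D3]) auto
    have wnth: "w $ i $ j = (\<Sum>b\<in>Bs. c b * b $ i $ j)" for i j by (simp add: w_def)
    have entsw: "entries w \<subseteq> ?D3" unfolding entries_iff wnth using cb by (intro allI subfld_sum D3)
    have dw: "map_entries d3 w = \<eta>"
    proof -
      have "d3 (w $ i $ j) = \<eta> $ i $ j" for i j
      proof -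
        have "d3 (w $ i $ j) = (\<Sum>b\<in>Bs. d3 (c b * b $ i $ j))"
          unfolding wnth using cb by (intro deriv_on_sum[OF d3(1)])
        also have "\<dots> = (\<Sum>b\<in>Bs. v b * b $ i $ j + c b * d1 (b $ i $ j))"
          using sub3 entsD[OF entsD0(2)] d3
          by (intro sum.cong) (auto simp: deriv_onD(6)[OF d3(1)] image_subset_iff subset_iff algebra_simps)
        also have "\<dots> = (\<Sum>b\<in>Bs. v b *\<^sub>R b) $ i $ j + w' $ i $ j"
          by (simp add: w'_def sum.distrib)
        finally show ?thesis by (simp flip: v)
      qed
      then show ?thesis by (simp add: vec_eq_iff)
    qed
    obtain d4 where d4: "deriv_on (fld (?D3 \<union> X)) d4" "\<And>y. y \<in> ?D3 \<Longrightarrow> d4 y = d3 y"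
      using deriv_extend[OF d3(1) X] by metis
    have sub4: "?D3 \<subseteq> fld (?D3 \<union> X)" "X \<subseteq> fld (?D3 \<union> X)" using fld_superset[of "?D3 \<union> X"] by auto
    have "map_entries d4 p = u"
      using d4(2) d3(2) d1(3) entsD[OF entsD0(1)] sub3(1) by (auto simp: vec_eq_iff subset_iff)
    moreover have "map_entries d4 w = \<eta>"
      using dw d4(2) entsD[OF entsw] by (auto simp: vec_eq_iff)
    ultimately show "\<exists>D \<delta>. deriv_on D \<delta> \<and> X \<subseteq> D \<and> entries p \<subseteq> D \<and> entries w \<subseteq> D \<and> map_entries \<delta> p = u \<and> map_entries \<delta> w = \<eta>"
      using d4(1) sub4 sub3 entsw entsD0(1) by (intro exI[of _ "fld (?D3 \<union> X)"] exI[of _ d4]) blast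
    qed
  qed
qed

text \<open>The submersion statement. If \<open>\<eta>\<close> kills \<open>edge_form E p\<close> on
  the configurations stressed by \<open>w\<close>, then some velocity \<open>(u, \<eta>)\<close> of
  \<open>(p, w)\<close> preserves equilibrium. A derivation realizing it, applied to
  \<open>w \<bullet> edge_form E x y = 0\<close> with \<open>x\<close> and \<open>y\<close> stressed
  by \<open>w\<close>, yields \<open>\<eta> \<bullet> edge_form E x y = 0\<close>; the velocities of
  \<open>x\<close> and \<open>y\<close> drop out.\<close>

lemma generic_stress:
  fixes p :: "real ^ 'v::finite ^ 'n::finite"
  assumes p: "generic_conf p"
  obtains w where "p \<in> stress_configs E w"
    "span {edge_form E x y | x y. x \<in> (stress_configs E w :: (real ^ 'v ^ 'n) set) \<and> y \<in> (stress_configs E w :: (real ^ 'v ^ 'n) set)} \<subseteq> edge_form E p ` stress_configs E w"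
proof -
  obtain w where pw: "p \<in> stress_configs E w" and der: "\<forall>u \<eta>. \<forall>X :: real set. finite X \<longrightarrow> (\<forall>y. \<eta> \<bullet> edge_form E p y + w \<bullet> edge_form E u y = 0) \<longrightarrow>
      (\<exists>D \<delta>. deriv_on D \<delta> \<and> X \<subseteq> D \<and> entries p \<subseteq> D \<and> entries w \<subseteq> D \<and> map_entries \<delta> p = u \<and> map_entries \<delta> w = \<eta>)"
    using generic_stress_deriv[OF p, of E] by blast
  \<comment> \<open>The matrix of the symmetric form obtained by weighting
    \<open>edge_form E\<close> with \<open>v\<close>. Self-adjointness makes the range of
    \<open>A w\<close> the orthogonal complement of its kernel.\<close>
  define A where "A v x = (\<Sum>b\<in>Basis. (v \<bullet> edge_form E x b) *\<^sub>R b)" for v and x :: "real ^ 'v ^ 'n"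
  have A: "A v x \<bullet> y = v \<bullet> edge_form E x y" for v x y
  proof -
    have "v \<bullet> edge_form E x y = v \<bullet> edge_form E x (\<Sum>b\<in>Basis. (y \<bullet> b) *\<^sub>R b)" by (simp add: euclidean_representation)
    also have "\<dots> = (\<Sum>b\<in>Basis. (y \<bullet> b) * (v \<bullet> edge_form E x b))"
      using linear_sum[OF linear_edge_form[of E x], of "\<lambda>b. (y \<bullet> b) *\<^sub>R b" Basis]
      by (simp add: linear_cmul[OF linear_edge_form] inner_sum_right)
    also have "\<dots> = A v x \<bullet> y" by (simp add: A_def inner_sum_left) (simp add: inner_commute mult.commute)
    finally show ?thesis by simp
  qed
  have linA: "linear (A v)" for v
    by (rule linearI) (auto simp: A_def edge_form_linear edge_form_scaleR inner_add_right scaleR_left_distrib sum.distrib scaleR_sum_right)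
  have adj: "adjoint (A v) = A v" for v
    by (rule adjoint_unique) (metis A edge_form_commute inner_commute)
  have "x \<in> range (A w)" if x: "\<And>y. y \<in> stress_configs E w \<Longrightarrow> x \<bullet> y = 0" for x
  proof -
    have "(A w) -` {0} \<subseteq> stress_configs E w"
      using A[of w, symmetric] by (auto simp: stress_configs_def)
    then have "x \<in> ((A w) -` {0})\<^sup>\<bottom>" using x by (auto simp: orthogonal_comp_def orthogonal_def inner_commute)
    also have "\<dots> = (range (A w))\<^sup>\<bottom>\<^sup>\<bottom>" using ker_orthogonal_comp_adjoint[OF linA[of w]] adj by simp
    also have "\<dots> = range (A w)" by (simp add: linA linear_subspace_image orthogonal_comp_self)
    finally show ?thesis .
  qed
  note rangeA = this
  have key: "\<eta> \<bullet> edge_form E x y = 0" if \<eta>: "\<And>y. y \<in> stress_configs E w \<Longrightarrow> \<eta> \<bullet> edge_form E p y = 0" and x: "x \<in> stress_configs E w" and y: "y \<in> stress_configs E w"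
    for \<eta> and x y :: "real ^ 'v ^ 'n"
  proof -
    have "A \<eta> p \<in> range (A w)" using \<eta> A by (intro rangeA) simp
    then obtain u where u: "A \<eta> p = A w (- u)" by (metis add.inverse_inverse imageE)
    have "\<eta> \<bullet> edge_form E p z + w \<bullet> edge_form E u z = 0" for z
      using u A linear_neg[OF linA[of w], of u] by (metis add.right_inverse inner_minus_left add.commute)
    then obtain D \<delta> where d: "deriv_on D \<delta>" "entries x \<union> entries y \<subseteq> D" "entries w \<subseteq> D" "map_entries \<delta> w = \<eta>"
      using der[rule_format, of "entries x \<union> entries y" \<eta> u] by auto
    have wx: "w \<bullet> edge_form E x z = 0" and wy: "w \<bullet> edge_form E z y = 0" for z
      using x y by (auto simp: stress_configs_def edge_form_commute[of E z y])
    show ?thesis using deriv_stress[OF d(1), of x y w E] d wx wy by simp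
  qed
  let ?R = "edge_form E p ` stress_configs E w"
  have subR: "subspace ?R" by (intro linear_subspace_image linear_edge_form subspace_stress_configs)
  show ?thesis
  proof (rule that[OF pw], rule subsetI)
    fix z assume z: "z \<in> span {edge_form E x y | x y. x \<in> (stress_configs E w :: (real ^ 'v ^ 'n) set) \<and> y \<in> (stress_configs E w :: (real ^ 'v ^ 'n) set)}"
    obtain \<pi> where \<pi>: "\<And>x. \<pi> x \<in> ?R" "\<And>x y. y \<in> ?R \<Longrightarrow> (x - \<pi> x) \<bullet> y = 0"
      using subspace_projection[OF subR] by metis
    let ?\<eta> = "z - \<pi> z"
    have "?\<eta> \<bullet> edge_form E x y = 0" if "x \<in> stress_configs E w" "y \<in> stress_configs E w" for x y :: "real ^ 'v ^ 'n"
      using key[OF _ that] \<pi>(2) by blast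
    then have "?\<eta> \<bullet> b = 0" if "b \<in> {edge_form E x y | x y. x \<in> stress_configs E w \<and> y \<in> (stress_configs E w :: (real ^ 'v ^ 'n) set)}" for b
      using that by blast
    note b0 = this
    have "\<eta> \<bullet> z' = 0" if "z' \<in> span S" "\<And>b. b \<in> S \<Longrightarrow> \<eta> \<bullet> b = 0" for \<eta> z' and S :: "(real ^ 'v ^ 'v) set"
      using that
    proof (induction rule: span_induct_alt)
      case (step c b y)
      then show ?case by (simp add: inner_add_right)
    qed simp
    from this[OF z b0] have "?\<eta> \<bullet> z = 0" .
    moreover have "?\<eta> \<bullet> \<pi> z = 0" using \<pi> by blast
    ultimately have "?\<eta> \<bullet> ?\<eta> = 0" by (simp add: inner_diff_right)
    then have "z = \<pi> z" by simp
    then show "z \<in> ?R" using \<pi>(1)[of z] by simp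
  qed
qed

section \<open>Infinitesimal rigidity\<close>

definition inf_rigid :: "'v set set \<Rightarrow> real ^ 'v::finite ^ 'n::finite \<Rightarrow> bool" where
  "inf_rigid E p \<longleftrightarrow> (\<forall>u. edge_form E p u = 0 \<longrightarrow> (\<forall>t s. pair_form p u t s = 0))"

text \<open>Differentiating \<open>edge_form E p u = 0\<close> along \<open>\<delta> p = y\<close>
  and pairing with \<open>w\<close> kills the term with \<open>\<delta> u\<close>, leaving the
  equilibrium condition for \<open>u\<close> tested against \<open>y\<close>.\<close>

lemma flex_in_stress_configs:
  fixes p u :: "real ^ 'v::finite ^ 'n::finite"
  assumes p: "generic_conf p" and w: "p \<in> stress_configs E w" and u: "edge_form E p u = 0"
  shows "u \<in> stress_configs E w"
  unfolding stress_configs_def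
proof (intro CollectI allI)
  fix y
  obtain D \<delta> where d: "deriv_on D \<delta>" "entries u \<subseteq> D" "entries p \<subseteq> D" "map_entries \<delta> p = y"
    using generic_conf_deriv[OF p finite_entries[of u]] by metis
  have "map_entries \<delta> (edge_form E p u) = 0" using u deriv_onD(2)[OF d(1)] by (simp add: vec_eq_iff)
  then have "edge_form E y u + edge_form E p (map_entries \<delta> u) = 0" using deriv_edge_form(1)[OF d(1,3,2)] d(4) by simp
  then have "w \<bullet> edge_form E y u + w \<bullet> edge_form E p (map_entries \<delta> u) = 0" by (metis inner_add_right inner_zero_right)
  then show "w \<bullet> edge_form E u y = 0" using w by (simp add: stress_configs_def edge_form_commute[of E u y])
qed

text \<open>If a flex \<open>u\<close> changed the distance of \<open>t\<close> and \<open>s\<close>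
  to first order, this distance could be added as a further measurement and the map would stay
  submersive, as \<open>u\<close> moves the new component alone. By the open mapping theorem it
  could then change while all edge lengths stay fixed.\<close>

lemma GGR_imp_inf_rigid:
  fixes p :: "real ^ 'v::finite ^ 'n::finite"
  assumes rigid: "\<And>y :: real ^ 'v ^ 'n. edge_form E p p = edge_form E y y \<Longrightarrow> \<forall>t u. pair_form p p t u = pair_form y y t u" and p: "generic_conf p"
  shows "inf_rigid E p"
  unfolding inf_rigid_def
proof (intro allI impI)
  fix u t s assume u: "edge_form E p u = 0"
  show "pair_form p u t s = 0"
  proof (rule ccontr)
    assume nz: "pair_form p u t s \<noteq> 0"
    obtain w where pw: "p \<in> stress_configs E w"
      and surj: "span {edge_form E x y | x y. x \<in> (stress_configs E w :: (real ^ 'v ^ 'n) set) \<and> y \<in> (stress_configs E w :: (real ^ 'v ^ 'n) set)} \<subseteq> edge_form E p ` stress_configs E w"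
      using generic_stress[OF p, of E] by blast
    let ?K = "stress_configs E w :: (real ^ 'v ^ 'n) set"
    let ?L = "span {edge_form E x y | x y. x \<in> ?K \<and> y \<in> ?K}"
    have uK: "u \<in> ?K" using flex_in_stress_configs[OF p pw u] .
    let ?f = "\<lambda>x :: real ^ 'v ^ 'n. (edge_form E x x, pair_form x x t s)"
    let ?f' = "\<lambda>y. (2 *\<^sub>R edge_form E p y, 2 * pair_form p y t s)"
    have "bilinear (\<lambda>x y :: real ^ 'v ^ 'n. pair_form x y t s)"
      unfolding bilinear_def by (auto intro!: linearI simp: pair_form_linear pair_form_scaleR)
    then have bil: "bounded_bilinear (\<lambda>x y :: real ^ 'v ^ 'n. pair_form x y t s)" by (simp add: bilinear_conv_bounded_bilinear)
    have dpd: "((\<lambda>x. pair_form x x t s) has_derivative (\<lambda>y. 2 * pair_form x y t s)) (at x)" for x :: "real ^ 'v ^ 'n"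
    proof -
      have "((\<lambda>x. pair_form x x t s) has_derivative (\<lambda>y. pair_form x y t s + pair_form y x t s)) (at x)"
        by (rule bounded_bilinear.FDERIV[OF bil]) (auto intro: derivative_eq_intros)
      moreover have "pair_form x y t s + pair_form y x t s = 2 * pair_form x y t s" for y by (simp add: pair_form_commute)
      ultimately show ?thesis by simp
    qed
    have cont: "continuous_on UNIV ?f"
      by (intro continuous_on_Pair continuous_edge_form continuous_at_imp_continuous_on ballI)
        (rule has_derivative_continuous[OF dpd])
    obtain e where e: "e > 0" "\<And>z. z \<in> ?L \<times> UNIV \<Longrightarrow> dist z (?f p) < e \<Longrightarrow> \<exists>x\<in>?K. ?f x = z"
    proof (rule subspace_open_mapping[of ?K "?L \<times> UNIV" p ?f ?f'])
      show "subspace ?K" by (rule subspace_stress_configs)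
      show "subspace (?L \<times> (UNIV :: real set))" by (intro subspace_Times) auto
      show "?f x \<in> ?L \<times> UNIV" if "x \<in> ?K" for x using that by (auto intro: span_base)
      show "(?f has_derivative ?f') (at p)" by (intro has_derivative_Pair has_derivative_edge_form dpd)
      fix z assume "z \<in> ?L \<times> (UNIV :: real set)"
      then obtain z1 r where z: "z = (z1, r)" "z1 \<in> ?L" by auto
      then obtain y where y: "y \<in> ?K" "edge_form E p y = (1/2) *\<^sub>R z1" using subsetD[OF surj span_scale[of z1 _ "1/2"]] by force
      \<comment> \<open>The multiple of \<open>u\<close> that corrects the additional component; the
        half comes from differentiating a quadratic form.\<close>
      define c where "c = (r / 2 - pair_form p y t s) / pair_form p u t s"
      have "?f' (y + c *\<^sub>R u) = z"
        using y nz u by (simp add: z edge_form_linear edge_form_scaleR pair_form_linear pair_form_scaleR c_def)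
      moreover have "y + c *\<^sub>R u \<in> ?K" using y uK subspace_stress_configs by (auto intro: subspace_add subspace_scale)
      ultimately show "\<exists>y\<in>?K. ?f' y = z" by blast
    qed (use pw cont in auto)
    have "(edge_form E p p, pair_form p p t s + e / 2) \<in> ?L \<times> UNIV" using pw by (auto intro: span_base)
    moreover have "dist (edge_form E p p, pair_form p p t s + e / 2) (?f p) < e" using e(1) by (simp add: dist_Pair_Pair dist_real_def)
    ultimately obtain x where "?f x = (edge_form E p p, pair_form p p t s + e / 2)" using e(2) by blast
    then have "edge_form E p p = edge_form E x x" "pair_form x x t s \<noteq> pair_form p p t s" using e(1) by auto
    then show False using rigid[of x] by simp
  qed
qed

section \<open>Slices and Gram--Schmidt\<close>

definition edge_form1 :: "'v set set \<Rightarrow> real ^ 'v \<Rightarrow> real ^ 'v \<Rightarrow> real ^ 'v ^ 'v" where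
  "edge_form1 E f g = (\<chi> t u. if {t, u} \<in> E then (f $ t - f $ u) * (g $ t - g $ u) else 0)"

definition stress_kernel :: "'v::finite set set \<Rightarrow> real ^ 'v ^ 'v \<Rightarrow> (real ^ 'v) set" where
  "stress_kernel E w = {f. \<forall>g. w \<bullet> edge_form1 E f g = 0}"

lemma edge_form_edge_form1: "edge_form E x y = (\<Sum>j\<in>UNIV. edge_form1 E (x $ j) (y $ j))"
  by (auto simp: edge_form_def edge_form1_def pair_form_def vec_eq_iff)

lemma edge_form1_linear:
  "edge_form1 E (f + f') g = edge_form1 E f g + edge_form1 E f' g" "edge_form1 E (c *\<^sub>R f) g = c *\<^sub>R edge_form1 E f g" "edge_form1 E 0 g = 0" "edge_form1 E f 0 = 0"
  by (auto simp: edge_form1_def vec_eq_iff algebra_simps)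

lemma subspace_stress_kernel: "subspace (stress_kernel E w)"
  by (auto simp: stress_kernel_def subspace_def edge_form1_linear inner_add_right)

lemma stress_configs_iff: "x \<in> stress_configs E w \<longleftrightarrow> (\<forall>j. x $ j \<in> stress_kernel E w)"
proof
  assume x: "x \<in> stress_configs E w"
  show "\<forall>j. x $ j \<in> stress_kernel E w"
    unfolding stress_kernel_def
  proof (intro allI CollectI)
    fix j g
    have "edge_form E x (axis j g) = (\<Sum>i\<in>UNIV. if i = j then edge_form1 E (x $ j) g else 0)"
      unfolding edge_form_edge_form1 by (intro sum.cong) (auto simp: axis_def edge_form1_linear)
    then have "edge_form E x (axis j g) = edge_form1 E (x $ j) g" by simp
    then show "w \<bullet> edge_form1 E (x $ j) g = 0" using x by (metis (mono_tags) stress_configs_def mem_Collect_eq)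
  qed
qed (auto simp: stress_configs_def stress_kernel_def edge_form_edge_form1 inner_sum_right)

text \<open>Fixing the value at \<open>t0\<close> divides out the constants, which always lie in the
  stress kernel; for configurations it removes translations.\<close>

definition anchored_kernel :: "'v::finite set set \<Rightarrow> real ^ 'v ^ 'v \<Rightarrow> 'v \<Rightarrow> (real ^ 'v) set" where
  "anchored_kernel E w t0 = {f \<in> stress_kernel E w. f $ t0 = 0}"

lemma subspace_anchored_kernel: "subspace (anchored_kernel E w t0)"
  using subspace_stress_kernel[of E w] by (auto simp: anchored_kernel_def subspace_def)

lemma dim_kernel_functional:
  fixes S :: "'a::euclidean_space set" and \<phi> :: "'a \<Rightarrow> real"
  assumes S: "subspace S" and \<phi>: "linear \<phi>" and f: "f \<in> S" "\<phi> f \<noteq> 0"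
  shows "dim S = Suc (dim {x \<in> S. \<phi> x = 0})"
proof -
  let ?T = "{x \<in> S. \<phi> x = 0}"
  have T: "subspace ?T" using S by (auto simp: subspace_def linear_0[OF \<phi>] linear_add[OF \<phi>] linear_cmul[OF \<phi>])
  have "S \<subseteq> span (insert f ?T)"
  proof
    fix x assume x: "x \<in> S"
    define c where "c = \<phi> x / \<phi> f"
    have "\<phi> (x - c *\<^sub>R f) = 0" using f(2) by (simp add: linear_diff[OF \<phi>] linear_cmul[OF \<phi>] c_def)
    moreover have "x - c *\<^sub>R f \<in> S" using x f S by (simp add: subspace_diff subspace_scale)
    ultimately have "x - c *\<^sub>R f \<in> span ?T" by (intro span_base) simp
    then show "x \<in> span (insert f ?T)" by (auto simp: span_breakdown_eq)
  qed
  moreover have "span (insert f ?T) \<subseteq> S" using S f by (intro span_minimal) auto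
  ultimately have "dim S = dim (insert f ?T)" by (metis dim_span subset_antisym)
  moreover have "f \<notin> span ?T" using f(2) T by (metis (mono_tags, lifting) mem_Collect_eq span_eq_iff)
  ultimately show ?thesis by (simp add: dim_insert)
qed

lemma dim_vec_components:
  fixes S :: "'n::finite \<Rightarrow> (real ^ 'v::finite) set"
  assumes S: "\<And>j. subspace (S j)"
  shows "dim {x :: real ^ 'v ^ 'n. \<forall>j. x $ j \<in> S j} = (\<Sum>j\<in>UNIV. dim (S j))"
proof -
  have "\<forall>j. \<exists>B. B \<subseteq> S j \<and> pairwise orthogonal B \<and> (\<forall>x\<in>B. norm x = 1) \<and> independent B \<and> card B = dim (S j) \<and> span B = S j"
    using orthonormal_basis_subspace[OF S] by metis
  then obtain B where B: "\<And>j. B j \<subseteq> S j" "\<And>j. pairwise orthogonal (B j)" "\<And>j x. x \<in> B j \<Longrightarrow> norm x = 1"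
    "\<And>j. independent (B j)" "\<And>j. card (B j) = dim (S j)" "\<And>j. span (B j) = S j" by metis
  have fin: "finite (B j)" for j using B(4) independent_bound by blast
  let ?U = "\<Union>j. axis j ` B j :: (real ^ 'v ^ 'n) set"
  let ?S = "{x :: real ^ 'v ^ 'n. \<forall>j. x $ j \<in> S j}"
  have subS: "subspace ?S" using S by (auto simp: subspace_def)
  have nz: "b \<noteq> 0" if "b \<in> B j" for b j using B(3)[OF that] by auto
  have "?U \<subseteq> ?S" using S subsetD[OF B(1)] by (auto simp: axis_def subspace_0)
  moreover have "?S \<subseteq> span ?U"
  proof
    fix x assume x: "x \<in> ?S"
    have "x = (\<Sum>j\<in>UNIV. axis j (x $ j))"
      by (simp add: vec_eq_iff axis_def if_distrib if_distribR cong: if_cong)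
    moreover have "axis j (x $ j) \<in> span ?U" for j
    proof -
      have "x $ j \<in> span (B j)" using x B(6) by auto
      then show ?thesis
      proof (induction rule: span_induct_alt)
        case base
        have "axis j 0 = (0 :: real ^ 'v ^ 'n)" by (simp add: vec_eq_iff axis_def)
        then show ?case by (metis span_zero)
      next
        case (step c b y)
        have "axis j (c *\<^sub>R b + y) = c *\<^sub>R axis j b + (axis j y :: real ^ 'v ^ 'n)" by (simp add: vec_eq_iff axis_def)
        moreover have "axis j b \<in> span ?U" using step by (auto intro!: span_base)
        ultimately show ?case using step by (simp add: span_add span_scale)
      qed
    qed
    ultimately show "x \<in> span ?U" by (metis (no_types, lifting) span_sum)
  qed
  moreover have "independent ?U"
  proof (rule pairwise_orthogonal_independent)
    show "0 \<notin> ?U" using nz by (auto simp: axis_eq_0_iff)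
    show "pairwise orthogonal ?U"
    proof (rule pairwiseI)
      fix x y assume "x \<in> ?U" "y \<in> ?U" and ne: "x \<noteq> y"
      then obtain i j b c where x: "x = axis i b" "b \<in> B i" and y: "y = axis j c" "c \<in> B j" by blast
      have "x \<bullet> y = (if i = j then b \<bullet> c else 0)" by (simp add: x y inner_axis_axis)
      then show "orthogonal x y" using B(2)[of i] x y ne by (auto simp: orthogonal_def pairwise_def)
    qed
  qed
  moreover have "card ?U = (\<Sum>j\<in>UNIV. dim (S j))"
  proof -
    have "card ?U = (\<Sum>j\<in>UNIV. card (axis j ` B j :: (real ^ 'v ^ 'n) set))"
    proof (rule card_UN_disjoint)
      show "\<forall>i\<in>UNIV. \<forall>j\<in>UNIV. i \<noteq> j \<longrightarrow> axis i ` B i \<inter> axis j ` B j = ({} :: (real ^ 'v ^ 'n) set)"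
        using nz by (auto simp: axis_eq_axis)
    qed (use fin in auto)
    moreover have "card (axis j ` B j :: (real ^ 'v ^ 'n) set) = dim (S j)" for j
      using B(5)[of j] by (subst card_image) (auto simp: inj_on_def axis_eq_axis)
    ultimately show ?thesis by simp
  qed
  ultimately show ?thesis by (rule dim_unique)
qed

section \<open>Triangular position by Gram--Schmidt and rotation\<close>

text \<open>The table of \<open>y i \<bullet> e j\<close> becomes triangular. Its diagonal is
  nonzero if the \<open>y i\<close> are independent modulo the complement of \<open>W\<close>; that
  clause is conditional so that the same lemma also covers vectors in degenerate position.\<close>

lemma gram_schmidt_subspace:
  fixes W :: "'a::euclidean_space set" and y :: "nat \<Rightarrow> 'a"
  assumes "subspace W" "dim W = m"
  shows "\<exists>e :: nat \<Rightarrow> 'a. (\<forall>i<m. e i \<in> W \<and> norm (e i) = 1) \<and> (\<forall>i<m. \<forall>j<m. i \<noteq> j \<longrightarrow> e i \<bullet> e j = 0) \<and>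
    (\<forall>j<m. \<forall>i<j. y i \<bullet> e j = 0) \<and>
    ((\<forall>c. (\<forall>x\<in>W. (\<Sum>i<m. c i *\<^sub>R y i) \<bullet> x = 0) \<longrightarrow> (\<forall>i<m. c i = (0::real))) \<longrightarrow> (\<forall>i<m. y i \<bullet> e i \<noteq> 0))"
  using assms
proof (induction m arbitrary: W y)
  case 0
  then show ?case by simp
next
  case (Suc m)
  obtain \<pi> where \<pi>: "linear \<pi>" "\<And>x. \<pi> x \<in> W" "\<And>x z. z \<in> W \<Longrightarrow> (x - \<pi> x) \<bullet> z = 0"
    using subspace_projection[OF Suc.prems(1)] by metis
  have yz: "y 0 \<bullet> z = \<pi> (y 0) \<bullet> z" if "z \<in> W" for z using \<pi>(3)[OF that, of "y 0"] by (simp add: inner_diff_left)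
  \<comment> \<open>The direction of the projection of \<open>y 0\<close> to \<open>W\<close>, or
    any unit vector of \<open>W\<close> if that projection is zero. Either way the part of
    \<open>W\<close> orthogonal to \<open>e0\<close> is orthogonal to \<open>y 0\<close>.\<close>
  obtain e0 where e0: "e0 \<in> W" "norm e0 = 1" "\<exists>c. \<pi> (y 0) = c *\<^sub>R e0"
  proof (cases "\<pi> (y 0) = 0")
    case True
    have "W \<noteq> {0}" using Suc.prems(2) by auto
    then obtain z where "z \<in> W" "z \<noteq> 0" using subspace_0[OF Suc.prems(1)] by auto
    then show ?thesis
      using True Suc.prems(1) by (intro that[of "(1 / norm z) *\<^sub>R z"]) (auto simp: subspace_scale intro: exI[of _ 0])
  next
    case False
    then show ?thesis
      using \<pi>(2)[of "y 0"] Suc.prems(1) by (intro that[of "(1 / norm (\<pi> (y 0))) *\<^sub>R \<pi> (y 0)"])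
        (auto simp: subspace_scale intro: exI[of _ "norm (\<pi> (y 0))"])
  qed
  have e00: "e0 \<bullet> e0 = 1" using e0(2) by (simp add: norm_eq_1)
  let ?W = "{x \<in> W. x \<bullet> e0 = 0}"
  have lin: "linear (\<lambda>x. x \<bullet> e0)" by (rule linearI) (auto simp: inner_add_left)
  have subW: "subspace ?W" using Suc.prems(1) by (auto simp: subspace_def inner_add_left)
  have "dim ?W = m"
    using dim_kernel_functional[OF Suc.prems(1) lin e0(1)] e00 Suc.prems(2) by simp
  from Suc.IH[OF subW this, of "\<lambda>i. y (Suc i)"] obtain e where
    e: "\<forall>i<m. e i \<in> ?W \<and> norm (e i) = 1" "\<forall>i<m. \<forall>j<m. i \<noteq> j \<longrightarrow> e i \<bullet> e j = 0" "\<forall>j<m. \<forall>i<j. y (Suc i) \<bullet> e j = 0"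
    "(\<forall>c. (\<forall>x\<in>?W. (\<Sum>i<m. c i *\<^sub>R y (Suc i)) \<bullet> x = 0) \<longrightarrow> (\<forall>i<m. c i = (0::real))) \<longrightarrow> (\<forall>i<m. y (Suc i) \<bullet> e i \<noteq> 0)"
    by (elim exE conjE) (rule that, assumption+)
  have y0W: "y 0 \<bullet> x = 0" if "x \<in> ?W" for x
    using that yz[of x] e0(3) by (auto simp: inner_commute)
  define e' where "e' = case_nat e0 e"
  have e's: "e' 0 = e0" "e' (Suc i) = e i" for i by (simp_all add: e'_def)
  have 1: "\<forall>i<Suc m. e' i \<in> W \<and> norm (e' i) = 1"
    using e(1) e0 by (auto simp: less_Suc_eq_0_disj e's)
  have 2: "\<forall>i<Suc m. \<forall>j<Suc m. i \<noteq> j \<longrightarrow> e' i \<bullet> e' j = 0"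
  proof -
    have "\<forall>i<m. e0 \<bullet> e i = 0" using e(1) by (simp add: inner_commute)
    then show ?thesis using e(1,2) by (auto simp: less_Suc_eq_0_disj e's) metis
  qed
  have 3: "\<forall>j<Suc m. \<forall>i<j. y i \<bullet> e' j = 0"
    using e(1,3) y0W by (auto simp: less_Suc_eq_0_disj e's)
  have 4: "\<forall>i<Suc m. y i \<bullet> e' i \<noteq> 0"
    if C: "\<forall>c. (\<forall>x\<in>W. (\<Sum>i<Suc m. c i *\<^sub>R y i) \<bullet> x = 0) \<longrightarrow> (\<forall>i<Suc m. c i = (0::real))"
  proof -
    have y0: "y 0 \<bullet> e0 \<noteq> 0"
    proof
      assume "y 0 \<bullet> e0 = 0"
      then have "\<pi> (y 0) = 0" using yz[OF e0(1)] e0(3) e00 by auto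
      then have "\<forall>x\<in>W. (\<Sum>i<Suc m. (if i = 0 then 1 else 0) *\<^sub>R y i) \<bullet> x = 0"
        using yz by (simp add: sum.lessThan_Suc_shift del: sum.lessThan_Suc)
      then show False using C[rule_format, of "\<lambda>i. if i = 0 then 1 else 0" 0] by auto
    qed
    have "\<forall>i<m. y (Suc i) \<bullet> e i \<noteq> 0"
    proof (rule e(4)[THEN mp], intro allI impI)
      fix c i assume c: "\<forall>x\<in>?W. (\<Sum>i<m. c i *\<^sub>R y (Suc i)) \<bullet> x = 0" and i: "i < m"
      let ?Z = "\<Sum>i<m. c i *\<^sub>R y (Suc i)"
      \<comment> \<open>The coefficient of \<open>y 0\<close> is chosen to make the combination
        orthogonal to \<open>e0\<close> too, which turns a relation in the smaller space into one in
        \<open>W\<close>.\<close>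
      define c' where "c' = case_nat (- (?Z \<bullet> e0) / (y 0 \<bullet> e0)) c"
      have sum: "(\<Sum>i<Suc m. c' i *\<^sub>R y i) = c' 0 *\<^sub>R y 0 + ?Z"
        by (simp add: sum.lessThan_Suc_shift c'_def del: sum.lessThan_Suc)
      have "(\<Sum>i<Suc m. c' i *\<^sub>R y i) \<bullet> x = 0" if x: "x \<in> W" for x
      proof -
        let ?x = "x - (x \<bullet> e0) *\<^sub>R e0"
        have x': "?x \<in> ?W" using x e0(1) e00 Suc.prems(1) by (simp add: subspace_diff subspace_scale inner_diff_left)
        have "(c' 0 *\<^sub>R y 0 + ?Z) \<bullet> ?x = 0" using c x' y0W[OF x'] by (simp add: inner_add_left)
        moreover have "(c' 0 *\<^sub>R y 0 + ?Z) \<bullet> e0 = 0" using y0 by (simp add: inner_add_left inner_diff_left c'_def)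
        ultimately show ?thesis unfolding sum by (simp add: inner_diff_right)
      qed
      then have "c' (Suc i) = 0" using C i by blast
      then show "c i = 0" by (simp add: c'_def)
    qed
    then show ?thesis using y0 by (auto simp: less_Suc_eq_0_disj e's)
  qed
  show ?case by (rule exI[of _ e']) (intro conjI 1 2 3 impI 4)
qed

definition col :: "real ^ 'v ^ 'n \<Rightarrow> 'v \<Rightarrow> real ^ 'n" where
  "col x s = (\<chi> j. x $ j $ s)"

lemma col_nth [simp]: "col x s $ j = x $ j $ s"
  by (simp add: col_def)

lemma col_eqI: "(\<And>s. col x s = col y s) \<Longrightarrow> x = y"
  by (simp add: col_def vec_eq_iff)

lemma pair_form_col: "pair_form x y t u = (col x t - col x u) \<bullet> (col y t - col y u)"
  by (simp add: pair_form_def inner_vec_def)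

definition rot :: "real ^ 'n ^ 'n \<Rightarrow> real ^ 'v ^ 'n \<Rightarrow> real ^ 'v ^ 'n" where
  "rot P x = (\<chi> j s. (P *v col x s) $ j)"

lemma col_rot: "col (rot P x) s = P *v col x s"
  by (simp add: rot_def vec_eq_iff)

lemma pair_form_rot:
  assumes "orthogonal_matrix P"
  shows "pair_form (rot P x) (rot P y) t u = pair_form x y t u"
proof -
  have "orthogonal_transformation ((*v) P)"
    using assms by (simp add: orthogonal_transformation_matrix matrix_vector_mul_linear)
  then show ?thesis
    by (simp add: pair_form_col col_rot orthogonal_transformation_def flip: matrix_vector_mult_diff_distrib)
qed

lemma edge_form_rot: "orthogonal_matrix P \<Longrightarrow> edge_form E (rot P x) (rot P y) = edge_form E x y"
  by (simp add: edge_form_def pair_form_rot vec_eq_iff)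

lemma rot_transpose:
  assumes "orthogonal_matrix P"
  shows "rot P (rot (transpose P) y) = y"
proof -
  have "P ** transpose P = mat 1" using assms by (simp add: orthogonal_matrix_def)
  then show ?thesis by (intro col_eqI) (simp only: col_rot matrix_vector_mul_assoc matrix_vector_mul_lid)
qed

lemma inf_rigid_rot:
  assumes P: "orthogonal_matrix P" and x: "inf_rigid E x"
  shows "inf_rigid E (rot P x)"
  unfolding inf_rigid_def
proof (intro allI impI)
  fix u t s assume u: "edge_form E (rot P x) u = 0"
  let ?u = "rot (transpose P) u"
  have "edge_form E x ?u = 0" using u edge_form_rot[OF P, of E x ?u] by (simp add: rot_transpose[OF P])
  then have "pair_form x ?u t s = 0" using x by (simp add: inf_rigid_def)
  then show "pair_form (rot P x) u t s = 0" using pair_form_rot[OF P, of x ?u] by (simp add: rot_transpose[OF P])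
qed

lemma orthonormal_rows_matrix:
  fixes e :: "'n::finite \<Rightarrow> real ^ 'n"
  assumes "\<And>i. norm (e i) = 1" "\<And>i j. i \<noteq> j \<Longrightarrow> e i \<bullet> e j = 0"
  shows "orthogonal_matrix (\<chi> i. e i)"
  using assms by (simp add: orthogonal_matrix_orthonormal_rows row_def orthogonal_def)

lemma rot_rows: "rot (\<chi> i. e i) x $ j $ s = e j \<bullet> col x s"
  by (simp add: rot_def matrix_vector_mult_def inner_vec_def)

text \<open>Forward substitution in a triangular system with nonzero diagonal, in the order that
  \<open>rk\<close> puts on the coordinates.\<close>

lemma triangular_zero:
  fixes z :: "real ^ 'n::finite" and c :: "nat \<Rightarrow> real ^ 'n"
  assumes inj: "inj rk" and orth: "\<And>j. rk j < k \<Longrightarrow> c (rk j) \<bullet> z = 0"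
    and tri: "\<And>i j. rk j < k \<Longrightarrow> rk j < rk i \<Longrightarrow> c (rk j) $ i = 0" and diag: "\<And>j. rk j < k \<Longrightarrow> c (rk j) $ j \<noteq> (0::real)"
    and j: "rk j < k"
  shows "z $ j = 0"
  using j
proof (induction "rk j" arbitrary: j rule: less_induct)
  case less
  have "c (rk j) \<bullet> z = (\<Sum>i\<in>UNIV. if i = j then c (rk j) $ j * z $ j else 0)"
    unfolding inner_vec_def
  proof (rule sum.cong[OF refl])
    fix i
    consider "i = j" | "rk i < rk j" | "rk j < rk i" using inj by (metis injD linorder_neqE_nat)
    then show "c (rk j) $ i \<bullet> z $ i = (if i = j then c (rk j) $ j * z $ j else 0)"
      using less tri[of j i] by cases auto
  qed
  then have "c (rk j) $ j * z $ j = 0" using orth[OF less.prems] by simp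
  then show ?case using diag[OF less.prems] by simp
qed

section \<open>Pinned configurations\<close>

definition anchored_configs :: "'v::finite set set \<Rightarrow> real ^ 'v ^ 'v \<Rightarrow> 'v \<Rightarrow> (real ^ 'v ^ 'n::finite) set" where
  "anchored_configs E w t0 = {x. \<forall>j. x $ j \<in> anchored_kernel E w t0}"

text \<open>The situation to be refuted: by \<open>big\<close>, the stress kernel modulo constants
  has more dimensions than there are coordinate functions of \<open>p\<close>. The vertex
  \<open>t0\<close> is held at the origin, and \<open>rk\<close> orders the coordinates so that
  triangular configurations make sense.\<close>

locale pinning =
  fixes E :: "'v::finite set set" and p :: "real ^ 'v ^ 'n::finite" and w :: "real ^ 'v ^ 'v" and t0 :: 'v
    and rk :: "'n \<Rightarrow> nat" and d :: nat
  assumes generic_conf: "generic_conf p" and pK: "p \<in> stress_configs E w"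
    and surj: "span {edge_form E x y | x y. x \<in> (stress_configs E w :: (real ^ 'v ^ 'n) set) \<and> y \<in> (stress_configs E w :: (real ^ 'v ^ 'n) set)} \<subseteq> edge_form E p ` stress_configs E w"
    and inf_rigid: "inf_rigid E p" and rk: "bij_betw rk UNIV {..<d}" and big: "d < dim (anchored_kernel E w t0)" and d_eq: "d = CARD('n)"
begin

abbreviation V :: "(real ^ 'v) set" where "V \<equiv> anchored_kernel E w t0"

lemma inj_rk: "inj rk" using rk by (simp add: bij_betw_def)

lemma rk_less: "rk j < d" using rk by (auto simp: bij_betw_def)

lemma rk_surj: "k < d \<Longrightarrow> \<exists>j. rk j = k"
proof -
  assume "k < d"
  then have "k \<in> range rk" using rk by (simp add: bij_betw_def)
  then show ?thesis by blast
qed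

definition Wn :: "(nat \<Rightarrow> 'v) \<Rightarrow> nat \<Rightarrow> (real ^ 'v) set" where
  "Wn t k = {f \<in> V. \<forall>i<k. f $ t i = 0}"

text \<open>Every new pinned vertex imposes a condition independent of the earlier ones, so the
  dimension of \<open>V\<close> drops by exactly one each time.\<close>

definition admissible :: "(nat \<Rightarrow> 'v) \<Rightarrow> nat \<Rightarrow> bool" where
  "admissible t k \<longleftrightarrow> (\<forall>i<k. \<exists>f\<in>Wn t i. f $ t i \<noteq> 0)"

text \<open>A slice for rotations: vertex \<open>t i\<close> may use only coordinates of rank at
  most \<open>i\<close>, as in the triangular factor of a QR decomposition.\<close>

definition A :: "(nat \<Rightarrow> 'v) \<Rightarrow> (real ^ 'v ^ 'n) set" where
  "A t = {x. \<forall>j. x $ j \<in> Wn t (rk j)}"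

definition L :: "(real ^ 'v ^ 'v) set" where
  "L = edge_form E p ` stress_configs E w"

text \<open>The common dimension of the slices of admissible \<open>t\<close>; it turns out to be
  the dimension of \<open>L\<close> as well.\<close>

definition D :: nat where "D = (\<Sum>j\<in>UNIV. dim V - rk j)"

lemma subspace_L: "subspace L" unfolding L_def by (intro linear_subspace_image linear_edge_form subspace_stress_configs)

lemma subspace_Wn: "subspace (Wn t k)"
  using subspace_anchored_kernel[of E w t0] by (auto simp: Wn_def subspace_def)

lemma subspace_A: "subspace (A t)"
  using subspace_Wn by (auto simp: A_def subspace_def)

lemma subspace_anchored_configs: "subspace (anchored_configs E w t0)"
  using subspace_anchored_kernel[of E w t0] by (auto simp: anchored_configs_def subspace_def)

lemma A_anchored_configs: "A t \<subseteq> anchored_configs E w t0" by (auto simp: A_def anchored_configs_def Wn_def)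

lemma anchored_configs_stress_configs: "anchored_configs E w t0 \<subseteq> stress_configs E w" by (auto simp: anchored_configs_def stress_configs_iff anchored_kernel_def)

lemma edge_form_in_L:
  assumes "x \<in> anchored_configs E w t0" "(y :: real ^ 'v ^ 'n) \<in> anchored_configs E w t0"
  shows "edge_form E x y \<in> L"
  unfolding L_def by (rule subsetD[OF surj], rule span_base) (use assms anchored_configs_stress_configs in blast)

lemma A_iff: "x \<in> A t \<longleftrightarrow> x \<in> stress_configs E w \<and> (\<forall>j. x $ j $ t0 = 0 \<and> (\<forall>i<rk j. x $ j $ t i = 0))"
  by (auto simp: A_def Wn_def anchored_kernel_def stress_configs_iff)

lemma dim_Wn: "admissible t k \<Longrightarrow> dim (Wn t k) + k = dim V"
proof (induction k)
  case 0
  then show ?case by (simp add: Wn_def)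
next
  case (Suc k)
  then obtain f where f: "f \<in> Wn t k" "f $ t k \<noteq> 0" by (auto simp: admissible_def)
  have "admissible t k" using Suc.prems by (auto simp: admissible_def)
  moreover have "dim (Wn t k) = Suc (dim {x \<in> Wn t k. x $ t k = 0})"
    by (rule dim_kernel_functional[of "Wn t k" "\<lambda>x. x $ t k" f]) (auto intro!: linearI simp: subspace_Wn f)
  moreover have "{x \<in> Wn t k. x $ t k = 0} = Wn t (Suc k)" by (auto simp: Wn_def less_Suc_eq)
  ultimately show ?case using Suc.IH by simp
qed

lemma admissible_mono: "admissible t k \<Longrightarrow> i \<le> k \<Longrightarrow> admissible t i"
  by (auto simp: admissible_def)

lemma admissible_exists: "k \<le> d \<Longrightarrow> \<exists>t. admissible t k"
proof (induction k)
  case 0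
  then show ?case by (simp add: admissible_def)
next
  case (Suc k)
  then obtain t where t: "admissible t k" by auto
  have "dim (Wn t k) \<noteq> 0" using dim_Wn[OF t] big Suc.prems by linarith
  then have "\<not> Wn t k \<subseteq> {0}" by (simp add: dim_eq_0)
  then obtain f where "f \<in> Wn t k" "f \<noteq> 0" by auto
  then obtain s where f: "f \<in> Wn t k" "f $ s \<noteq> 0" by (auto simp: vec_eq_iff)
  have W: "Wn (t(k := s)) i = Wn t i" if "i \<le> k" for i using that by (auto simp: Wn_def)
  have "admissible (t(k := s)) (Suc k)"
    unfolding admissible_def
  proof (intro allI impI)
    fix i assume "i < Suc k"
    then consider "i < k" | "i = k" by linarith
    then show "\<exists>f\<in>Wn (t(k := s)) i. f $ (t(k := s)) i \<noteq> 0"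
    proof cases
      case 1
      then show ?thesis using t W[of i] by (auto simp: admissible_def)
    next
      case 2
      then show ?thesis using f W[of k] by auto
    qed
  qed
  then show ?case by blast
qed

lemma dim_A: "admissible t d \<Longrightarrow> dim (A t) = D"
proof -
  assume t: "admissible t d"
  have "dim (Wn t (rk j)) = dim V - rk j" for j
    using dim_Wn[OF admissible_mono[OF t less_imp_le[OF rk_less[of j]]]] by simp
  then show ?thesis unfolding A_def D_def by (subst dim_vec_components) (auto simp: subspace_Wn)
qed

text \<open>Deleting coordinate \<open>j\<close> loses \<open>dim V - rk j\<close> dimensions, at
  least two since \<open>rk j < d < dim V\<close>. This is where the excess of the stress kernel
  enters: for \<open>dim V = d\<close> the coordinate of highest rank would cost only one.\<close>

lemma dim_A_degenerate:
  assumes t: "admissible t d"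
  shows "dim {x \<in> A t. x $ j = 0} + 2 \<le> D"
proof -
  have W: "dim (Wn t (rk j)) = dim V - rk j" for j
    using dim_Wn[OF admissible_mono[OF t less_imp_le[OF rk_less[of j]]]] by simp
  have "{x \<in> A t. x $ j = 0} = {x. \<forall>i. x $ i \<in> (if i = j then {0} else Wn t (rk i))}"
    using subspace_0[OF subspace_Wn] by (auto simp: A_def split: if_splits)
  then have "dim {x \<in> A t. x $ j = 0} = (\<Sum>i\<in>UNIV. dim (if i = j then {0} else Wn t (rk i)))"
    by (simp only:) (rule dim_vec_components, auto simp: subspace_Wn)
  also have "\<dots> = (\<Sum>i\<in>UNIV - {j}. dim V - rk i)"
    by (subst sum.remove[of _ j]) (auto simp: W intro!: sum.cong)
  also have "\<dots> + (dim V - rk j) = D" unfolding D_def by (subst (2) sum.remove[of _ j]) auto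
  finally show ?thesis using big rk_less[of j] by linarith
qed

lemma rows_in_A:
  assumes x: "x \<in> anchored_configs E w t0" and e: "\<And>i j. i < j \<Longrightarrow> j < d \<Longrightarrow> col x (t i) \<bullet> e j = 0"
  shows "rot (\<chi> j. e (rk j)) x \<in> A t"
proof -
  have "rot (\<chi> j. e (rk j)) x $ j = (\<Sum>l\<in>UNIV. e (rk j) $ l *\<^sub>R x $ l)" for j
    by (simp add: vec_eq_iff rot_rows inner_vec_def)
  moreover have "(\<Sum>l\<in>UNIV. e (rk j) $ l *\<^sub>R x $ l) \<in> V" for j
    using x by (auto simp: anchored_configs_def intro!: subspace_sum subspace_scale subspace_anchored_kernel)
  moreover have "rot (\<chi> j. e (rk j)) x $ j $ t i = 0" if "i < rk j" for i j
    unfolding rot_rows using e[OF that rk_less] by (simp add: inner_commute)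
  ultimately show ?thesis by (simp add: A_def Wn_def)
qed

text \<open>Gram--Schmidt applied to the pinned positions supplies the rotation, and the rotated
  coordinate functions with their nonzero diagonal entries are themselves the witnesses of
  admissibility.\<close>

lemma pin_independent:
  assumes x: "x \<in> anchored_configs E w t0" and ind: "\<And>c. (\<Sum>i<d. c i *\<^sub>R col x (t i)) = 0 \<Longrightarrow> \<forall>i<d. c i = (0::real)"
  obtains P where "orthogonal_matrix P" "rot P x \<in> A t" "\<And>j. rot P x $ j $ t (rk j) \<noteq> 0" "admissible t d"
proof -
  have C: "\<forall>c. (\<forall>z\<in>UNIV. (\<Sum>i<d. c i *\<^sub>R col x (t i)) \<bullet> z = 0) \<longrightarrow> (\<forall>i<d. c i = (0::real))"
    using ind by (metis UNIV_I inner_eq_zero_iff)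
  obtain e where e: "\<forall>i<d. norm (e i) = 1" "\<forall>i<d. \<forall>j<d. i \<noteq> j \<longrightarrow> e i \<bullet> e j = 0"
    "\<forall>j<d. \<forall>i<j. col x (t i) \<bullet> e j = 0" "\<forall>i<d. col x (t i) \<bullet> e i \<noteq> 0"
    using gram_schmidt_subspace[of "UNIV :: (real ^ 'n) set" d "\<lambda>i. col x (t i)"] C d_eq by auto
  let ?P = "\<chi> j. e (rk j)"
  have P: "orthogonal_matrix ?P"
    using e(1,2) rk_less inj_rk by (intro orthonormal_rows_matrix) (auto simp: inj_eq)
  have A: "rot ?P x \<in> A t" using e(3) by (intro rows_in_A[OF x]) auto
  have diag: "rot ?P x $ j $ t (rk j) \<noteq> 0" for j using e(4) rk_less by (simp add: rot_rows inner_commute)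
  have "admissible t d"
    unfolding admissible_def
  proof (intro allI impI)
    fix i assume "i < d"
    then obtain j where "rk j = i" using rk_surj by blast
    then show "\<exists>f\<in>Wn t i. f $ t i \<noteq> 0" using A diag[of j] by (intro bexI[of _ "rot ?P x $ j"]) (auto simp: A_def)
  qed
  then show ?thesis using P A diag that by blast
qed

text \<open>If the positions span, \<open>d\<close> of the vertices have independent positions and
  are pinned with nonzero diagonal. Otherwise all positions lie in a hyperplane, and its normal,
  used as an axis, gives a coordinate that vanishes identically.\<close>

lemma pin:
  assumes x: "x \<in> anchored_configs E w t0"
  obtains t P where "admissible t d" "orthogonal_matrix P" "rot P x \<in> A t"
    "(\<forall>j. rot P x $ j $ t (rk j) \<noteq> 0) \<or> (\<exists>j. rot P x $ j = 0)"
proof (cases "span (range (col x)) = UNIV")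
  case True
  obtain B where B: "B \<subseteq> range (col x)" "independent B" "range (col x) \<subseteq> span B" "card B = dim (range (col x))"
    using basis_exists by metis
  have cB: "card B = d" using B(4) True d_eq by (metis dim_span dim_UNIV DIM_cart DIM_real mult.right_neutral)
  have fin: "finite B" using B(2) independent_bound by blast
  obtain h where h: "bij_betw h {..<d} B" using ex_bij_betw_nat_finite[OF fin] cB by (auto simp: atLeast0LessThan)
  have "\<forall>i. \<exists>s. i < d \<longrightarrow> col x s = h i" using h B(1) by (auto simp: bij_betw_def) (metis imageE image_eqI lessThan_iff subsetD)
  then obtain t where t: "\<And>i. i < d \<Longrightarrow> col x (t i) = h i" by metis
  have "\<forall>i<d. c i = 0" if c: "(\<Sum>i<d. c i *\<^sub>R col x (t i)) = 0" for c :: "nat \<Rightarrow> real"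
  proof -
    let ?g = "the_inv_into {..<d} h"
    have g: "?g (h i) = i" if "i < d" for i using h that by (auto simp: bij_betw_def the_inv_into_f_f)
    have "(\<Sum>b\<in>B. c (?g b) *\<^sub>R b) = (\<Sum>i<d. c (?g (h i)) *\<^sub>R h i)"
      using sum.reindex_bij_betw[OF h, of "\<lambda>b. c (?g b) *\<^sub>R b"] by simp
    also have "\<dots> = 0" using c t g by simp
    finally have "c (?g b) = 0" if "b \<in> B" for b
      using independentD[OF B(2) fin subset_refl, of "\<lambda>b. c (?g b)" b] that by simp
    then show ?thesis using bij_betwE[OF h] g by (metis lessThan_iff)
  qed
  then show ?thesis using pin_independent[OF x, of t] that by blast
next
  case False
  then obtain a where a: "a \<noteq> 0" "\<And>z. z \<in> span (range (col x)) \<Longrightarrow> a \<bullet> z = 0"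
    using span_not_univ_subset_hyperplane[of "range (col x)"] by blast
  define \<nu> where "\<nu> = (1 / norm a) *\<^sub>R a"
  have \<nu>: "norm \<nu> = 1" "\<nu> \<bullet> col x s = 0" for s using a span_base[of "col x s" "range (col x)"] by (auto simp: \<nu>_def)
  obtain t where t: "admissible t d" using admissible_exists by blast
  let ?W = "{z \<in> UNIV. z \<bullet> \<nu> = 0}"
  have lin: "linear (\<lambda>z. z \<bullet> \<nu>)" by (rule linearI) (auto simp: inner_add_left)
  have "\<nu> \<noteq> 0" using \<nu>(1) by auto
  then have "DIM(real ^ 'n) = Suc (dim ?W)"
    using dim_kernel_functional[OF subspace_UNIV lin, of \<nu>] by simp
  then have dW: "dim ?W = d - 1" using d_eq by simp
  have subW: "subspace ?W" by (auto simp: subspace_def inner_add_left)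
  obtain e where e: "\<forall>i<d-1. e i \<in> ?W \<and> norm (e i) = 1" "\<forall>i<d-1. \<forall>j<d-1. i \<noteq> j \<longrightarrow> e i \<bullet> e j = 0"
    "\<forall>j<d-1. \<forall>i<j. col x (t i) \<bullet> e j = 0"
    using gram_schmidt_subspace[OF subW dW, of "\<lambda>i. col x (t i)"] by (elim exE conjE) (rule that, assumption+)
  \<comment> \<open>The last place goes to the normal. It is orthogonal to all positions and so
    leaves the triangular shape intact.\<close>
  define e' where "e' = e(d - 1 := \<nu>)"
  have less: "i < d \<Longrightarrow> i < d - 1 \<or> i = d - 1" for i by linarith
  have n1: "norm (e' i) = 1" if "i < d" for i using less[OF that] e(1) \<nu>(1) by (auto simp: e'_def)
  have o1: "e' i \<bullet> e' j = 0" if "i < d" "j < d" "i \<noteq> j" for i j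
    using less[OF that(1)] less[OF that(2)] that(3) e(1,2) by (auto simp: e'_def inner_commute)
  have c1: "col x (t i) \<bullet> e' j = 0" if "i < j" "j < d" for i j
    using less[OF that(2)] that e(3) \<nu>(2) by (auto simp: e'_def inner_commute)
  let ?P = "\<chi> j. e' (rk j)"
  have P: "orthogonal_matrix ?P"
    using n1 o1 rk_less inj_rk by (intro orthonormal_rows_matrix) (auto simp: inj_eq)
  have A: "rot ?P x \<in> A t" using c1 by (intro rows_in_A[OF x]) auto
  have "d > 0" using d_eq by simp
  then obtain j where j: "rk j = d - 1" using rk_surj[of "d - 1"] by auto
  have "rot ?P x $ j = 0" using \<nu>(2) j by (simp add: vec_eq_iff rot_rows e'_def)
  then show ?thesis using t P A that by blast
qed

lemma anchored_configs_t0: "x \<in> anchored_configs E w t0 \<Longrightarrow> col x t0 = 0"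
  by (simp add: anchored_configs_def anchored_kernel_def vec_eq_iff)

lemma tri_A:
  assumes "x \<in> A t" "k < rk i"
  shows "col x (t k) $ i = 0"
  using assms by (auto simp: A_iff)

text \<open>With \<open>t0\<close> at the origin, distances determine inner products. As for a
  Cholesky factor, these determine the pinned positions one after another up to the sign of the
  diagonal entry; the remaining vertices follow by substitution.\<close>

lemma pinned_unique:
  assumes x: "x \<in> A t" and y: "y \<in> A t" and sgn: "\<And>j. x $ j $ t (rk j) * y $ j $ t (rk j) > 0"
    and eq: "\<And>s r. pair_form x x s r = pair_form y y s r"
  shows "x = y"
proof -
  have 0: "col x t0 = 0" "col y t0 = 0" using x y A_anchored_configs anchored_configs_t0 by blast+
  have sq: "col x s \<bullet> col x s = col y s \<bullet> col y s" for s using eq[of s t0] by (simp add: pair_form_col 0)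
  have inn: "col x s \<bullet> col x r = col y s \<bullet> col y r" for s r
    using eq[of s r] sq[of s] sq[of r] by (simp add: pair_form_col inner_diff_left inner_diff_right inner_commute)
  have diag: "col x (t (rk j)) $ j \<noteq> 0" for j using sgn[of j] by auto
  have "col x (t k) = col y (t k)" if "k < d" for k using that
  proof (induction k rule: less_induct)
    case (less k)
    let ?z = "col x (t k) - col y (t k)"
    have small: "?z $ j = 0" if "rk j < k" for j
    proof (rule triangular_zero[OF inj_rk, of k "\<lambda>l. col x (t l)"])
      fix j assume "rk j < k"
      then have "col x (t (rk j)) = col y (t (rk j))" using less by auto
      then show "col x (t (rk j)) \<bullet> ?z = 0" using inn[of "t (rk j)" "t k"] by (simp add: inner_diff_right)
    qed (use tri_A[OF x] diag that in auto)
    obtain i where i: "rk i = k" using rk_surj less.prems by blast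
    have other: "?z $ j = 0" if "j \<noteq> i" for j
    proof (cases "rk j < k")
      case True then show ?thesis using small by blast
    next
      case False
      then have "k < rk j" using that i inj_rk by (metis injD linorder_neqE_nat)
      then show ?thesis using tri_A[OF x] tri_A[OF y] by simp
    qed
    have "(\<Sum>j\<in>UNIV. (x $ j $ t k)^2) = (\<Sum>j\<in>UNIV. (y $ j $ t k)^2)"
      using sq[of "t k"] by (simp add: inner_vec_def power2_eq_square)
    moreover have "(\<Sum>j\<in>UNIV - {i}. (x $ j $ t k)^2) = (\<Sum>j\<in>UNIV - {i}. (y $ j $ t k)^2)"
      using other by (intro sum.cong) auto
    ultimately have "(x $ i $ t k)^2 = (y $ i $ t k)^2" by (simp add: sum.remove[of UNIV i])
    then have "x $ i $ t k = y $ i $ t k \<or> x $ i $ t k = - y $ i $ t k" by (simp add: power2_eq_iff)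
    moreover have "x $ i $ t k * y $ i $ t k > 0" using sgn[of i] i by simp
    ultimately have "x $ i $ t k = y $ i $ t k" using mult_nonneg_nonneg by (smt (verit) mult_minus_left zero_le_square)
    then have "x $ j $ t k = y $ j $ t k" for j using other[of j] by (cases "j = i") auto
    then show ?case by (simp add: vec_eq_iff)
  qed
  note tk = this
  have "col x s = col y s" for s
  proof -
    let ?z = "col x s - col y s"
    have "?z $ j = 0" for j
    proof (rule triangular_zero[OF inj_rk, of d "\<lambda>l. col x (t l)"])
      fix j
      have "col x (t (rk j)) = col y (t (rk j))" using tk rk_less by auto
      then show "col x (t (rk j)) \<bullet> ?z = 0" using inn[of "t (rk j)" s] by (simp add: inner_diff_right)
    qed (use tri_A[OF x] diag rk_less in auto)
    then show ?thesis by (simp add: vec_eq_iff)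
  qed
  then show ?thesis by (rule col_eqI)
qed

text \<open>The linearization of the preceding uniqueness: infinitesimal rigidity makes all
  first-order changes of distance vanish, and the triangular shape excludes infinitesimal
  rotations.\<close>

lemma pinned_inj:
  assumes x: "x \<in> A t" and diag: "\<And>j. x $ j $ t (rk j) \<noteq> 0" and IRx: "inf_rigid E x" and y: "y \<in> A t" and z: "edge_form E x y = 0"
  shows "y = 0"
proof -
  have 0: "col x t0 = 0" "col y t0 = 0" using x y A_anchored_configs anchored_configs_t0 by blast+
  have pair_form: "pair_form x y s r = 0" for s r using IRx z by (simp add: inf_rigid_def)
  have sq: "col x s \<bullet> col y s = 0" for s using pair_form[of s t0] by (simp add: pair_form_col 0)
  have inn: "col x s \<bullet> col y r + col x r \<bullet> col y s = 0" for s r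
    using pair_form[of s r] sq[of s] sq[of r] by (simp add: pair_form_col inner_diff_left inner_diff_right)
  have "col y (t k) = 0" if "k < d" for k using that
  proof (induction k rule: less_induct)
    case (less k)
    have small: "col y (t k) $ j = 0" if "rk j < Suc k" for j
    proof (rule triangular_zero[OF inj_rk, of "Suc k" "\<lambda>l. col x (t l)"])
      fix j assume "rk j < Suc k"
      then consider "rk j < k" | "rk j = k" by linarith
      then show "col x (t (rk j)) \<bullet> col y (t k) = 0"
      proof cases
        case 1
        then show ?thesis using inn[of "t (rk j)" "t k"] less by simp
      qed (use sq in simp)
    qed (use tri_A[OF x] diag that in auto)
    have "col y (t k) $ j = 0" for j
      using small[of j] tri_A[OF y, of k j] by (cases "rk j < Suc k") auto
    then show ?case by (simp add: vec_eq_iff)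
  qed
  note tk = this
  have "col y s = col 0 s" for s
  proof -
    have "col y s $ j = 0" for j
    proof (rule triangular_zero[OF inj_rk, of d "\<lambda>l. col x (t l)"])
      fix j
      show "col x (t (rk j)) \<bullet> col y s = 0" using inn[of "t (rk j)" s] tk[OF rk_less[of j]] by simp
    qed (use tri_A[OF x] diag rk_less in auto)
    then show ?thesis by (simp add: vec_eq_iff)
  qed
  then show ?thesis by (rule col_eqI)
qed

definition anchored_p :: "real ^ 'v ^ 'n" where
  "anchored_p = (\<chi> j s. p $ j $ s - p $ j $ t0)"

lemma pair_form_shift: "pair_form (\<chi> j s. x $ j $ s - x $ j $ t0) y t u = pair_form x y t u"
  by (simp add: pair_form_def)

lemma edge_form_shift: "edge_form E (\<chi> j s. x $ j $ s - x $ j $ t0) y = edge_form E x y"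
  by (simp add: edge_form_def pair_form_shift vec_eq_iff)

lemma shift_anchored_configs: "x \<in> stress_configs E w \<Longrightarrow> (\<chi> j s. x $ j $ s - x $ j $ t0) \<in> anchored_configs E w t0"
proof -
  assume "x \<in> stress_configs E w"
  then have "(\<chi> j s. x $ j $ s - x $ j $ t0) \<in> stress_configs E w" by (simp add: stress_configs_def edge_form_shift)
  then show ?thesis by (auto simp: anchored_configs_def anchored_kernel_def stress_configs_iff)
qed

lemma anchored_p_anchored_configs: "anchored_p \<in> anchored_configs E w t0" unfolding anchored_p_def by (rule shift_anchored_configs[OF pK])

lemma inf_rigid_anchored_p: "inf_rigid E anchored_p"
  using inf_rigid by (simp add: inf_rigid_def anchored_p_def edge_form_shift pair_form_shift)

lemma L_surj: "z \<in> L \<Longrightarrow> \<exists>y\<in>anchored_configs E w t0. edge_form E anchored_p y = z"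
proof -
  assume "z \<in> L"
  then obtain y where y: "y \<in> stress_configs E w" "z = edge_form E p y" by (auto simp: L_def)
  let ?y = "\<chi> j s. y $ j $ s - y $ j $ t0"
  have "edge_form E anchored_p ?y = z" unfolding anchored_p_def edge_form_shift using y(2) edge_form_shift[of y p] by (simp add: edge_form_commute[of E p])
  then show ?thesis using shift_anchored_configs[OF y(1)] by blast
qed

end

section \<open>Generic values of the measurement map\<close>

text \<open>A choice function rather than an existential, so that the field \<open>F0\<close> can be
  defined from these bases once and for all.\<close>

definition some_basis :: "'a::euclidean_space set \<Rightarrow> 'a set" where
  "some_basis S = (SOME B. B \<subseteq> S \<and> independent B \<and> S \<subseteq> span B \<and> card B = dim S)"

lemma some_basis: "some_basis S \<subseteq> S" "independent (some_basis S)" "S \<subseteq> span (some_basis S)" "card (some_basis S) = dim S" "finite (some_basis S)"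
proof -
  have "\<exists>B. B \<subseteq> S \<and> independent B \<and> S \<subseteq> span B \<and> card B = dim S" using basis_exists by metis
  from someI_ex[OF this] show "some_basis S \<subseteq> S" "independent (some_basis S)" "S \<subseteq> span (some_basis S)" "card (some_basis S) = dim S"
    unfolding some_basis_def by auto
  then show "finite (some_basis S)" using independent_bound by blast
qed

lemma span_some_basis: "subspace S \<Longrightarrow> span (some_basis S) = S"
  using some_basis[of S] span_minimal[of "some_basis S" S] by blast

lemma deriv_free_subset:
  assumes "deriv_free D c I" "J \<subseteq> I"
  shows "deriv_free D c J"
  unfolding deriv_free_def
proof (intro allI impI)
  fix \<delta> v assume "deriv_on D \<delta>"
  then obtain \<delta>' where d: "deriv_on (fld (D \<union> c ` I)) \<delta>'" "\<forall>y\<in>D. \<delta>' y = \<delta> y" "\<forall>i\<in>I. \<delta>' (c i) = v i"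
    using assms(1) unfolding deriv_free_def by metis
  have "fld (D \<union> c ` J) \<subseteq> fld (D \<union> c ` I)" using assms(2) by (intro fld_mono) auto
  then have "deriv_on (fld (D \<union> c ` J)) \<delta>'" using deriv_on_subset[OF d(1)] by simp
  then show "\<exists>\<delta>'. deriv_on (fld (D \<union> c ` J)) \<delta>' \<and> (\<forall>y\<in>D. \<delta>' y = \<delta> y) \<and> (\<forall>i\<in>J. \<delta>' (c i) = v i)"
    using d assms(2) by blast
qed

lemma map_entries_combination:
  fixes b :: "'k \<Rightarrow> real ^ 'b::finite ^ 'c::finite"
  assumes d: "deriv_on D \<delta>" and c: "\<And>i. i \<in> I \<Longrightarrow> c i \<in> D" and b: "\<And>i. i \<in> I \<Longrightarrow> entries (b i) \<subseteq> D"
    and 0: "\<And>i x. i \<in> I \<Longrightarrow> x \<in> entries (b i) \<Longrightarrow> \<delta> x = 0"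
  shows "map_entries \<delta> (\<Sum>i\<in>I. c i *\<^sub>R b i) = (\<Sum>i\<in>I. \<delta> (c i) *\<^sub>R b i)" "entries (\<Sum>i\<in>I. c i *\<^sub>R b i) \<subseteq> D"
proof -
  note D = deriv_onD(1)[OF d]
  have m: "c i * b i $ k $ l \<in> D" if "i \<in> I" for i k l using that c b by (intro subfldD(4)[OF D]) (auto simp: entsD)
  then show "entries (\<Sum>i\<in>I. c i *\<^sub>R b i) \<subseteq> D" by (auto simp: entries_iff intro!: subfld_sum D)
  have "\<delta> (\<Sum>i\<in>I. c i * b i $ k $ l) = (\<Sum>i\<in>I. \<delta> (c i) * b i $ k $ l)" for k l
  proof -
    have "\<delta> (\<Sum>i\<in>I. c i * b i $ k $ l) = (\<Sum>i\<in>I. \<delta> (c i * b i $ k $ l))" using m by (intro deriv_on_sum[OF d])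
    also have "\<dots> = (\<Sum>i\<in>I. \<delta> (c i) * b i $ k $ l)"
    proof (rule sum.cong[OF refl])
      fix i assume i: "i \<in> I"
      have "b i $ k $ l \<in> entries (b i)" using entsD[OF subset_refl] .
      then show "\<delta> (c i * b i $ k $ l) = \<delta> (c i) * b i $ k $ l"
        using i c b 0 by (subst deriv_onD(6)[OF d]) (auto simp: mult.commute)
    qed
    finally show ?thesis .
  qed
  then show "map_entries \<delta> (\<Sum>i\<in>I. c i *\<^sub>R b i) = (\<Sum>i\<in>I. \<delta> (c i) *\<^sub>R b i)" by (simp add: vec_eq_iff)
qed

context pinning
begin

lemma admissible_inj:
  assumes t: "admissible t d"
  shows "inj_on t {..<d}" "i < d \<Longrightarrow> t i \<noteq> t0"
proof -
  have ne: "t i \<noteq> t j" if "i < j" "j < d" for i j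
  proof -
    from t that(2) obtain f where "f \<in> Wn t j" "f $ t j \<noteq> 0" by (auto simp: admissible_def)
    then show ?thesis using that(1) by (auto simp: Wn_def)
  qed
  show "inj_on t {..<d}" by (rule inj_onI) (metis ne lessThan_iff linorder_neqE_nat)
  show "t i \<noteq> t0" if i: "i < d"
  proof -
    from t i obtain f where "f \<in> Wn t i" "f $ t i \<noteq> 0" by (auto simp: admissible_def)
    then show ?thesis by (auto simp: Wn_def anchored_kernel_def)
  qed
qed

text \<open>Given a relation with \<open>c i \<noteq> 0\<close>, a derivation moves vertex
  \<open>t i\<close> alone in an arbitrary direction \<open>e\<close>. The differentiated relation
  places \<open>e\<close> in the span of the other \<open>d - 1\<close> positions, which is too
  small.\<close>

lemma anchored_p_independent:
  assumes t: "admissible t d" and c: "(\<Sum>i<d. c i *\<^sub>R col anchored_p (t i)) = 0"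
  shows "\<forall>i<d. c i = (0::real)"
proof (rule ccontr)
  assume "\<not> ?thesis"
  then obtain i where i: "i < d" "c i \<noteq> 0" by blast
  let ?S = "(\<lambda>l. col anchored_p (t l)) ` ({..<d} - {i})"
  have split: "(\<Sum>l<d. f l) = f i + (\<Sum>l\<in>{..<d} - {i}. f l)" for f :: "nat \<Rightarrow> real ^ 'n"
    using i by (simp add: sum.remove)
  have rest: "(\<Sum>l\<in>{..<d} - {i}. g l *\<^sub>R col anchored_p (t l)) \<in> span ?S" for g
    by (intro span_sum span_scale span_base) auto
  have "c i *\<^sub>R col anchored_p (t i) = - (\<Sum>l\<in>{..<d} - {i}. c l *\<^sub>R col anchored_p (t l))"
    using c split[of "\<lambda>l. c l *\<^sub>R col anchored_p (t l)"] by (simp add: eq_neg_iff_add_eq_0)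
  then have "c i *\<^sub>R col anchored_p (t i) \<in> span ?S" using rest[of c] by (simp add: span_neg)
  then have "(1 / c i) *\<^sub>R (c i *\<^sub>R col anchored_p (t i)) \<in> span ?S" by (rule span_scale)
  then have ci: "col anchored_p (t i) \<in> span ?S" using i by simp
  have all: "e \<in> span ?S" for e :: "real ^ 'n"
  proof -
    let ?u = "\<chi> j s. if s = t i then e $ j else 0"
    obtain Dm \<delta> where d: "deriv_on Dm \<delta>" "c ` {..<d} \<subseteq> Dm" "entries p \<subseteq> Dm" "map_entries \<delta> p = ?u"
      by (rule generic_conf_deriv[OF generic_conf, of "c ` {..<d}" ?u]) auto
    note Dm = deriv_onD(1)[OF d(1)]
    have dp: "\<delta> (p $ j $ s) = (if s = t i then e $ j else 0)" for j s
      using d(4) by (simp add: vec_eq_iff)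
    have phD: "anchored_p $ j $ s \<in> Dm" for j s
      using d(3) by (auto simp: anchored_p_def entsD subfldD(7)[OF Dm])
    have dph: "\<delta> (anchored_p $ j $ t l) = (if l = i then e $ j else 0)" if "l < d" for j l
      using admissible_inj[OF t] that i(1) d(3) by (auto simp: anchored_p_def deriv_onD(5)[OF d(1)] entsD dp inj_on_def)
    have "c i * e $ j + (\<Sum>l<d. \<delta> (c l) * anchored_p $ j $ t l) = 0" for j
    proof -
      have "(\<Sum>l<d. c l * anchored_p $ j $ t l) = 0" using c by (simp add: vec_eq_iff)
      then have "0 = \<delta> (\<Sum>l<d. c l * anchored_p $ j $ t l)" using deriv_onD(2)[OF d(1)] by simp
      also have "\<dots> = (\<Sum>l<d. \<delta> (c l * anchored_p $ j $ t l))"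
        using d(2) phD by (intro deriv_on_sum[OF d(1)] subfldD(4)[OF Dm]) auto
      also have "\<dots> = (\<Sum>l<d. (if l = i then c i * e $ j else 0) + \<delta> (c l) * anchored_p $ j $ t l)"
        using d(2) phD dph by (intro sum.cong) (auto simp: deriv_onD(6)[OF d(1)] mult.commute)
      also have "\<dots> = c i * e $ j + (\<Sum>l<d. \<delta> (c l) * anchored_p $ j $ t l)" using i by (simp add: sum.distrib)
      finally show ?thesis by simp
    qed
    then have "c i *\<^sub>R e = - (\<Sum>l<d. \<delta> (c l) *\<^sub>R col anchored_p (t l))" by (simp add: vec_eq_iff eq_neg_iff_add_eq_0)
    moreover have "(\<Sum>l<d. \<delta> (c l) *\<^sub>R col anchored_p (t l)) \<in> span ?S"
      unfolding split using rest[of "\<lambda>l. \<delta> (c l)"] ci by (simp add: span_add span_scale)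
    ultimately have "c i *\<^sub>R e \<in> span ?S" by (simp add: span_neg)
    then have "(1 / c i) *\<^sub>R (c i *\<^sub>R e) \<in> span ?S" by (rule span_scale)
    then show ?thesis using i by simp
  qed
  have "dim (UNIV :: (real ^ 'n) set) \<le> card ?S" using all by (intro dim_le_card) auto
  moreover have "card ?S \<le> card ({..<d} - {i})" by (intro card_image_le) auto
  ultimately show False using i(1) d_eq by simp
qed

text \<open>The anchored \<open>p\<close>, rotated into the slice, is infinitesimally rigid and has
  nonzero diagonal.\<close>

lemma good_point:
  assumes t: "admissible t d"
  shows "\<exists>y\<in>A t. \<forall>u\<in>A t. edge_form E y u = 0 \<longrightarrow> u = 0"
proof -
  obtain P where P: "orthogonal_matrix P" "rot P anchored_p \<in> A t" "\<And>j. rot P anchored_p $ j $ t (rk j) \<noteq> 0"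
    using pin_independent[OF anchored_p_anchored_configs anchored_p_independent[OF t]] by blast
  then show ?thesis using pinned_inj[OF P(2,3) inf_rigid_rot[OF P(1) inf_rigid_anchored_p]] by blast
qed

lemma linear_image_inj_dim:
  fixes f :: "'a::euclidean_space \<Rightarrow> 'b::euclidean_space"
  assumes "linear f" "subspace S" "\<And>x. x \<in> S \<Longrightarrow> f x = 0 \<Longrightarrow> x = 0"
  shows "dim (f ` S) = dim S"
proof -
  have "inj_on f (span S)"
    using assms by (simp add: linear_inj_on_span_iff_independent_image linear_inj_on_iff_eq_0 span_eq_iff[THEN iffD2])
  then show ?thesis using assms(1) by (intro dim_image_eq) auto
qed

lemma D_le: "D \<le> dim L"
proof -
  obtain t where t: "admissible t d" using admissible_exists by blast
  obtain y where y: "y \<in> A t" "\<forall>u\<in>A t. edge_form E y u = 0 \<longrightarrow> u = 0" using good_point[OF t] by blast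
  have "edge_form E y ` A t \<subseteq> L" using edge_form_in_L A_anchored_configs y(1) by blast
  moreover have "dim (edge_form E y ` A t) = D"
    using linear_image_inj_dim[OF linear_edge_form subspace_A, of t E y] y(2) dim_A[OF t] by simp
  ultimately show ?thesis by (metis dim_subset)
qed

text \<open>A countable field of definition for \<open>w\<close>, for \<open>L\<close> and for all
  slices. Derivations that vanish on it respect these spaces, and values are generic relative to
  it.\<close>

definition F0 :: "real set" where
  "F0 = fld (entries w \<union> (\<Union>b\<in>some_basis L. entries b) \<union> (\<Union>S\<in>range A. \<Union>b\<in>some_basis S. entries b))"

lemma finite_range_A: "finite (range A)"
proof -
  have "range A \<subseteq> (\<lambda>l. A (\<lambda>i. l ! i)) ` {l. set l \<subseteq> UNIV \<and> length l = d}"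
  proof
    fix S assume "S \<in> range A"
    then obtain t where t: "S = A t" by blast
    have "A t = A (\<lambda>i. map t [0..<d] ! i)"
      unfolding A_def Wn_def using rk_less by (auto simp: order.strict_trans)
    then show "S \<in> (\<lambda>l. A (\<lambda>i. l ! i)) ` {l. set l \<subseteq> UNIV \<and> length l = d}"
      using t by (intro image_eqI[of _ _ "map t [0..<d]"]) auto
  qed
  then show ?thesis by (rule finite_subset) (intro finite_imageI finite_lists_length_eq, simp)
qed

lemma countable_F0: "countable F0"
  unfolding F0_def by (intro countable_fld countable_finite finite_UnI finite_UN_I some_basis finite_entries finite_range_A)

lemma subfld_F0: "subfld F0" by (simp add: F0_def)

lemma F0_w: "entries w \<subseteq> F0"
  unfolding F0_def by (rule order_trans[OF _ fld_superset]) blast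

lemma F0_L: "b \<in> some_basis L \<Longrightarrow> entries b \<subseteq> F0"
  unfolding F0_def by (rule order_trans[OF _ fld_superset]) blast

lemma F0_A: "b \<in> some_basis (A t) \<Longrightarrow> entries b \<subseteq> F0"
  unfolding F0_def by (rule order_trans[OF _ fld_superset]) blast

text \<open>The slice is cut out by linear equations with coefficients in \<open>F0\<close>, which
  \<delta> treats as constants.\<close>

lemma map_entries_A:
  assumes d: "deriv_on Dm \<delta>" "F0 \<subseteq> Dm" "\<And>y. y \<in> F0 \<Longrightarrow> \<delta> y = 0" and x: "x \<in> A t" "entries x \<subseteq> Dm"
  shows "map_entries \<delta> x \<in> A t"
  unfolding A_iff
proof (intro conjI allI impI)
  have xK: "x \<in> stress_configs E w" using x A_iff by blast
  show "map_entries \<delta> x \<in> stress_configs E w"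
    unfolding stress_configs_def
  proof (intro CollectI allI)
    fix y :: "real ^ 'v ^ 'n"
    obtain \<delta>' where d': "deriv_on (fld (Dm \<union> entries y)) \<delta>'" "\<And>z. z \<in> Dm \<Longrightarrow> \<delta>' z = \<delta> z"
      using deriv_extend[OF d(1) finite_entries[of y]] by metis
    let ?D = "fld (Dm \<union> entries y)"
    have sub: "Dm \<subseteq> ?D" "entries y \<subseteq> ?D" using fld_superset[of "Dm \<union> entries y"] by auto
    have "\<delta>' (w $ i $ j) = 0" for i j using entsD[OF F0_w, of i j] d(2,3) d'(2) by auto
    then have w0: "map_entries \<delta>' w = 0" by (simp add: vec_eq_iff)
    have x0: "map_entries \<delta>' x = map_entries \<delta> x" using x(2) d'(2) by (auto simp: vec_eq_iff entries_iff)
    have "map_entries \<delta>' w \<bullet> edge_form E x y + w \<bullet> edge_form E (map_entries \<delta>' x) y + w \<bullet> edge_form E x (map_entries \<delta>' y) = 0"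
      using x sub F0_w d(2) xK by (intro deriv_stress[OF d'(1)]) (auto simp: stress_configs_def)
    then show "w \<bullet> edge_form E (map_entries \<delta> x) y = 0" using xK by (simp add: w0 x0 stress_configs_def)
  qed
  show "map_entries \<delta> x $ j $ t0 = 0" "i < rk j \<Longrightarrow> map_entries \<delta> x $ j $ t i = 0" for i j
    using x(1) deriv_onD(2)[OF d(1)] by (auto simp: A_iff)
qed

text \<open>The quadratic equation \<open>eq\<close> is differentiated with constant vectors
  \<open>b\<close> and \<open>w0\<close>; halving undoes the factor from the square. Nothing is
  assumed about \<open>\<delta> s0\<close>, so it remains as an uncontrolled multiple of
  \<open>w0\<close>.\<close>

lemma deriv_value:
  assumes I: "I \<subseteq> some_basis L" and d: "deriv_on Dm \<delta>" and sub: "F0 \<subseteq> Dm" "c ` I \<subseteq> Dm" "entries a \<subseteq> Dm" "s0 \<in> Dm"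
    and 0: "\<And>y. y \<in> F0 \<Longrightarrow> \<delta> y = 0" and w0: "entries w0 \<subseteq> F0" and eq: "edge_form E a a = (\<Sum>b\<in>I. c b *\<^sub>R b) + s0 *\<^sub>R w0"
  shows "edge_form E a (map_entries \<delta> a) = (\<Sum>b\<in>I. (\<delta> (c b) / 2) *\<^sub>R b) + (\<delta> s0 / 2) *\<^sub>R w0"
proof -
  have cD: "c b \<in> Dm" and bD: "entries b \<subseteq> Dm" and b0: "x \<in> entries b \<Longrightarrow> \<delta> x = 0" if "b \<in> I" for b x
    using that sub F0_L[of b] I 0 by blast+
  have c1: "map_entries \<delta> (\<Sum>b\<in>I. c b *\<^sub>R b) = (\<Sum>b\<in>I. \<delta> (c b) *\<^sub>R b)" "entries (\<Sum>b\<in>I. c b *\<^sub>R b) \<subseteq> Dm"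
    using map_entries_combination[OF d, of I c "\<lambda>b. b", OF cD bD b0] by auto
  have "entries w0 \<subseteq> Dm" "\<And>x. x \<in> entries w0 \<Longrightarrow> \<delta> x = 0" using w0 sub 0 by blast+
  then have c2: "map_entries \<delta> (s0 *\<^sub>R w0) = \<delta> s0 *\<^sub>R w0" "entries (s0 *\<^sub>R w0) \<subseteq> Dm"
    using map_entries_combination[OF d, of "{()}" "\<lambda>_. s0" "\<lambda>_. w0", OF sub(4)] by auto
  have "map_entries \<delta> (x + y) = map_entries \<delta> x + map_entries \<delta> y" if "entries x \<subseteq> Dm" "entries y \<subseteq> Dm" for x y :: "real ^ 'v ^ 'v"
    using that deriv_onD(4)[OF d] by (simp add: vec_eq_iff entsD)
  from this[OF c1(2) c2(2)] have "map_entries \<delta> (edge_form E a a) = (\<Sum>b\<in>I. \<delta> (c b) *\<^sub>R b) + \<delta> s0 *\<^sub>R w0"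
    unfolding eq c1 c2 .
  moreover have "map_entries \<delta> (edge_form E a a) = 2 *\<^sub>R edge_form E a (map_entries \<delta> a)"
    using deriv_edge_form(1)[OF d sub(3) sub(3), of E] by (simp add: edge_form_commute[of E "map_entries \<delta> a"] scaleR_2)
  ultimately have "(1/2) *\<^sub>R (2 *\<^sub>R edge_form E a (map_entries \<delta> a)) = (1/2) *\<^sub>R ((\<Sum>b\<in>I. \<delta> (c b) *\<^sub>R b) + \<delta> s0 *\<^sub>R w0)" by simp
  then show ?thesis by (simp add: scaleR_add_right scaleR_sum_right)
qed

text \<open>An algebraic version of Sard's theorem: derivations act transitively on generic values, and
  the derivative of the measurement map intertwines derivations of source and target.\<close>
lemma generic_value_surj:
  assumes I: "I \<subseteq> some_basis L" and c: "deriv_free F0 c I" and a: "a \<in> A t" and w0: "entries w0 \<subseteq> F0"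
    and eq: "edge_form E a a = (\<Sum>b\<in>I. c b *\<^sub>R b) + s0 *\<^sub>R w0" and z: "z \<in> span I"
  shows "\<exists>y\<in>A t. \<exists>r. edge_form E a y = z + r *\<^sub>R w0 \<and> (\<forall>j. a $ j = 0 \<longrightarrow> y $ j = 0)"
proof -
  have fin: "finite I" using I some_basis(5) finite_subset by blast
  obtain v where v: "z = (\<Sum>b\<in>I. v b *\<^sub>R b)" using z by (auto simp: span_finite[OF fin])
  have "\<exists>\<delta>'. deriv_on (fld (F0 \<union> c ` I)) \<delta>' \<and> (\<forall>y\<in>F0. \<delta>' y = 0) \<and> (\<forall>b\<in>I. \<delta>' (c b) = 2 * v b)"
    using c[unfolded deriv_free_def, rule_format, OF deriv_on_zero[OF subfld_F0], of "\<lambda>b. 2 * v b"] by simp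
  then obtain d1 where d1: "deriv_on (fld (F0 \<union> c ` I)) d1" "\<And>y. y \<in> F0 \<Longrightarrow> d1 y = 0" "\<And>b. b \<in> I \<Longrightarrow> d1 (c b) = 2 * v b"
    by blast
  let ?D1 = "fld (F0 \<union> c ` I)"
  have "finite (entries a \<union> {s0})" by simp
  then obtain d2 where d2: "deriv_on (fld (?D1 \<union> (entries a \<union> {s0}))) d2" "\<And>y. y \<in> ?D1 \<Longrightarrow> d2 y = d1 y"
    using deriv_extend[OF d1(1)] by metis
  let ?D2 = "fld (?D1 \<union> (entries a \<union> {s0}))"
  have sub1: "F0 \<subseteq> ?D1" "c ` I \<subseteq> ?D1" using fld_superset[of "F0 \<union> c ` I"] by auto
  have sub2: "?D1 \<subseteq> ?D2" "entries a \<subseteq> ?D2" "s0 \<in> ?D2" using fld_superset[of "?D1 \<union> (entries a \<union> {s0})"] by auto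
  have FD: "F0 \<subseteq> ?D2" "c ` I \<subseteq> ?D2" using sub1 sub2(1) by (meson order_trans)+
  have 0: "d2 y = 0" if "y \<in> F0" for y using that d2(2) d1(2) sub1 by auto
  have yA: "map_entries d2 a \<in> A t" using map_entries_A[OF d2(1) FD(1) 0 a sub2(2)] .
  have dc: "d2 (c b) = 2 * v b" if "b \<in> I" for b using that d2(2) d1(3) sub1 by auto
  have "edge_form E a (map_entries d2 a) = (\<Sum>b\<in>I. (d2 (c b) / 2) *\<^sub>R b) + (d2 s0 / 2) *\<^sub>R w0"
    by (rule deriv_value[OF I d2(1) FD sub2(2,3) 0 w0 eq])
  then have "edge_form E a (map_entries d2 a) = z + (d2 s0 / 2) *\<^sub>R w0" using dc by (simp add: v cong: sum.cong)
  \<comment> \<open>A coordinate that is identically zero stays so under a derivation. Hence at a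
    degenerate configuration all preimages lie in the degenerate part of the slice.\<close>
  moreover have "map_entries d2 a $ j = 0" if "a $ j = 0" for j using that deriv_onD(2)[OF d2(1)] by (simp add: vec_eq_iff)
  ultimately show ?thesis using yA by blast
qed

lemma open_in_L:
  fixes S :: "(real ^ 'v ^ 'n) set"
  assumes S: "subspace S" "S \<subseteq> anchored_configs E w t0" and x: "x \<in> S" and sur: "\<And>z. z \<in> L \<Longrightarrow> \<exists>y\<in>S. edge_form E x y = z"
  obtains e where "e > 0" "\<And>z. z \<in> L \<Longrightarrow> dist z (edge_form E x x) < e \<Longrightarrow> \<exists>x'\<in>S. edge_form E x' x' = z"
proof (rule subspace_open_mapping[of S L x "\<lambda>x. edge_form E x x" "\<lambda>y. 2 *\<^sub>R edge_form E x y"])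
  show "edge_form E x x \<in> L" if "x \<in> S" for x using edge_form_in_L that S by blast
  show "\<exists>y\<in>S. 2 *\<^sub>R edge_form E x y = z" if "z \<in> L" for z
  proof -
    from sur[OF that] obtain y where "y \<in> S" "edge_form E x y = z" by blast
    then show ?thesis using S(1) by (intro bexI[of _ "(1/2) *\<^sub>R y"]) (auto simp: edge_form_scaleR subspace_scale)
  qed
qed (use S x that in \<open>auto simp: subspace_L continuous_edge_form has_derivative_edge_form\<close>)

lemma generic_near:
  assumes z: "z \<in> L" and e: "e > 0"
  shows "\<exists>c. deriv_free F0 c (some_basis L) \<and> dist (\<Sum>b\<in>some_basis L. c b *\<^sub>R b) z < e"
proof -
  have "z \<in> span (some_basis L)" using z some_basis(3) by blast
  then obtain v where v: "z = (\<Sum>b\<in>some_basis L. v b *\<^sub>R b)" by (auto simp: span_finite[OF some_basis(5)])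
  define N where "N = 1 + (\<Sum>b\<in>some_basis L. norm b)"
  have N: "N > 0" unfolding N_def by (intro add_pos_nonneg sum_nonneg) auto
  obtain c where c: "deriv_free F0 c (some_basis L)" "\<And>b. b \<in> some_basis L \<Longrightarrow> v b - e / N < c b \<and> c b < v b + e / N"
    using exists_deriv_free[OF some_basis(5)[of L] countable_F0 subfld_F0, of "\<lambda>b. v b - e / N" "\<lambda>b. v b + e / N"] e N by auto
  have "norm ((\<Sum>b\<in>some_basis L. c b *\<^sub>R b) - z) = norm (\<Sum>b\<in>some_basis L. (c b - v b) *\<^sub>R b)"
    by (simp add: v sum_subtractf scaleR_diff_left)
  also have "\<dots> \<le> (\<Sum>b\<in>some_basis L. norm ((c b - v b) *\<^sub>R b))" by (rule norm_sum)
  also have "\<dots> \<le> (\<Sum>b\<in>some_basis L. (e / N) * norm b)"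
  proof (rule sum_mono)
    fix b assume "b \<in> some_basis L"
    then have "\<bar>c b - v b\<bar> \<le> e / N" using c(2)[of b] by linarith
    then show "norm ((c b - v b) *\<^sub>R b) \<le> (e / N) * norm b" using mult_right_mono[of "\<bar>c b - v b\<bar>" "e / N" "norm b"] by simp
  qed
  also have "\<dots> = (e / N) * (N - 1)" by (simp add: N_def sum_distrib_left)
  also have "\<dots> < e" using e N by (simp add: field_simps)
  finally show ?thesis using c(1) by (auto simp: dist_norm)
qed

lemma generic_near_image:
  obtains c and x :: "real ^ 'v ^ 'n" where "deriv_free F0 c (some_basis L)" "x \<in> anchored_configs E w t0" "edge_form E x x = (\<Sum>b\<in>some_basis L. c b *\<^sub>R b)"
proof -
  obtain e where e: "e > 0" "\<And>z. z \<in> L \<Longrightarrow> dist z (edge_form E anchored_p anchored_p) < e \<Longrightarrow> \<exists>x'\<in>(anchored_configs E w t0 :: (real ^ 'v ^ 'n) set). edge_form E x' x' = z"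
    using open_in_L[OF subspace_anchored_configs subset_refl anchored_p_anchored_configs L_surj] by blast
  obtain c where c: "deriv_free F0 c (some_basis L)" "dist (\<Sum>b\<in>some_basis L. c b *\<^sub>R b) (edge_form E anchored_p anchored_p) < e"
    using generic_near[OF edge_form_in_L[OF anchored_p_anchored_configs anchored_p_anchored_configs] e(1)] by blast
  have "(\<Sum>b\<in>some_basis L. c b *\<^sub>R b) \<in> L" using some_basis(1) by (intro subspace_sum subspace_scale subspace_L) auto
  from e(2)[OF this c(2)] show ?thesis using that[OF c(1)] by blast
qed

text \<open>A generic value is attained near the value of \<open>anchored_p\<close>. Its preimage
  rotates into a slice, and there the derivative maps the slice onto \<open>L\<close>, which bounds
  the dimension of \<open>L\<close> by \<open>D\<close>; \<open>D_le\<close> is the other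
  half.\<close>

lemma dim_L: "dim L = D"
proof -
  obtain c and x :: "real ^ 'v ^ 'n" where c: "deriv_free F0 c (some_basis L)" "x \<in> anchored_configs E w t0" "edge_form E x x = (\<Sum>b\<in>some_basis L. c b *\<^sub>R b)"
    using generic_near_image by blast
  obtain t P where t: "admissible t d" "orthogonal_matrix P" "rot P x \<in> A t" using pin[OF c(2)] by blast
  have eq: "edge_form E (rot P x) (rot P x) = (\<Sum>b\<in>some_basis L. c b *\<^sub>R b) + 0 *\<^sub>R 0" using edge_form_rot[OF t(2), of E x x] c(3) by simp
  have "entries (0 :: real ^ 'v ^ 'v) \<subseteq> F0" using subfldD(2)[OF subfld_F0] by (simp add: entries_iff)
  from generic_value_surj[OF subset_refl c(1) t(3) this eq]
  have "L \<subseteq> edge_form E (rot P x) ` A t" using some_basis(3)[of L] by force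
  then have "dim L \<le> dim (A t)" using dim_image_le[OF linear_edge_form] dim_subset le_trans by blast
  then show ?thesis using D_le dim_A[OF t(1)] by simp
qed

end

section \<open>Regular points\<close>

lemma linear_surj_subspace_inj:
  fixes f :: "'a::euclidean_space \<Rightarrow> 'b::euclidean_space"
  assumes f: "linear f" and A: "subspace A" and dim: "dim A = dim L" and sur: "\<And>z. z \<in> L \<Longrightarrow> \<exists>y\<in>A. f y = z"
    and y: "y \<in> A" "f y = 0"
  shows "y = 0"
proof (rule ccontr)
  assume nz: "y \<noteq> 0"
  define B where "B = {x \<in> A. x \<bullet> y = 0}"
  have lin: "linear (\<lambda>x. x \<bullet> y)" by (rule linearI) (auto simp: inner_add_left)
  have dB: "dim A = Suc (dim B)"
    unfolding B_def using dim_kernel_functional[OF A lin y(1)] nz by simp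
  have "L \<subseteq> f ` B"
  proof
    fix z assume "z \<in> L"
    then obtain x where x: "x \<in> A" "f x = z" using sur by blast
    let ?x = "x - ((x \<bullet> y) / (y \<bullet> y)) *\<^sub>R y"
    have "?x \<in> B" using x y A nz by (simp add: B_def subspace_diff subspace_scale inner_diff_left)
    moreover have "f ?x = z" using x y by (simp add: linear_diff[OF f] linear_cmul[OF f])
    ultimately show "z \<in> f ` B" by blast
  qed
  then have "dim L \<le> dim B" using dim_image_le[OF f] dim_subset le_trans by blast
  then show False using dB dim by simp
qed

lemma subspace_inverse_function:
  fixes f :: "'a::euclidean_space \<Rightarrow> 'b::euclidean_space"
  assumes A: "subspace A" and L: "subspace L" and dim: "dim A = dim L" and a: "a \<in> A"
    and fL: "\<And>x. x \<in> A \<Longrightarrow> f x \<in> L" and der: "\<And>x. (f has_derivative f' x) (at x)"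
    and cont: "\<And>y. continuous_on UNIV (\<lambda>x. f' x y)" and sur: "\<And>z. z \<in> L \<Longrightarrow> \<exists>y\<in>A. f' a y = z"
  obtains g e where "e > 0" "\<And>z. z \<in> L \<Longrightarrow> dist z (f a) < e \<Longrightarrow> g z \<in> A \<and> f (g z) = z"
    "continuous_on {z \<in> L. dist z (f a) < e} g" "g (f a) = a"
proof -
  obtain \<pi> where \<pi>: "linear \<pi>" "\<And>x. \<pi> x \<in> A" "\<And>x. x \<in> A \<Longrightarrow> \<pi> x = x" "\<And>x y. y \<in> A \<Longrightarrow> (x - \<pi> x) \<bullet> y = 0"
    using subspace_projection[OF A] by metis
  obtain J where J: "linear J" "J ` L = A" "inj_on J L" using subspace_isomorphism[OF L A] dim by auto
  have bl: "bounded_linear \<pi>" "bounded_linear J" using \<pi> J by (simp_all add: linear_conv_bounded_linear)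
  have perp: "x - \<pi> x = 0" if "x - \<pi> x \<in> A" for x using \<pi>(4)[OF that, of x] by simp
  \<comment> \<open>\<open>J\<close> identifies \<open>L\<close> with \<open>A\<close>, and the
    directions orthogonal to \<open>A\<close> are carried along unchanged, giving a map of the whole
    space to itself. A point whose image under \<open>F\<close> lies in \<open>A\<close> lies in
    \<open>A\<close>.\<close>
  define F where "F x = J (f (\<pi> x)) + (x - \<pi> x)" for x
  define F' where "F' x y = J (f' (\<pi> x) (\<pi> y)) + (y - \<pi> y)" for x y
  have derF: "(F has_derivative F' x) (at x)" for x
  proof -
    have 1: "(\<pi> has_derivative \<pi>) (at x)" by (rule bounded_linear_imp_has_derivative[OF bl(1)])
    have "((\<lambda>x. J (f (\<pi> x))) has_derivative (\<lambda>y. J (f' (\<pi> x) (\<pi> y)))) (at x)"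
      by (intro bounded_linear.has_derivative[OF bl(2)] has_derivative_compose[OF 1 der])
    then show ?thesis unfolding F_def F'_def by (intro derivative_intros 1)
  qed
  have blF': "bounded_linear (F' x)" for x using has_derivative_bounded_linear[OF derF] .
  have derB: "(F has_derivative blinfun_apply (Blinfun (F' x))) (at x)" for x
    using derF[of x] by (simp add: bounded_linear_Blinfun_apply[OF blF'])
  have contB: "continuous_on UNIV (\<lambda>x. Blinfun (F' x))"
  proof (rule continuous_on_blinfun_componentwise)
    fix i :: 'a
    have "continuous_on UNIV (\<lambda>x. F' x i)"
      unfolding F'_def
      by (intro continuous_intros bounded_linear.continuous_on[OF bl(2)] continuous_on_compose2[OF cont]
          bounded_linear.continuous_on[OF bl(1)]) auto
    then show "continuous_on UNIV (\<lambda>x. blinfun_apply (Blinfun (F' x)) i)"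
      by (simp add: bounded_linear_Blinfun_apply[OF blF'])
  qed
  have linF': "linear (F' a)" using blF' by (simp add: linear_conv_bounded_linear)
  have "surj (F' a)"
    unfolding surj_def
  proof
    fix x
    obtain z where z: "z \<in> L" "J z = \<pi> x" using J(2) \<pi>(2)[of x] by force
    obtain y where y: "y \<in> A" "f' a y = z" using sur[OF z(1)] by blast
    have "\<pi> (y + (x - \<pi> x)) = y" using \<pi> y by (simp add: linear_add linear_diff)
    then have "F' a (y + (x - \<pi> x)) = x" using y z \<pi>(3)[OF a] by (simp add: F'_def)
    then show "\<exists>y. x = F' a y" by metis
  qed
  then obtain G where G: "linear G" "F' a \<circ> G = id" using linear_surjective_right_inverse[OF linF'] by blast
  then have "G \<circ> F' a = id" using linear_inverse_left[OF linF' G(1)] by simp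
  then have "Blinfun G o\<^sub>L Blinfun (F' a) = id_blinfun"
    using G(1) blF' by (intro blinfun_eqI) (simp add: bounded_linear_Blinfun_apply linear_conv_bounded_linear fun_eq_iff)
  then obtain U W g where U: "open U" "a \<in> U" "open W" "F a \<in> W" "homeomorphism U W F g"
    using inverse_function_theorem[OF open_UNIV derB contB UNIV_I] by metis
  have Fa: "F a = J (f a)" using \<pi>(3)[OF a] by (simp add: F_def)
  have "open (J -` W)" by (rule open_vimage[OF U(3) linear_continuous_on[OF bl(2)]])
  moreover have "f a \<in> J -` W" using U(4) Fa by simp
  ultimately obtain e where e: "e > 0" "\<And>z. dist z (f a) < e \<Longrightarrow> J z \<in> W"
    unfolding open_dist by blast
  show ?thesis
  proof (rule that[of e "\<lambda>z. g (J z)"])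
    show "e > 0" by fact
    show "g (J (f a)) = a" using U(2,5) Fa by (metis homeomorphism_apply1)
    show "continuous_on {z \<in> L. dist z (f a) < e} (\<lambda>z. g (J z))"
    proof (rule continuous_on_compose2[of W g])
      show "continuous_on W g" using U(5) by (simp add: homeomorphism_def)
      show "continuous_on {z \<in> L. dist z (f a) < e} J" by (rule linear_continuous_on[OF bl(2)])
    qed (use e(2) in blast)
    fix z assume z: "z \<in> L" "dist z (f a) < e"
    let ?x = "g (J z)"
    have Fx: "F ?x = J z" using U(5) e(2)[OF z(2)] by (metis homeomorphism_apply2)
    have "J z \<in> A" "J (f (\<pi> ?x)) \<in> A" using J(2) z(1) fL[OF \<pi>(2)] by blast+
    moreover have "?x - \<pi> ?x = J z - J (f (\<pi> ?x))" using Fx by (simp add: F_def algebra_simps)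
    ultimately have "?x - \<pi> ?x \<in> A" using A by (simp add: subspace_diff)
    then have x: "\<pi> ?x = ?x" using perp[of ?x] by simp
    then have "?x \<in> A" using \<pi>(2) by metis
    moreover have "J (f ?x) = J z" using Fx x by (simp add: F_def)
    then have "f ?x = z" using J(3) fL[OF \<open>?x \<in> A\<close>] z(1) by (auto dest: inj_onD)
    ultimately show "?x \<in> A \<and> f ?x = z" by blast
  qed
qed

lemma generic_conf_distinct:
  fixes p :: "real ^ 'v::finite ^ 'n::finite"
  assumes "generic_conf p" "t \<noteq> s"
  shows "p $ l $ t \<noteq> p $ l $ s"
proof
  assume eq: "p $ l $ t = p $ l $ s"
  obtain D \<delta> where "map_entries \<delta> p = (\<chi> j r. if r = t then (1::real) else 0)"
    by (rule generic_conf_deriv[OF assms(1), of "{}" "\<chi> j r. if r = t then 1 else 0"]) auto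
  then have "\<delta> (p $ j $ r) = (if r = t then 1 else 0)" for j r by (simp add: vec_eq_iff)
  from this[of l t] this[of l s] show False using eq assms(2) by simp
qed

section \<open>Properness and regular points\<close>

context pinning
begin

text \<open>Vanishing real squared lengths make each coordinate equal at the ends of every edge.
  Placed alone in direction \<open>j\<close>, such a function is a flex of \<open>p\<close>;
  infinitesimal rigidity and the distinct values of \<open>p $ j\<close> make it constant, hence
  zero by anchoring.\<close>

lemma edge_form_zero_imp_zero:
  assumes x: "x \<in> anchored_configs E w t0" and z: "edge_form E x x = 0"
  shows "x = (0 :: real ^ 'v ^ 'n)"
proof -
  have edge: "x $ j $ t = x $ j $ u" if "{t, u} \<in> E" for j t u
  proof -
    have "pair_form x x t u = edge_form E x x $ t $ u" using that by (simp add: edge_form_def)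
    then have "(\<Sum>j\<in>UNIV. (x $ j $ t - x $ j $ u)\<^sup>2) = 0" using z by (simp add: pair_form_def power2_eq_square)
    then have "(x $ j $ t - x $ j $ u)\<^sup>2 = 0" by (simp add: sum_nonneg_eq_0_iff)
    then show ?thesis by simp
  qed
  have "x $ j $ s = 0" for j s
  proof (cases "s = t0")
    case True
    then show ?thesis using x by (simp add: anchored_configs_def anchored_kernel_def)
  next
    case False
    let ?y = "\<chi> i. if i = j then x $ j else 0 :: real ^ 'v ^ 'n"
    have pair_form: "pair_form p ?y t u = (p $ j $ t - p $ j $ u) * (x $ j $ t - x $ j $ u)" for t u
    proof -
      have "pair_form p ?y t u = (\<Sum>i\<in>UNIV. if i = j then (p $ j $ t - p $ j $ u) * (x $ j $ t - x $ j $ u) else 0)"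
        unfolding pair_form_def by (rule sum.cong) auto
      then show ?thesis by simp
    qed
    have "edge_form E p ?y = 0" using edge by (simp add: edge_form_def pair_form vec_eq_iff)
    then have "pair_form p ?y s t0 = 0" using inf_rigid by (simp add: inf_rigid_def)
    then have "x $ j $ s = x $ j $ t0" using generic_conf_distinct[OF generic_conf False, of j] pair_form[of s t0] by simp
    then show ?thesis using x by (simp add: anchored_configs_def anchored_kernel_def)
  qed
  then show ?thesis by (simp add: vec_eq_iff)
qed

text \<open>Properness: compactness of the unit sphere and homogeneity bound the squared norm of a
  configuration by a multiple of its measurement, so a convergent sequence of values has preimages
  in one compact ball.\<close>

lemma closed_image: "closed ((\<lambda>x. edge_form E x x) ` (anchored_configs E w t0 :: (real ^ 'v ^ 'n) set))"
proof -
  let ?\<phi> = "\<lambda>x :: real ^ 'v ^ 'n. edge_form E x x"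
  let ?V = "anchored_configs E w t0 :: (real ^ 'v ^ 'n) set"
  have clV: "closed ?V" by (rule closed_subspace[OF subspace_anchored_configs])
  obtain m where m: "m > 0" "\<And>x. x \<in> ?V \<Longrightarrow> m * (norm x)\<^sup>2 \<le> norm (?\<phi> x)"
  proof (cases "?V \<inter> sphere 0 1 = {}")
    case True
    have "x = 0" if "x \<in> ?V" for x
    proof (rule ccontr)
      assume "x \<noteq> 0"
      then have "(1 / norm x) *\<^sub>R x \<in> ?V \<inter> sphere 0 1" using that subspace_scale[OF subspace_anchored_configs] by auto
      then show False using True by blast
    qed
    then have "1 * (norm x)\<^sup>2 \<le> norm (?\<phi> x)" if "x \<in> ?V" for x using that by fastforce
    then show ?thesis using that[of 1] by simp
  next
    case False
    have comp: "compact (?V \<inter> sphere 0 1)" using clV by (simp add: closed_Int_compact)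
    have "continuous_on (?V \<inter> sphere 0 1) (\<lambda>x. norm (?\<phi> x))" by (intro continuous_on_norm continuous_edge_form)
    then obtain x0 where x0: "x0 \<in> ?V \<inter> sphere 0 1" "\<And>x. x \<in> ?V \<inter> sphere 0 1 \<Longrightarrow> norm (?\<phi> x0) \<le> norm (?\<phi> x)"
      using continuous_attains_inf[OF comp False] by blast
    have pos: "norm (?\<phi> x0) > 0" using x0(1) edge_form_zero_imp_zero[of x0] by auto
    have "norm (?\<phi> x0) * (norm x)\<^sup>2 \<le> norm (?\<phi> x)" if x: "x \<in> ?V" for x
    proof (cases "x = 0")
      case True then show ?thesis by simp
    next
      case False
      then have "(1 / norm x) *\<^sub>R x \<in> ?V \<inter> sphere 0 1" using x subspace_scale[OF subspace_anchored_configs] by auto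
      from x0(2)[OF this] have "norm (?\<phi> x0) \<le> norm (?\<phi> x) / (norm x)\<^sup>2"
        by (simp add: edge_form_scaleR power2_eq_square)
      then show ?thesis using False by (simp add: field_simps)
    qed
    then show ?thesis using pos that by blast
  qed
  show ?thesis
    unfolding closed_sequential_limits
  proof (intro allI impI)
    fix y l assume "(\<forall>n. y n \<in> ?\<phi> ` ?V) \<and> y \<longlonglongrightarrow> l"
    then have y: "\<And>n. y n \<in> ?\<phi> ` ?V" "y \<longlonglongrightarrow> l" by auto
    then obtain R where R: "\<And>n. norm (y n) \<le> R" using convergent_imp_bounded by (fastforce simp: bounded_iff)
    have "norm (y 0) \<le> R" by (rule R)
    then have R0: "R \<ge> 0" using norm_ge_zero order_trans by blast
    let ?C = "?V \<inter> cball 0 (sqrt (R / m))"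
    have yC: "y n \<in> ?\<phi> ` ?C" for n
    proof -
      obtain x where x: "x \<in> ?V" "y n = ?\<phi> x" using y(1) by blast
      have "m * (norm x)\<^sup>2 \<le> R" using m(2)[OF x(1)] R[of n] x(2) by simp
      then have "(norm x)\<^sup>2 \<le> R / m" using m(1) by (simp add: field_simps)
      then have "norm x \<le> sqrt (R / m)" by (rule real_le_rsqrt)
      then show ?thesis using x by auto
    qed
    have "compact ?C" using clV by (simp add: closed_Int_compact)
    then have "compact (?\<phi> ` ?C)" by (intro compact_continuous_image continuous_edge_form)
    then have "closed (?\<phi> ` ?C)" by (rule compact_imp_closed)
    then have "l \<in> ?\<phi> ` ?C" using yC y(2) by (meson closed_sequentially)
    then show "l \<in> ?\<phi> ` ?V" by blast
  qed
qed

lemma not_surj_kernel: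
  assumes t: "admissible t d" and a: "a \<in> A t" and ns: "\<not> (\<forall>z\<in>L. \<exists>y\<in>A t. edge_form E a y = z)"
  shows "\<exists>b\<in>A t. b \<noteq> 0 \<and> edge_form E a b = 0"
proof (rule ccontr)
  assume "\<not> ?thesis"
  then have inj: "\<And>y. y \<in> A t \<Longrightarrow> edge_form E a y = 0 \<Longrightarrow> y = 0" by blast
  have "dim (edge_form E a ` A t) = dim L"
    using linear_image_inj_dim[OF linear_edge_form subspace_A inj] dim_A[OF t] dim_L by simp
  moreover have "edge_form E a ` A t \<subseteq> L" using edge_form_in_L A_anchored_configs a by blast
  ultimately have "edge_form E a ` A t = L"
    using subspace_L subspace_A linear_edge_form by (intro subspace_dim_equal linear_subspace_image) auto
  then show False using ns by force
qed

text \<open>Injectivity at the good point comes with a lower bound \<open>m\<close>, and with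
  \<open>K\<close> bounding the bilinear form it survives any perturbation smaller than
  \<open>m / K\<close>.\<close>

lemma good_point_open:
  assumes t: "admissible t d"
  obtains y e where "y \<in> A t" "e > 0" "\<And>x u. dist x y < e \<Longrightarrow> u \<in> A t \<Longrightarrow> edge_form E x u = 0 \<Longrightarrow> u = 0"
proof -
  obtain y where y: "y \<in> A t" "\<forall>u\<in>A t. edge_form E y u = 0 \<longrightarrow> u = 0" using good_point[OF t] by blast
  obtain m where m: "m > 0" "\<forall>u\<in>A t. norm (edge_form E y u) \<ge> m * norm u"
    using injective_imp_isometric[OF closed_subspace[OF subspace_A] subspace_A, of "edge_form E y" t] y(2) linear_edge_form
    by (auto simp: linear_conv_bounded_linear)
  obtain K where K: "K > 0" "\<And>x u :: real ^ 'v ^ 'n. norm (edge_form E x u) \<le> norm x * norm u * K"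
    using bounded_bilinear.pos_bounded[OF bounded_bilinear_edge_form, of E] by blast
  have "u = 0" if x: "dist x y < m / K" and u: "u \<in> A t" "edge_form E x u = 0" for x u
  proof (rule ccontr)
    assume "u \<noteq> 0"
    have "edge_form E y u = edge_form E (y - x) u" using u(2) by (simp add: edge_form_linear)
    then have "m * norm u \<le> norm (y - x) * norm u * K" using m(2) u(1) K(2)[of "y - x" u] by force
    then have "m \<le> norm (y - x) * K" using \<open>u \<noteq> 0\<close> by (simp add: mult.assoc mult.commute[of "norm u"]) 
    then show False using x K(1) by (simp add: dist_norm norm_minus_commute field_simps)
  qed
  then show ?thesis using y(1) m(1) K(1) that[of y "m / K"] by simp
qed

text \<open>Points whose coordinates in the slice can be moved freely by derivations are algebraically generic,
  so a field embedding carries them close to a point where the measurement map is an immersion.\<close>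
lemma deriv_generic_regular:
  assumes t: "admissible t d" and x: "x \<in> A t"
    and der: "\<And>v. v \<in> A t \<Longrightarrow> \<exists>Dm \<delta>. deriv_on Dm \<delta> \<and> F0 \<subseteq> Dm \<and> entries x \<subseteq> Dm \<and> (\<forall>y\<in>F0. \<delta> y = 0) \<and> map_entries \<delta> x = v"
    and y: "y \<in> A t" "edge_form E x y = 0"
  shows "y = 0"
proof (rule ccontr)
  assume ynz: "y \<noteq> 0"
  let ?B = "some_basis (A t)"
  note finB = some_basis(5)[of "A t"]
  have spanB: "span ?B = A t" by (rule span_some_basis[OF subspace_A])
  have coord: "\<exists>v. z = (\<Sum>b\<in>?B. v b *\<^sub>R b)" if "z \<in> A t" for z
    using that spanB span_finite[OF finB] by auto
  obtain \<alpha> where \<alpha>: "x = (\<Sum>b\<in>?B. \<alpha> b *\<^sub>R b)" using coord[OF x] by blast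
  obtain \<eta> where \<eta>: "y = (\<Sum>b\<in>?B. \<eta> b *\<^sub>R b)" using coord[OF y(1)] by blast
  have "\<exists>b0\<in>?B. \<eta> b0 \<noteq> 0"
  proof (rule ccontr)
    assume "\<not> ?thesis"
    then have "y = 0" unfolding \<eta> by (intro sum.neutral) simp
    then show False using ynz by simp
  qed
  then obtain b0 where b0: "b0 \<in> ?B" "\<eta> b0 \<noteq> 0" by blast
  obtain y0 e where y0: "y0 \<in> A t" "e > 0" "\<And>x u. dist x y0 < e \<Longrightarrow> u \<in> A t \<Longrightarrow> edge_form E x u = 0 \<Longrightarrow> u = 0"
    using good_point_open[OF t] by blast
  obtain \<gamma> where \<gamma>: "y0 = (\<Sum>b\<in>?B. \<gamma> b *\<^sub>R b)" using coord[OF y0(1)] by blast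
  define N where "N = 1 + (\<Sum>b\<in>?B. norm b)"
  have N: "N > 0" unfolding N_def by (intro add_pos_nonneg sum_nonneg) auto
  have comb: "(\<Sum>b\<in>?B. v b *\<^sub>R b) \<in> A t" for v
    using some_basis(1)[of "A t"] by (intro subspace_sum subspace_scale subspace_A) auto
  have "\<exists>Dm \<delta>. deriv_on Dm \<delta> \<and> F0 \<union> \<alpha> ` ?B \<subseteq> Dm \<and> (\<forall>y\<in>F0. \<delta> y = 0) \<and> (\<forall>b\<in>?B. \<delta> (\<alpha> b) = v b)" for v
  proof -
    obtain Dm \<delta> where d: "deriv_on Dm \<delta>" "F0 \<subseteq> Dm" "entries x \<subseteq> Dm" "\<And>y. y \<in> F0 \<Longrightarrow> \<delta> y = 0" "map_entries \<delta> x = (\<Sum>b\<in>?B. v b *\<^sub>R b)"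
      using der[OF comb[of v]] by blast
    obtain \<delta>' where d': "deriv_on (fld (Dm \<union> \<alpha> ` ?B)) \<delta>'" "\<And>z. z \<in> Dm \<Longrightarrow> \<delta>' z = \<delta> z"
      using deriv_extend[OF d(1) finite_imageI[OF finB, of \<alpha>]] by metis
    let ?D = "fld (Dm \<union> \<alpha> ` ?B)"
    have sub: "Dm \<subseteq> ?D" "\<alpha> ` ?B \<subseteq> ?D" using fld_superset[of "Dm \<union> \<alpha> ` ?B"] by auto
    have z0: "\<delta>' z = 0" if "z \<in> F0" for z using that d(2,4) d'(2) by auto
    have cD: "\<alpha> b \<in> ?D" and bD: "entries b \<subseteq> ?D" and b0: "z \<in> entries b \<Longrightarrow> \<delta>' z = 0" if "b \<in> ?B" for b z
      using that sub d(2) F0_A[of b t] z0 by blast+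
    have "map_entries \<delta>' x = (\<Sum>b\<in>?B. \<delta>' (\<alpha> b) *\<^sub>R b)"
      unfolding \<alpha> using map_entries_combination(1)[OF d'(1), of ?B \<alpha> "\<lambda>b. b", OF cD bD b0] by simp
    moreover have "map_entries \<delta>' x = map_entries \<delta> x" using d'(2) entsD[OF d(3)] by (simp add: vec_eq_iff)
    ultimately have "(\<Sum>b\<in>?B. (\<delta>' (\<alpha> b) - v b) *\<^sub>R b) = 0"
      using d(5) by (simp add: scaleR_diff_left sum_subtractf)
    then have "\<delta>' (\<alpha> b) - v b = 0" if "b \<in> ?B" for b
      using independentD[OF some_basis(2) finB subset_refl, of "\<lambda>b. \<delta>' (\<alpha> b) - v b" b] that by simp
    then have "\<forall>b\<in>?B. \<delta>' (\<alpha> b) = v b" by simp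
    then show ?thesis using d'(1) sub d(2) z0 by (intro exI[of _ ?D] exI[of _ \<delta>']) blast
  qed
  then obtain h :: "real \<Rightarrow> complex" and \<beta> where h: "hom_on (fld (F0 \<union> \<alpha> ` ?B)) h" "\<forall>y\<in>F0. h y = of_real y"
    "\<forall>b\<in>?B. h (\<alpha> b) = of_real (\<beta> b) \<and> \<gamma> b - e / N < \<beta> b \<and> \<beta> b < \<gamma> b + e / N"
    using deriv_generic_hom[OF finB countable_F0 subfld_F0, of \<alpha> "\<lambda>b. \<gamma> b - e / N" "\<lambda>b. \<gamma> b + e / N"] y0(2) N
    by auto
  let ?T = "fld (F0 \<union> \<alpha> ` ?B)"
  \<comment> \<open>The specialization of \<open>x\<close> under \<open>h\<close>, which fixes
    \<open>F0\<close>. It is real and within \<open>e\<close> of the good point, so the derivative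
    is injective there.\<close>
  define x' where "x' = (\<Sum>b\<in>?B. \<beta> b *\<^sub>R b)"
  have "norm (x' - y0) = norm (\<Sum>b\<in>?B. (\<beta> b - \<gamma> b) *\<^sub>R b)"
    by (simp add: x'_def \<gamma> sum_subtractf scaleR_diff_left)
  also have "\<dots> \<le> (\<Sum>b\<in>?B. norm ((\<beta> b - \<gamma> b) *\<^sub>R b))" by (rule norm_sum)
  also have "\<dots> \<le> (\<Sum>b\<in>?B. (e / N) * norm b)"
  proof (rule sum_mono)
    fix b assume "b \<in> ?B"
    then have "\<bar>\<beta> b - \<gamma> b\<bar> \<le> e / N" using h(3) by fastforce
    then show "norm ((\<beta> b - \<gamma> b) *\<^sub>R b) \<le> (e / N) * norm b"
      using mult_right_mono[of "\<bar>\<beta> b - \<gamma> b\<bar>" "e / N" "norm b"] by simp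
  qed
  also have "\<dots> = (e / N) * (N - 1)" by (simp add: N_def sum_distrib_left)
  also have "\<dots> < e" using y0(2) N by (simp add: field_simps)
  finally have near: "dist x' y0 < e" by (simp add: dist_norm)
  have edge_form_sum: "edge_form E (\<Sum>b\<in>?B. v b *\<^sub>R b) z $ i $ j = (\<Sum>b\<in>?B. v b * edge_form E b z $ i $ j)" for v z i j
  proof -
    have "edge_form E (\<Sum>b\<in>?B. v b *\<^sub>R b) z = (\<Sum>b\<in>?B. v b *\<^sub>R edge_form E b z)"
      unfolding edge_form_commute[of E _ z] by (simp add: linear_sum[OF linear_edge_form] edge_form_scaleR)
    then show ?thesis by simp
  qed
  have TF: "F0 \<subseteq> ?T" "\<alpha> ` ?B \<subseteq> ?T" using fld_superset[of "F0 \<union> \<alpha> ` ?B"] by auto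
  have bb: "edge_form E b b' $ i $ j \<in> F0" if "b \<in> ?B" "b' \<in> ?B" for b b' i j
    using deriv_edge_form(2)[OF deriv_on_zero[OF subfld_F0] F0_A[OF that(1)] F0_A[OF that(2)]] by (rule entsD)
  \<comment> \<open>The matrix of \<open>edge_form E x\<close> in the basis of the slice. Its
    entries are combinations of the \<open>\<alpha> b\<close> over \<open>F0\<close>, so
    \<open>h\<close> carries it to the matrix at \<open>x'\<close>.\<close>
  define M where "M ij b = edge_form E x b $ fst ij $ snd ij" for ij :: "'v \<times> 'v" and b :: "real ^ 'v ^ 'n"
  have MT: "\<alpha> b' * edge_form E b' b $ i $ j \<in> ?T" if "b \<in> ?B" "b' \<in> ?B" for b b' i j
    using that bb[of b' b] TF by (intro subfldD(4)) auto
  have Min: "M ij b \<in> ?T" if "b \<in> ?B" for ij b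
    unfolding M_def \<alpha> edge_form_sum using MT[OF that] by (intro subfld_sum) auto
  have hM: "h (M ij b) = of_real (edge_form E x' b $ fst ij $ snd ij)" if b: "b \<in> ?B" for ij b
  proof -
    have "h (M ij b) = (\<Sum>b'\<in>?B. h (\<alpha> b' * edge_form E b' b $ fst ij $ snd ij))"
      unfolding M_def \<alpha> edge_form_sum using MT[OF b] by (intro hom_on_sum[OF h(1)]) auto
    also have "\<dots> = (\<Sum>b'\<in>?B. of_real (\<beta> b' * edge_form E b' b $ fst ij $ snd ij))"
    proof (rule sum.cong[OF refl])
      fix b' assume b': "b' \<in> ?B"
      then have "\<alpha> b' \<in> ?T" "edge_form E b' b $ fst ij $ snd ij \<in> ?T" using TF bb[OF b' b] by auto
      then show "h (\<alpha> b' * edge_form E b' b $ fst ij $ snd ij) = of_real (\<beta> b' * edge_form E b' b $ fst ij $ snd ij)"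
        using hom_onD(5)[OF h(1)] h(2,3) bb[OF b' b] b' by simp
    qed
    finally show ?thesis unfolding x'_def edge_form_sum by simp
  qed
  have zero: "(\<Sum>b\<in>?B. M ij b * \<eta> b) = 0" for ij
  proof -
    have "(\<Sum>b\<in>?B. M ij b * \<eta> b) = edge_form E y x $ fst ij $ snd ij"
      unfolding \<eta> edge_form_sum M_def by (simp add: edge_form_commute[of E x] mult.commute)
    then show ?thesis using y(2) by (simp add: edge_form_commute[of E y x])
  qed
  have "countable ?T" using countable_F0 finB by (intro countable_fld) (auto intro: countable_finite)
  then obtain g where g: "\<And>ij. (\<Sum>b\<in>?B. h (M ij b) * g b) = 0" "g b0 \<noteq> 0"
    using hom_singular_system[OF h(1) _ finB, of UNIV M \<eta> b0] Min zero b0 by auto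
  \<comment> \<open>The transported kernel vector is complex whereas \<open>x'\<close> is real; its
    real and imaginary parts are therefore kernel vectors at \<open>x'\<close>, and both must
    vanish.\<close>
  have part: "f (g b0) = 0" if f: "linear f" "\<And>r z. f (of_real r * z) = r * f z" for f :: "complex \<Rightarrow> real"
  proof -
    let ?u = "\<Sum>b\<in>?B. f (g b) *\<^sub>R b"
    have "edge_form E ?u x' $ i $ j = 0" for i j
    proof -
      have "(\<Sum>b\<in>?B. of_real (edge_form E x' b $ i $ j) * g b) = 0" using g(1)[of "(i, j)"] hM by (simp cong: sum.cong)
      then have "0 = f (\<Sum>b\<in>?B. of_real (edge_form E x' b $ i $ j) * g b)" using linear_0[OF f(1)] by simp
      also have "\<dots> = (\<Sum>b\<in>?B. f (g b) * edge_form E b x' $ i $ j)"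
        by (simp add: linear_sum[OF f(1)] f(2)) (simp add: edge_form_commute[of E x'] mult.commute)
      finally show ?thesis unfolding edge_form_sum by simp
    qed
    then have "edge_form E x' ?u = 0" by (simp add: vec_eq_iff edge_form_commute[of E x'])
    then have "?u = 0" by (rule y0(3)[OF near comb[of "\<lambda>b. f (g b)"]])
    then show ?thesis using independentD[OF some_basis(2) finB subset_refl, of "\<lambda>b. f (g b)" b0] b0 by simp
  qed
  have "Re (g b0) = 0" "Im (g b0) = 0" by (rule part; auto intro!: linearI)+
  then show False using g(2) by (simp add: complex_eq_iff)
qed

end

section \<open>Folds\<close>

text \<open>The level \<open>v\<close> lies strictly between the value at \<open>\<tau>0\<close> and
  the values at both ends. By the intermediate value theorem it is crossed on each side of
  \<open>\<tau>0\<close>, and this persists for nearby levels and offsets.\<close>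

lemma double_value:
  fixes F :: "'b::real_normed_vector \<Rightarrow> real"
  assumes L: "subspace L" and u0: "u0 \<in> L" and w0: "w0 \<in> L"
    and cont: "continuous_on {z \<in> L. dist z (u0 + \<tau>0 *\<^sub>R w0) < e} F"
    and \<tau>: "\<tau>1 < \<tau>0" "\<tau>0 < \<tau>2"
    and near: "dist (u0 + \<tau>1 *\<^sub>R w0) (u0 + \<tau>0 *\<^sub>R w0) < e" "dist (u0 + \<tau>2 *\<^sub>R w0) (u0 + \<tau>0 *\<^sub>R w0) < e"
    and less: "F (u0 + \<tau>1 *\<^sub>R w0) < F (u0 + \<tau>0 *\<^sub>R w0)" "F (u0 + \<tau>2 *\<^sub>R w0) < F (u0 + \<tau>0 *\<^sub>R w0)"
  obtains v \<eta> where "\<eta> > 0"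
    "\<forall>u\<in>L. \<forall>s. dist u u0 < \<eta> \<longrightarrow> \<bar>s - v\<bar> < \<eta> \<longrightarrow> (\<exists>\<tau> \<tau>'. \<tau> < \<tau>' \<and>
      dist (u + \<tau> *\<^sub>R w0) (u0 + \<tau>0 *\<^sub>R w0) < e \<and> dist (u + \<tau>' *\<^sub>R w0) (u0 + \<tau>0 *\<^sub>R w0) < e \<and>
      F (u + \<tau> *\<^sub>R w0) = s \<and> F (u + \<tau>' *\<^sub>R w0) = s)"
proof -
  let ?N = "{z \<in> L. dist z (u0 + \<tau>0 *\<^sub>R w0) < e}"
  define z where "z \<tau> = u0 + \<tau> *\<^sub>R w0" for \<tau>
  have inL: "u + \<tau> *\<^sub>R w0 \<in> L" if "u \<in> L" for u \<tau> using that w0 L by (simp add: subspace_add subspace_scale)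
  have e: "e > 0" using near(1) zero_le_dist[of "u0 + \<tau>1 *\<^sub>R w0" "u0 + \<tau>0 *\<^sub>R w0"] by linarith
  have zN: "z \<tau>0 \<in> ?N" "z \<tau>1 \<in> ?N" "z \<tau>2 \<in> ?N" using near e u0 by (auto simp: z_def inL)
  define M where "M = max (F (z \<tau>1)) (F (z \<tau>2))"
  \<comment> \<open>A quarter of the gap: \<open>v\<close> is \<open>2 * \<epsilon>\<close> away
    from the levels above and below, and perturbing the offset and the level costs less than
    \<epsilon> each.\<close>
  define \<epsilon> where "\<epsilon> = (F (z \<tau>0) - M) / 4"
  define v where "v = (F (z \<tau>0) + M) / 2"
  have \<epsilon>: "\<epsilon> > 0" using less by (simp add: \<epsilon>_def M_def z_def)
  have cz: "\<exists>\<delta>>0. \<forall>y\<in>?N. dist y x < \<delta> \<longrightarrow> \<bar>F y - F x\<bar> < \<epsilon>" if "x \<in> ?N" for x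
    using cont[unfolded continuous_on_iff] that \<epsilon> by (simp only: dist_real_def)
  obtain d0 where d0: "d0 > 0" "\<forall>y\<in>?N. dist y (z \<tau>0) < d0 \<longrightarrow> \<bar>F y - F (z \<tau>0)\<bar> < \<epsilon>" using cz[OF zN(1)] by blast
  obtain d1 where d1: "d1 > 0" "\<forall>y\<in>?N. dist y (z \<tau>1) < d1 \<longrightarrow> \<bar>F y - F (z \<tau>1)\<bar> < \<epsilon>" using cz[OF zN(2)] by blast
  obtain d2 where d2: "d2 > 0" "\<forall>y\<in>?N. dist y (z \<tau>2) < d2 \<longrightarrow> \<bar>F y - F (z \<tau>2)\<bar> < \<epsilon>" using cz[OF zN(3)] by blast
  define m where "m = max \<bar>\<tau>1 - \<tau>0\<bar> \<bar>\<tau>2 - \<tau>0\<bar> * norm w0"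
  have dist0: "dist (u + \<tau> *\<^sub>R w0) (u0 + \<tau>' *\<^sub>R w0) \<le> dist u u0 + \<bar>\<tau> - \<tau>'\<bar> * norm w0" for u \<tau> \<tau>'
  proof -
    have "(u + \<tau> *\<^sub>R w0) - (u0 + \<tau>' *\<^sub>R w0) = (u - u0) + (\<tau> - \<tau>') *\<^sub>R w0" by (simp add: algebra_simps)
    then show ?thesis unfolding dist_norm by (metis norm_scaleR norm_triangle_ineq)
  qed
  have m: "m < e"
  proof -
    have "dist (u0 + \<tau> *\<^sub>R w0) (u0 + \<tau>0 *\<^sub>R w0) = \<bar>\<tau> - \<tau>0\<bar> * norm w0" for \<tau>
      by (simp add: dist_norm flip: scaleR_diff_left)
    then show ?thesis using near by (simp add: m_def max_def)
  qed
  define \<eta> where "\<eta> = Min {d0, d1, d2, \<epsilon>, e - m}"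
  have \<eta>: "\<eta> > 0" "\<eta> \<le> d0" "\<eta> \<le> d1" "\<eta> \<le> d2" "\<eta> \<le> \<epsilon>" "\<eta> \<le> e - m"
    using d0(1) d1(1) d2(1) \<epsilon> m by (auto simp: \<eta>_def)
  show ?thesis
  proof (rule that[OF \<eta>(1), of v], intro ballI allI impI)
    fix u s assume u: "u \<in> L" "dist u u0 < \<eta>" and s: "\<bar>s - v\<bar> < \<eta>"
    have inN: "u + \<tau> *\<^sub>R w0 \<in> ?N" if "\<tau>1 \<le> \<tau>" "\<tau> \<le> \<tau>2" for \<tau>
    proof -
      have "\<bar>\<tau> - \<tau>0\<bar> \<le> max \<bar>\<tau>1 - \<tau>0\<bar> \<bar>\<tau>2 - \<tau>0\<bar>" using that by linarith
      then have "\<bar>\<tau> - \<tau>0\<bar> * norm w0 \<le> m" unfolding m_def by (rule mult_right_mono) simp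
      then show ?thesis using dist0[of u \<tau> \<tau>0] u \<eta>(6) inL by simp
    qed
    have du: "dist (u + \<tau> *\<^sub>R w0) (z \<tau>) < \<eta>" for \<tau> using dist0[of u \<tau> \<tau>] u by (simp add: z_def)
    have F0: "F (u + \<tau>0 *\<^sub>R w0) > s"
    proof -
      have "\<bar>F (u + \<tau>0 *\<^sub>R w0) - F (z \<tau>0)\<bar> < \<epsilon>" using d0(2) inN[of \<tau>0] du[of \<tau>0] \<eta>(2) \<tau> by force
      moreover have "F (z \<tau>0) = v + 2 * \<epsilon>" by (simp add: v_def \<epsilon>_def field_simps)
      ultimately show ?thesis using s \<eta>(5) by linarith
    qed
    have vM: "v = M + 2 * \<epsilon>" by (simp add: v_def \<epsilon>_def field_simps)
    have F1: "F (u + \<tau>1 *\<^sub>R w0) < s"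
    proof -
      have "\<bar>F (u + \<tau>1 *\<^sub>R w0) - F (z \<tau>1)\<bar> < \<epsilon>" using d1(2) inN[of \<tau>1] du[of \<tau>1] \<eta>(3) \<tau> by force
      moreover have "F (z \<tau>1) \<le> M" by (simp add: M_def)
      ultimately show ?thesis using s \<eta>(5) vM by linarith
    qed
    have F2: "F (u + \<tau>2 *\<^sub>R w0) < s"
    proof -
      have "\<bar>F (u + \<tau>2 *\<^sub>R w0) - F (z \<tau>2)\<bar> < \<epsilon>" using d2(2) inN[of \<tau>2] du[of \<tau>2] \<eta>(4) \<tau> by force
      moreover have "F (z \<tau>2) \<le> M" by (simp add: M_def)
      ultimately show ?thesis using s \<eta>(5) vM by linarith
    qed
    have c: "continuous_on {\<tau>1..\<tau>2} (\<lambda>\<tau>. F (u + \<tau> *\<^sub>R w0))"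
      by (rule continuous_on_compose2[OF cont]) (use inN in \<open>auto intro!: continuous_intros\<close>)
    obtain \<tau> where t1: "\<tau>1 \<le> \<tau>" "\<tau> \<le> \<tau>0" "F (u + \<tau> *\<^sub>R w0) = s"
      using IVT'[of "\<lambda>\<tau>. F (u + \<tau> *\<^sub>R w0)" \<tau>1 s \<tau>0] F0 F1 \<tau> continuous_on_subset[OF c] by force
    obtain \<tau>' where t2: "\<tau>0 \<le> \<tau>'" "\<tau>' \<le> \<tau>2" "F (u + \<tau>' *\<^sub>R w0) = s"
      using IVT2'[of "\<lambda>\<tau>. F (u + \<tau> *\<^sub>R w0)" \<tau>2 s \<tau>0] F0 F2 \<tau> continuous_on_subset[OF c] by force
    have "\<tau> \<noteq> \<tau>0" using t1 F0 by auto
    then have "\<tau> < \<tau>'" using t1 t2 by linarith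
    then show "\<exists>\<tau> \<tau>'. \<tau> < \<tau>' \<and>
      dist (u + \<tau> *\<^sub>R w0) (u0 + \<tau>0 *\<^sub>R w0) < e \<and> dist (u + \<tau>' *\<^sub>R w0) (u0 + \<tau>0 *\<^sub>R w0) < e \<and>
      F (u + \<tau> *\<^sub>R w0) = s \<and> F (u + \<tau>' *\<^sub>R w0) = s"
      using t1 t2 inN[of \<tau>] inN[of \<tau>'] \<tau> by auto
  qed
qed

text \<open>A fold may open upwards or downwards; the second case is the first one for
  \<open>- F\<close>.\<close>

lemma double_value_sym:
  fixes F :: "'b::real_normed_vector \<Rightarrow> real"
  assumes L: "subspace L" and u0: "u0 \<in> L" and w0: "w0 \<in> L"
    and cont: "continuous_on {z \<in> L. dist z (u0 + \<tau>0 *\<^sub>R w0) < e} F"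
    and \<tau>: "\<tau>1 < \<tau>0" "\<tau>0 < \<tau>2"
    and near: "dist (u0 + \<tau>1 *\<^sub>R w0) (u0 + \<tau>0 *\<^sub>R w0) < e" "dist (u0 + \<tau>2 *\<^sub>R w0) (u0 + \<tau>0 *\<^sub>R w0) < e"
    and same: "(F (u0 + \<tau>1 *\<^sub>R w0) - F (u0 + \<tau>0 *\<^sub>R w0)) * (F (u0 + \<tau>2 *\<^sub>R w0) - F (u0 + \<tau>0 *\<^sub>R w0)) > 0"
  obtains v \<eta> where "\<eta> > 0"
    "\<forall>u\<in>L. \<forall>s. dist u u0 < \<eta> \<longrightarrow> \<bar>s - v\<bar> < \<eta> \<longrightarrow> (\<exists>\<tau> \<tau>'. \<tau> < \<tau>' \<and>
      dist (u + \<tau> *\<^sub>R w0) (u0 + \<tau>0 *\<^sub>R w0) < e \<and> dist (u + \<tau>' *\<^sub>R w0) (u0 + \<tau>0 *\<^sub>R w0) < e \<and>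
      F (u + \<tau> *\<^sub>R w0) = s \<and> F (u + \<tau>' *\<^sub>R w0) = s)"
proof (cases "F (u0 + \<tau>1 *\<^sub>R w0) < F (u0 + \<tau>0 *\<^sub>R w0)")
  case True
  then have "F (u0 + \<tau>2 *\<^sub>R w0) < F (u0 + \<tau>0 *\<^sub>R w0)" using same by (simp add: zero_less_mult_iff)
  show ?thesis by (rule double_value[OF L u0 w0 cont \<tau> near True \<open>F (u0 + \<tau>2 *\<^sub>R w0) < F (u0 + \<tau>0 *\<^sub>R w0)\<close>]) (rule that, assumption+)
next
  case False
  then have "- F (u0 + \<tau>1 *\<^sub>R w0) < - F (u0 + \<tau>0 *\<^sub>R w0)" "- F (u0 + \<tau>2 *\<^sub>R w0) < - F (u0 + \<tau>0 *\<^sub>R w0)"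
    using same by (auto simp: zero_less_mult_iff)
  note less = this
  obtain v \<eta> where \<eta>: "\<eta> > 0" and H: "\<forall>u\<in>L. \<forall>s. dist u u0 < \<eta> \<longrightarrow> \<bar>s - v\<bar> < \<eta> \<longrightarrow> (\<exists>\<tau> \<tau>'. \<tau> < \<tau>' \<and>
      dist (u + \<tau> *\<^sub>R w0) (u0 + \<tau>0 *\<^sub>R w0) < e \<and> dist (u + \<tau>' *\<^sub>R w0) (u0 + \<tau>0 *\<^sub>R w0) < e \<and>
      - F (u + \<tau> *\<^sub>R w0) = s \<and> - F (u + \<tau>' *\<^sub>R w0) = s)"
    by (rule double_value[OF L u0 w0 continuous_on_minus[OF cont] \<tau> near less]) (rule that, assumption+)
  show ?thesis
  proof (rule that[OF \<eta>, of "- v"], intro ballI allI impI)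
    fix u s assume "u \<in> L" "dist u u0 < \<eta>" "\<bar>s - - v\<bar> < \<eta>"
    moreover from this have "\<bar>- s - v\<bar> < \<eta>" by linarith
    ultimately obtain \<tau> \<tau>' where "\<tau> < \<tau>'" "dist (u + \<tau> *\<^sub>R w0) (u0 + \<tau>0 *\<^sub>R w0) < e"
      "dist (u + \<tau>' *\<^sub>R w0) (u0 + \<tau>0 *\<^sub>R w0) < e" "- F (u + \<tau> *\<^sub>R w0) = - s" "- F (u + \<tau>' *\<^sub>R w0) = - s"
      using H[rule_format, of u "- s"] by blast
    then show "\<exists>\<tau> \<tau>'. \<tau> < \<tau>' \<and>
      dist (u + \<tau> *\<^sub>R w0) (u0 + \<tau>0 *\<^sub>R w0) < e \<and> dist (u + \<tau>' *\<^sub>R w0) (u0 + \<tau>0 *\<^sub>R w0) < e \<and>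
      F (u + \<tau> *\<^sub>R w0) = s \<and> F (u + \<tau>' *\<^sub>R w0) = s" by (intro exI[of _ \<tau>] exI[of _ \<tau>']) auto
  qed
qed

context pinning
begin

text \<open>At a submersive preimage all nearby values in \<open>L\<close> are attained, in
  particular those on the line, so \<open>s0\<close> would be interior.\<close>

lemma boundary_not_surj:
  assumes u0: "u0 \<in> L" and w0: "w0 \<in> L" and x: "x \<in> A t" and eq: "edge_form E x x = u0 + s0 *\<^sub>R w0"
    and s0: "s0 \<notin> interior {s. u0 + s *\<^sub>R w0 \<in> (\<lambda>x. edge_form E x x) ` (anchored_configs E w t0 :: (real ^ 'v ^ 'n) set)}"
  shows "\<not> (\<forall>z\<in>L. \<exists>y\<in>A t. edge_form E x y = z)"
proof
  assume sur: "\<forall>z\<in>L. \<exists>y\<in>A t. edge_form E x y = z"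
  obtain e where e: "e > 0" "\<And>z. z \<in> L \<Longrightarrow> dist z (edge_form E x x) < e \<Longrightarrow> \<exists>x'\<in>A t. edge_form E x' x' = z"
    using open_in_L[OF subspace_A A_anchored_configs x] sur by blast
  let ?r = "e / (norm w0 + 1)"
  have r: "?r > 0" using e(1) by (intro divide_pos_pos add_nonneg_pos) auto
  have "ball s0 ?r \<subseteq> {s. u0 + s *\<^sub>R w0 \<in> (\<lambda>x. edge_form E x x) ` (anchored_configs E w t0 :: (real ^ 'v ^ 'n) set)}"
  proof
    fix s assume "s \<in> ball s0 ?r"
    then have s: "\<bar>s - s0\<bar> < ?r" by (simp add: dist_real_def abs_minus_commute)
    have "dist (u0 + s *\<^sub>R w0) (edge_form E x x) = \<bar>s - s0\<bar> * norm w0" by (simp add: eq dist_norm flip: scaleR_diff_left)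
    also have "\<dots> \<le> \<bar>s - s0\<bar> * (norm w0 + 1)" by (intro mult_left_mono) auto
    also have "\<dots> < ?r * (norm w0 + 1)" by (rule mult_strict_right_mono[OF s]) (auto intro: add_nonneg_pos)
    also have "\<dots> = e" using add_nonneg_pos[of "norm w0" 1] by simp
    finally have "\<exists>x'\<in>A t. edge_form E x' x' = u0 + s *\<^sub>R w0"
      using u0 w0 subspace_L by (intro e(2)) (auto intro: subspace_add subspace_scale)
    then obtain x' where "x' \<in> A t" "u0 + s *\<^sub>R w0 = edge_form E x' x'" by metis
    then show "s \<in> {s. u0 + s *\<^sub>R w0 \<in> (\<lambda>x. edge_form E x x) ` (anchored_configs E w t0 :: (real ^ 'v ^ 'n) set)}"
      using A_anchored_configs[of t] by blast
  qed
  then show False using r s0 by (meson mem_interior)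
qed

lemma D_ge: "2 \<le> D"
proof -
  obtain t where "admissible t d" using admissible_exists by blast
  from dim_A_degenerate[OF this, of undefined] show ?thesis by linarith
qed

text \<open>A line in \<open>L\<close> with generic offset must leave the image of the measurement map; at a point where it
  does, the map has corank one and folds, so nearby values are attained twice.\<close>
lemma fold_point:
  obtains z0 e where "z0 \<in> anchored_configs E w t0" "e > 0"
    "\<And>z. z \<in> anchored_configs E w t0 \<Longrightarrow> dist z z0 < e \<Longrightarrow>
      \<exists>y :: real ^ 'v ^ 'n. edge_form E y y = edge_form E z z \<and> (\<exists>s r. pair_form y y s r \<noteq> pair_form (z :: real ^ 'v ^ 'n) z s r)"
proof -
  let ?V = "anchored_configs E w t0 :: (real ^ 'v ^ 'n) set"
  let ?\<phi> = "\<lambda>x :: real ^ 'v ^ 'n. edge_form E x x"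
  obtain c x1 where c: "deriv_free F0 c (some_basis L)" and x1: "x1 \<in> ?V" "?\<phi> x1 = (\<Sum>b\<in>some_basis L. c b *\<^sub>R b)"
    using generic_near_image by blast
  have "card (some_basis L) \<noteq> 0" using some_basis(4)[of L] dim_L D_ge by simp
  then obtain w0 where w0: "w0 \<in> some_basis L" by fastforce
  \<comment> \<open>The coordinates along \<open>I\<close> stay generic. The one along
    \<open>w0\<close> is given up, because it has to be moved to the boundary of the image;
    \<open>lam\<close> reads it off.\<close>
  define I where "I = some_basis L - {w0}"
  have I: "I \<subseteq> some_basis L" "finite I" "some_basis L = insert w0 I" "w0 \<notin> I" using w0 some_basis(5)[of L] by (auto simp: I_def)
  have cI: "deriv_free F0 c I" using deriv_free_subset[OF c I(1)] .
  have w0L: "w0 \<in> L" and w0F: "entries w0 \<subseteq> F0" using w0 some_basis(1)[of L] F0_L by blast+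
  have w0nz: "w0 \<noteq> 0" using w0 some_basis(2)[of L] dependent_zero by blast
  define u0 where "u0 = (\<Sum>b\<in>I. c b *\<^sub>R b)"
  have IL: "span I \<subseteq> L" using I(1) some_basis(1)[of L] subspace_L by (intro span_minimal) auto
  have u0I: "u0 \<in> span I" unfolding u0_def by (intro span_sum span_scale span_base)
  have u0L: "u0 \<in> L" using u0I IL by blast
  have "\<exists>lam :: real ^ 'v ^ 'v \<Rightarrow> real. linear lam \<and> (\<forall>b\<in>some_basis L. lam b = (if b = w0 then 1 else 0))"
    by (rule linear_independent_extend[OF some_basis(2)])
  then obtain lam :: "real ^ 'v ^ 'v \<Rightarrow> real" where lam: "linear lam" "lam w0 = 1" "\<And>b. b \<in> I \<Longrightarrow> lam b = 0"
    using I by (metis insertCI)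
  have lamI: "lam z = 0" if "z \<in> span I" for z using linear_eq_0_on_span[OF lam(1) lam(3) that] .
  have dec: "z - lam z *\<^sub>R w0 \<in> span I" if z: "z \<in> L" for z
  proof -
    have "z \<in> span (insert w0 I)" using z some_basis(3)[of L] I(3) by auto
    then obtain k where k: "z - k *\<^sub>R w0 \<in> span I" using span_breakdown_eq by blast
    have "lam z = k" using lamI[OF k] lam by (simp add: linear_diff linear_cmul)
    then show ?thesis using k by simp
  qed
  let ?S = "{s. u0 + s *\<^sub>R w0 \<in> ?\<phi> ` ?V}"
  have "c w0 \<in> ?S"
  proof -
    have "u0 + c w0 *\<^sub>R w0 = ?\<phi> x1" using x1(2) I(2-4) by (simp add: u0_def)
    then show ?thesis using x1(1) by auto
  qed
  moreover have "closed ?S"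
  proof -
    have "?S = (\<lambda>s. u0 + s *\<^sub>R w0) -` (?\<phi> ` ?V)" by auto
    then show ?thesis by (simp only:) (intro closed_vimage closed_image continuous_intros)
  qed
  moreover have "?S \<noteq> UNIV"
  proof
    assume U: "?S = UNIV"
    obtain i j where ij: "w0 $ i $ j \<noteq> 0" using w0nz by (auto simp: vec_eq_iff)
    \<comment> \<open>Makes the entry \<open>(i, j)\<close> equal to \<open>- 1\<close>, impossible
      for a real squared length.\<close>
    define s where "s = (- 1 - u0 $ i $ j) / w0 $ i $ j"
    have "s \<in> ?S" using U by blast
    then obtain x where x: "u0 + s *\<^sub>R w0 = ?\<phi> x" by blast
    have "?\<phi> x $ i $ j \<ge> 0" by (simp add: edge_form_def pair_form_def sum_nonneg)
    moreover have "(u0 + s *\<^sub>R w0) $ i $ j = - 1" using ij by (simp add: s_def)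
    ultimately show False using x by simp
  qed
  ultimately have "\<not> open ?S" using clopen[of ?S] by blast
  then obtain s0 where s0: "s0 \<in> ?S" "s0 \<notin> interior ?S" using interior_subset[of ?S] interior_eq[of ?S] by blast
  then obtain a0 where a0: "a0 \<in> ?V" "?\<phi> a0 = u0 + s0 *\<^sub>R w0" by auto
  obtain t P where t: "admissible t d" "orthogonal_matrix P" "rot P a0 \<in> A t"
    "(\<forall>j. rot P a0 $ j $ t (rk j) \<noteq> 0) \<or> (\<exists>j. rot P a0 $ j = 0)" using pin[OF a0(1)] by blast
  define a where "a = rot P a0"
  have aA: "a \<in> A t" using t by (simp add: a_def)
  have \<phi>a: "?\<phi> a = u0 + s0 *\<^sub>R w0" using edge_form_rot[OF t(2), of E a0 a0] a0(2) by (simp add: a_def)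
  have gvs: "\<exists>y\<in>A t. \<exists>r. edge_form E a y = z + r *\<^sub>R w0 \<and> (\<forall>j. a $ j = 0 \<longrightarrow> y $ j = 0)" if "z \<in> span I" for z
    using generic_value_surj[OF I(1) cI aA w0F _ that, of s0] \<phi>a by (simp add: u0_def)
  \<comment> \<open>With a vanishing coordinate the derivative on a space of dimension at most
    \<open>D - 2\<close>, together with \<open>w0\<close>, would have to span \<open>L\<close>,
    which has dimension \<open>D\<close>.\<close>
  have diag: "a $ j $ t (rk j) \<noteq> 0" for j
  proof -
    have "\<not> (\<exists>j. a $ j = 0)"
    proof
      assume "\<exists>j. a $ j = 0"
      then obtain j where j: "a $ j = 0" by blast
      let ?A = "{x \<in> A t. x $ j = 0}"
      have "L \<subseteq> span (insert w0 (edge_form E a ` ?A))"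
      proof
        fix z assume z: "z \<in> L"
        obtain y r where y: "y \<in> A t" "edge_form E a y = z - lam z *\<^sub>R w0 + r *\<^sub>R w0" "y $ j = 0" using gvs[OF dec[OF z]] j by blast
        have "z - (lam z - r) *\<^sub>R w0 = edge_form E a y" using y(2) by (simp add: scaleR_diff_left)
        then have "z - (lam z - r) *\<^sub>R w0 \<in> span (edge_form E a ` ?A)" using y by (metis (mono_tags, lifting) imageI mem_Collect_eq span_base)
        then show "z \<in> span (insert w0 (edge_form E a ` ?A))" using span_breakdown_eq by blast
      qed
      from dim_subset[OF this] have "dim L \<le> dim (insert w0 (edge_form E a ` ?A))" by simp
      also have "\<dots> \<le> dim (edge_form E a ` ?A) + 1" by (simp add: dim_insert)
      also have "\<dots> \<le> dim ?A + 1" using dim_image_le[OF linear_edge_form, of E a ?A] by simp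
      finally show False using dim_A_degenerate[OF t(1), of j] dim_L by simp
    qed
    then show ?thesis using t(4) by (auto simp: a_def)
  qed
  obtain bb where bb: "bb \<in> A t" "bb \<noteq> 0" "edge_form E a bb = 0"
    using not_surj_kernel[OF t(1) aA boundary_not_surj[OF u0L w0L aA \<phi>a s0(2)]] by blast
  obtain j1 s1 where js: "bb $ j1 $ s1 \<noteq> 0" using bb(2) by (auto simp: vec_eq_iff)
  \<comment> \<open>A coordinate that does not vanish on the kernel vector \<open>bb\<close>. In
    \<open>\<Psi>\<close> it takes the place of the lost \<open>w0\<close>-component of the
    measurement, making \<open>\<Psi>\<close> a local diffeomorphism between the slice and
    \<open>L\<close>.\<close>
  define \<kappa> where "\<kappa> x = x $ j1 $ s1" for x :: "real ^ 'v ^ 'n"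
  have lin\<kappa>: "linear \<kappa>" by (rule linearI) (auto simp: \<kappa>_def)
  define \<Psi> where "\<Psi> x = ?\<phi> x - lam (?\<phi> x) *\<^sub>R w0 + \<kappa> x *\<^sub>R w0" for x
  define \<Psi>' where "\<Psi>' x y = 2 *\<^sub>R edge_form E x y - lam (2 *\<^sub>R edge_form E x y) *\<^sub>R w0 + \<kappa> y *\<^sub>R w0" for x y
  have bl: "bounded_linear lam" "bounded_linear \<kappa>" using lam(1) lin\<kappa> by (simp_all add: linear_conv_bounded_linear)
  have der\<Psi>: "(\<Psi> has_derivative \<Psi>' x) (at x)" for x
    unfolding \<Psi>_def \<Psi>'_def
    by (intro has_derivative_add has_derivative_diff has_derivative_scaleR_left has_derivative_edge_form
        bounded_linear.has_derivative[OF bl(1)] bounded_linear_imp_has_derivative[OF bl(2)])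
  have cont\<Psi>': "continuous_on UNIV (\<lambda>x. \<Psi>' x y)" for y
  proof -
    have "linear (\<lambda>x. edge_form E x y)" using linear_edge_form[of E y] by (simp add: edge_form_commute[of E _ y])
    then have "continuous_on UNIV (\<lambda>x. edge_form E x y)" by (simp add: linear_continuous_on linear_conv_bounded_linear)
    then show ?thesis unfolding \<Psi>'_def
      by (intro continuous_intros bounded_linear.continuous_on[OF bl(1)])
  qed
  have \<phi>L: "?\<phi> x \<in> L" if "x \<in> A t" for x using edge_form_in_L that A_anchored_configs by blast
  have \<Psi>L: "\<Psi> x \<in> L" if "x \<in> A t" for x
    unfolding \<Psi>_def using \<phi>L[OF that] w0L subspace_L by (intro subspace_add subspace_diff subspace_scale)
  have sur\<Psi>: "\<exists>y\<in>A t. \<Psi>' a y = z" if z: "z \<in> L" for z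
  proof -
    obtain y r where y: "y \<in> A t" "edge_form E a y = (1/2) *\<^sub>R (z - lam z *\<^sub>R w0) + r *\<^sub>R w0"
      using gvs[OF span_scale[OF dec[OF z]]] by blast
    define k where "k = (lam z - \<kappa> y) / \<kappa> bb"
    have \<kappa>bb: "\<kappa> bb \<noteq> 0" using js by (simp add: \<kappa>_def)
    have "\<kappa> (y + k *\<^sub>R bb) = lam z" using \<kappa>bb by (simp add: linear_add[OF lin\<kappa>] linear_cmul[OF lin\<kappa>] k_def)
    moreover have "edge_form E a (y + k *\<^sub>R bb) = edge_form E a y" by (simp add: edge_form_linear edge_form_scaleR bb(3))
    moreover have e2: "2 *\<^sub>R edge_form E a y = (z - lam z *\<^sub>R w0) + (2 * r) *\<^sub>R w0" by (simp add: y(2) scaleR_add_right)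
    moreover have "lam (2 *\<^sub>R edge_form E a y) = 2 * r"
      unfolding e2 using lamI[OF dec[OF z]] lam(2) by (simp add: linear_add[OF lam(1)] linear_cmul[OF lam(1)])
    ultimately have "\<Psi>' a (y + k *\<^sub>R bb) = z" by (simp add: \<Psi>'_def)
    moreover have "y + k *\<^sub>R bb \<in> A t" using y(1) bb(1) subspace_A by (auto intro: subspace_add subspace_scale)
    ultimately show ?thesis by blast
  qed
  have dimAL: "dim (A t) = dim L" using dim_A[OF t(1)] dim_L by simp
  obtain G e where e: "e > 0" and G: "\<And>z. z \<in> L \<Longrightarrow> dist z (\<Psi> a) < e \<Longrightarrow> G z \<in> A t \<and> \<Psi> (G z) = z"
    and contG: "continuous_on {z \<in> L. dist z (\<Psi> a) < e} G" and Ga: "G (\<Psi> a) = a"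
    by (rule subspace_inverse_function[OF subspace_A subspace_L dimAL aA \<Psi>L der\<Psi> cont\<Psi>' sur\<Psi>]) blast+
  define \<tau>0 where "\<tau>0 = \<kappa> a"
  have lam\<phi>a: "lam (?\<phi> a) = s0" unfolding \<phi>a using lamI[OF u0I] lam(2) by (simp add: linear_add[OF lam(1)] linear_cmul[OF lam(1)])
  have \<Psi>a: "\<Psi> a = u0 + \<tau>0 *\<^sub>R w0" unfolding \<Psi>_def lam\<phi>a \<tau>0_def by (simp add: \<phi>a)
  \<comment> \<open>In the chart \<open>G\<close>, with coordinates \<open>u\<close> and \<tau>, the
    measurement keeps \<open>u\<close>, and all its variation with \<tau> is in the single
    \<open>w0\<close>-component.\<close>
  have Gprops: "G (u + \<tau> *\<^sub>R w0) \<in> A t" "\<kappa> (G (u + \<tau> *\<^sub>R w0)) = \<tau>"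
    "?\<phi> (G (u + \<tau> *\<^sub>R w0)) = u + lam (?\<phi> (G (u + \<tau> *\<^sub>R w0))) *\<^sub>R w0"
    if u: "u \<in> span I" and near: "dist (u + \<tau> *\<^sub>R w0) (u0 + \<tau>0 *\<^sub>R w0) < e" for u \<tau>
  proof -
    let ?z = "u + \<tau> *\<^sub>R w0"
    have "?z \<in> L" using u IL w0L subspace_L by (auto intro!: subspace_add subspace_scale)
    then have g: "G ?z \<in> A t" "\<Psi> (G ?z) = ?z" using G near \<Psi>a by auto
    show "G ?z \<in> A t" by (rule g)
    have "lam (\<Psi> (G ?z)) = \<tau>" unfolding g(2) using lamI[OF u] lam(2) by (simp add: linear_add[OF lam(1)] linear_cmul[OF lam(1)])
    moreover have "lam (\<Psi> (G ?z)) = \<kappa> (G ?z)"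
      unfolding \<Psi>_def using lam(2) by (simp add: linear_add[OF lam(1)] linear_diff[OF lam(1)] linear_cmul[OF lam(1)])
    ultimately show k: "\<kappa> (G ?z) = \<tau>" by simp
    show "?\<phi> (G ?z) = u + lam (?\<phi> (G ?z)) *\<^sub>R w0" using g(2) unfolding \<Psi>_def k by (simp add: algebra_simps)
  qed
  \<comment> \<open>Near \<open>a\<close> the diagonal entries keep their signs, so that any two
    slice points found there are subject to \<open>pinned_unique\<close>.\<close>
  have "open {x :: real ^ 'v ^ 'n. \<forall>j. x $ j $ t (rk j) * a $ j $ t (rk j) > 0}"
  proof -
    have "{x :: real ^ 'v ^ 'n. \<forall>j. x $ j $ t (rk j) * a $ j $ t (rk j) > 0} = (\<Inter>j. {x. 0 < x $ j $ t (rk j) * a $ j $ t (rk j)})" by auto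
    then show ?thesis by (simp only:) (intro open_INT ballI open_Collect_less continuous_intros; simp)
  qed
  moreover have "a \<in> {x. \<forall>j. x $ j $ t (rk j) * a $ j $ t (rk j) > 0}" using diag by (auto simp: zero_less_mult_iff linorder_neq_iff)
  ultimately obtain \<rho> where \<rho>: "\<rho> > 0" "\<And>x j. dist x a < \<rho> \<Longrightarrow> x $ j $ t (rk j) * a $ j $ t (rk j) > 0"
    unfolding open_dist by blast
  have "\<Psi> a \<in> {z \<in> L. dist z (\<Psi> a) < e}" using \<Psi>L[OF aA] e by simp
  then obtain e1 where e1: "e1 > 0" "\<And>z. z \<in> L \<Longrightarrow> dist z (\<Psi> a) < e \<Longrightarrow> dist z (\<Psi> a) < e1 \<Longrightarrow> dist (G z) a < \<rho>"
    using contG[unfolded continuous_on_iff] \<rho>(1) Ga by (metis (mono_tags, lifting) mem_Collect_eq)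
  define e' where "e' = min e e1"
  have e': "e' > 0" "e' \<le> e" using e e1(1) by (auto simp: e'_def)
  define F where "F z = lam (?\<phi> (G z))" for z
  have contF: "continuous_on {z \<in> L. dist z (u0 + \<tau>0 *\<^sub>R w0) < e'} F"
  proof -
    have "continuous_on {z \<in> L. dist z (u0 + \<tau>0 *\<^sub>R w0) < e'} G"
      using contG unfolding \<Psi>a by (rule continuous_on_subset) (use e'(2) in auto)
    then show ?thesis unfolding F_def
      by (intro bounded_linear.continuous_on[OF bl(1)] continuous_on_compose2[OF continuous_edge_form[of UNIV]]) auto
  qed
  define r0 where "r0 = e' / norm w0"
  have r0: "r0 > 0" using e' w0nz by (simp add: r0_def)
  have dist\<tau>: "dist (u0 + \<tau> *\<^sub>R w0) (u0 + \<tau>0 *\<^sub>R w0) < e' \<longleftrightarrow> \<bar>\<tau> - \<tau>0\<bar> < r0" for \<tau>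
  proof -
    have "dist (u0 + \<tau> *\<^sub>R w0) (u0 + \<tau>0 *\<^sub>R w0) = \<bar>\<tau> - \<tau>0\<bar> * norm w0" by (simp add: dist_norm flip: scaleR_diff_left)
    then show ?thesis using w0nz by (simp add: r0_def field_simps)
  qed
  define h where "h \<tau> = F (u0 + \<tau> *\<^sub>R w0)" for \<tau>
  have h0: "h \<tau>0 = s0" unfolding h_def F_def using Ga \<Psi>a lam\<phi>a by simp
  have hG: "?\<phi> (G (u0 + \<tau> *\<^sub>R w0)) = u0 + h \<tau> *\<^sub>R w0" "G (u0 + \<tau> *\<^sub>R w0) \<in> A t" "\<kappa> (G (u0 + \<tau> *\<^sub>R w0)) = \<tau>" if "\<bar>\<tau> - \<tau>0\<bar> < r0" for \<tau>
    using Gprops[OF u0I, of \<tau>] dist\<tau>[of \<tau>] that e'(2) by (auto simp: h_def F_def)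
  have hS: "h \<tau> \<in> ?S" if "\<bar>\<tau> - \<tau>0\<bar> < r0" for \<tau>
  proof -
    have "?\<phi> (G (u0 + \<tau> *\<^sub>R w0)) \<in> ?\<phi> ` ?V" using subsetD[OF A_anchored_configs hG(2)[OF that]] by blast
    then show ?thesis using hG(1)[OF that] by simp
  qed
  have conth: "continuous_on {\<tau>0 - r0<..<\<tau>0 + r0} h"
    unfolding h_def
    by (rule continuous_on_compose2[OF contF])
      (use u0L w0L subspace_L dist\<tau> in \<open>auto intro!: continuous_intros subspace_add subspace_scale\<close>)
  \<comment> \<open>All values of \<open>h\<close> belong to the closed set of attained parameters.
    An interval of values around \<open>s0\<close> would make it an interior point.\<close>
  have claim1: "\<not> (h \<tau>1 < s0 \<and> s0 < h \<tau>2)" if "\<bar>\<tau>1 - \<tau>0\<bar> < r0" "\<bar>\<tau>2 - \<tau>0\<bar> < r0" for \<tau>1 \<tau>2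
  proof
    assume lt: "h \<tau>1 < s0 \<and> s0 < h \<tau>2"
    let ?J = "{\<tau>0 - r0<..<\<tau>0 + r0}"
    have "connected (h ` ?J)" by (rule connected_continuous_image[OF conth]) simp
    moreover have "\<tau>1 \<in> ?J" "\<tau>2 \<in> ?J" using that by (auto simp: abs_less_iff)
    then have "h \<tau>1 \<in> h ` ?J" "h \<tau>2 \<in> h ` ?J" by blast+
    ultimately have "{h \<tau>1..h \<tau>2} \<subseteq> h ` ?J" by (rule connected_contains_Icc)
    moreover have "h ` ?J \<subseteq> ?S" using hS by auto
    ultimately have "{h \<tau>1<..<h \<tau>2} \<subseteq> ?S" by (meson greaterThanLessThan_subseteq_atLeastAtMost_iff order_refl order_trans)
    then have "s0 \<in> interior ?S" using lt by (intro interiorI[of "{h \<tau>1<..<h \<tau>2}"]) auto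
    then show False using s0(2) by blast
  qed
  \<comment> \<open>If \<open>h\<close> were constant on an interval, a transcendental \<tau> in it
    would give a point whose \<tau> and offset coordinates move independently under derivations.
    Such a point is generic in the slice, hence regular, although its value lies on the
    boundary.\<close>
  have claim2: "\<exists>\<tau>. \<alpha> < \<tau> \<and> \<tau> < \<beta> \<and> h \<tau> \<noteq> s0" if \<alpha>\<beta>: "\<alpha> < \<beta>" "\<tau>0 - r0 \<le> \<alpha>" "\<beta> \<le> \<tau>0 + r0" for \<alpha> \<beta>
  proof (rule ccontr)
    assume "\<not> ?thesis"
    then have const: "\<And>\<tau>. \<alpha> < \<tau> \<Longrightarrow> \<tau> < \<beta> \<Longrightarrow> h \<tau> = s0" by blast
    let ?T = "fld (F0 \<union> c ` I)"
    have "countable ?T" using countable_F0 I(2) by (intro countable_fld) (auto intro: countable_finite)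
    then obtain \<tau> where \<tau>: "\<alpha> < \<tau>" "\<tau> < \<beta>" "trans_over ?T \<tau>" using exists_trans_real[OF _ subfld_fld \<alpha>\<beta>(1)] by metis
    define x where "x = G (u0 + \<tau> *\<^sub>R w0)"
    have near: "\<bar>\<tau> - \<tau>0\<bar> < r0" using \<tau> \<alpha>\<beta> by linarith
    have x: "x \<in> A t" "?\<phi> x = u0 + s0 *\<^sub>R w0" "\<kappa> x = \<tau>"
      using hG[OF near] const[OF \<tau>(1,2)] by (auto simp: x_def)
    \<comment> \<open>The velocities \<open>z\<close> of the offset and \<open>k\<close> of \<tau>
      are prescribed; the velocity of \<open>s0\<close> is then whatever the extension makes it,
      which accounts for \<open>r\<close>.\<close>
    have DER: "\<exists>Dm \<delta>. deriv_on Dm \<delta> \<and> F0 \<subseteq> Dm \<and> entries x \<subseteq> Dm \<and> (\<forall>y\<in>F0. \<delta> y = 0) \<and> map_entries \<delta> x \<in> A t \<and> \<kappa> (map_entries \<delta> x) = k \<and>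
        (\<exists>r. edge_form E x (map_entries \<delta> x) = z + r *\<^sub>R w0)" if z: "z \<in> span I" for z k
    proof -
      obtain v where v: "z = (\<Sum>b\<in>I. v b *\<^sub>R b)" using z by (auto simp: span_finite[OF I(2)])
      have "\<exists>\<delta>'. deriv_on ?T \<delta>' \<and> (\<forall>y\<in>F0. \<delta>' y = 0) \<and> (\<forall>b\<in>I. \<delta>' (c b) = 2 * v b)"
        using cI[unfolded deriv_free_def, rule_format, OF deriv_on_zero[OF subfld_F0], of "\<lambda>b. 2 * v b"] by simp
      then obtain d1 where d1: "deriv_on ?T d1" "\<And>y. y \<in> F0 \<Longrightarrow> d1 y = 0" "\<And>b. b \<in> I \<Longrightarrow> d1 (c b) = 2 * v b"
        by blast
      obtain d2 where d2: "deriv_on (fld (insert \<tau> ?T)) d2" "\<And>y. y \<in> ?T \<Longrightarrow> d2 y = d1 y" "d2 \<tau> = k"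
        using deriv_extend_trans[OF d1(1) \<tau>(3)] by metis
      let ?T2 = "fld (insert \<tau> ?T)"
      have "finite (entries x \<union> {s0})" by simp
      then obtain d3 where d3: "deriv_on (fld (?T2 \<union> (entries x \<union> {s0}))) d3" "\<And>y. y \<in> ?T2 \<Longrightarrow> d3 y = d2 y"
        using deriv_extend[OF d2(1)] by metis
      let ?T3 = "fld (?T2 \<union> (entries x \<union> {s0}))"
      have s1: "F0 \<subseteq> ?T" "c ` I \<subseteq> ?T" using fld_superset[of "F0 \<union> c ` I"] by auto
      have s2: "?T \<subseteq> ?T2" "\<tau> \<in> ?T2" using fld_superset[of "insert \<tau> ?T"] by auto
      have s3: "?T2 \<subseteq> ?T3" "entries x \<subseteq> ?T3" "s0 \<in> ?T3" using fld_superset[of "?T2 \<union> (entries x \<union> {s0})"] by auto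
      have FD: "F0 \<subseteq> ?T3" "c ` I \<subseteq> ?T3" using s1 s2(1) s3(1) by (meson order_trans)+
      have d31: "d3 y = d1 y" if "y \<in> ?T" for y using d3(2)[OF subsetD[OF s2(1) that]] d2(2)[OF that] by simp
      have 0: "d3 y = 0" if "y \<in> F0" for y using d31[OF subsetD[OF s1(1) that]] d1(2)[OF that] by simp
      have dc: "d3 (c b) = 2 * v b" if "b \<in> I" for b
        using d31[OF subsetD[OF s1(2) imageI[OF that]]] d1(3)[OF that] by simp
      have yA: "map_entries d3 x \<in> A t" using map_entries_A[OF d3(1) FD(1) 0 x(1) s3(2)] .
      have k: "\<kappa> (map_entries d3 x) = k" using x(3) d3(2)[OF s2(2)] d2(3) by (simp add: \<kappa>_def)
      have "edge_form E x (map_entries d3 x) = (\<Sum>b\<in>I. (d3 (c b) / 2) *\<^sub>R b) + (d3 s0 / 2) *\<^sub>R w0"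
        by (rule deriv_value[OF I(1) d3(1) FD s3(2,3) 0 w0F x(2)[unfolded u0_def]])
      then have "edge_form E x (map_entries d3 x) = z + (d3 s0 / 2) *\<^sub>R w0" using dc by (simp add: v cong: sum.cong)
      then show ?thesis using d3(1) FD(1) s3(2) 0 yA k by blast
    qed
    \<comment> \<open>The derivative of \<open>\<Psi>\<close> at \<open>x\<close>, without the
      factor \<open>2\<close> in the measurement part. It is onto, hence injective on the slice by
      equality of dimensions, so matching its values makes a derivation realize any tangent vector
      \<open>v\<close>.\<close>
    define \<Theta> where "\<Theta> y = edge_form E x y - lam (edge_form E x y) *\<^sub>R w0 + \<kappa> y *\<^sub>R w0" for y
    have lin\<Theta>: "linear \<Theta>"
      by (rule linearI) (auto simp: \<Theta>_def edge_form_linear edge_form_scaleR linear_add[OF lam(1)] linear_cmul[OF lam(1)]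
          linear_add[OF lin\<kappa>] linear_cmul[OF lin\<kappa>] algebra_simps)
    have \<Theta>eq: "\<Theta> y = z + \<kappa> y *\<^sub>R w0" if "z \<in> span I" "edge_form E x y = z + r *\<^sub>R w0" for y z r
      unfolding \<Theta>_def that(2) using lamI[OF that(1)] lam(2) by (simp add: linear_add[OF lam(1)] linear_cmul[OF lam(1)])
    have sur\<Theta>: "\<exists>y\<in>A t. \<Theta> y = z" if z: "z \<in> L" for z
    proof -
      obtain \<delta> r where d: "map_entries \<delta> x \<in> A t" "\<kappa> (map_entries \<delta> x) = lam z" "edge_form E x (map_entries \<delta> x) = (z - lam z *\<^sub>R w0) + r *\<^sub>R w0"
        using DER[OF dec[OF z], of "lam z"] by blast
      have "\<Theta> (map_entries \<delta> x) = z" using \<Theta>eq[OF dec[OF z] d(3)] d(2) by simp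
      then show ?thesis using d(1) by blast
    qed
    have der: "\<exists>Dm \<delta>. deriv_on Dm \<delta> \<and> F0 \<subseteq> Dm \<and> entries x \<subseteq> Dm \<and> (\<forall>y\<in>F0. \<delta> y = 0) \<and> map_entries \<delta> x = v" if v: "v \<in> A t" for v
    proof -
      have xv: "edge_form E x v \<in> L" using edge_form_in_L x(1) v A_anchored_configs by blast
      obtain Dm \<delta> r where d: "deriv_on Dm \<delta>" "F0 \<subseteq> Dm" "entries x \<subseteq> Dm" "\<forall>y\<in>F0. \<delta> y = 0" "map_entries \<delta> x \<in> A t" "\<kappa> (map_entries \<delta> x) = \<kappa> v"
        "edge_form E x (map_entries \<delta> x) = (edge_form E x v - lam (edge_form E x v) *\<^sub>R w0) + r *\<^sub>R w0"
        using DER[OF dec[OF xv], of "\<kappa> v"] by blast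
      have "\<Theta> (map_entries \<delta> x) = \<Theta> v" using \<Theta>eq[OF dec[OF xv] d(7)] d(6) by (simp add: \<Theta>_def)
      then have "\<Theta> (map_entries \<delta> x - v) = 0" by (simp add: linear_diff[OF lin\<Theta>])
      moreover have "map_entries \<delta> x - v \<in> A t" using d(5) v subspace_A by (simp add: subspace_diff)
      ultimately have "map_entries \<delta> x - v = 0" by (intro linear_surj_subspace_inj[OF lin\<Theta> subspace_A dimAL sur\<Theta>])
      then show ?thesis using d by auto
    qed
    obtain y where "y \<in> A t" "y \<noteq> 0" "edge_form E x y = 0"
      using not_surj_kernel[OF t(1) x(1) boundary_not_surj[OF u0L w0L x(1,2) s0(2)]] by blast
    then show False using deriv_generic_regular[OF t(1) x(1) der] by blast
  qed
  obtain \<tau>1 where \<tau>1: "\<tau>0 - r0 < \<tau>1" "\<tau>1 < \<tau>0" "h \<tau>1 \<noteq> s0" using claim2[of "\<tau>0 - r0" \<tau>0] r0 by auto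
  obtain \<tau>2 where \<tau>2: "\<tau>0 < \<tau>2" "\<tau>2 < \<tau>0 + r0" "h \<tau>2 \<noteq> s0" using claim2[of \<tau>0 "\<tau>0 + r0"] r0 by auto
  have n1: "\<bar>\<tau>1 - \<tau>0\<bar> < r0" and n2: "\<bar>\<tau>2 - \<tau>0\<bar> < r0" using \<tau>1 \<tau>2 by auto
  have same: "(h \<tau>1 - h \<tau>0) * (h \<tau>2 - h \<tau>0) > 0"
    using claim1[OF n1 n2] claim1[OF n2 n1] \<tau>1(3) \<tau>2(3) unfolding h0 by (auto simp: zero_less_mult_iff)
  obtain v \<eta> where \<eta>: "\<eta> > 0" and dv: "\<forall>u\<in>L. \<forall>s. dist u u0 < \<eta> \<longrightarrow> \<bar>s - v\<bar> < \<eta> \<longrightarrow> (\<exists>\<tau> \<tau>'. \<tau> < \<tau>' \<and>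
      dist (u + \<tau> *\<^sub>R w0) (u0 + \<tau>0 *\<^sub>R w0) < e' \<and> dist (u + \<tau>' *\<^sub>R w0) (u0 + \<tau>0 *\<^sub>R w0) < e' \<and>
      F (u + \<tau> *\<^sub>R w0) = s \<and> F (u + \<tau>' *\<^sub>R w0) = s)"
    by (rule double_value_sym[OF subspace_L u0L w0L contF \<tau>1(2) \<tau>2(1) dist\<tau>[THEN iffD2, OF n1] dist\<tau>[THEN iffD2, OF n2]
        same[unfolded h_def]]) (rule that, assumption+)
  obtain \<tau>s where \<tau>s: "dist (u0 + \<tau>s *\<^sub>R w0) (u0 + \<tau>0 *\<^sub>R w0) < e'" "F (u0 + \<tau>s *\<^sub>R w0) = v"
    using dv[rule_format, OF u0L, of v] \<eta> by auto
  \<comment> \<open>A configuration whose value sits in the middle of the doubly covered region;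
    values of all nearby anchored configurations stay inside that region.\<close>
  define z0 where "z0 = G (u0 + \<tau>s *\<^sub>R w0)"
  have z0: "z0 \<in> A t" "?\<phi> z0 = u0 + v *\<^sub>R w0"
    using Gprops[OF u0I, of \<tau>s] \<tau>s e'(2) by (auto simp: z0_def F_def)
  have lamz0: "lam (?\<phi> z0) = v" unfolding z0(2) using lamI[OF u0I] lam(2) by (simp add: linear_add[OF lam(1)] linear_cmul[OF lam(1)])
  let ?U = "{z :: real ^ 'v ^ 'n. dist (?\<phi> z - lam (?\<phi> z) *\<^sub>R w0) u0 < \<eta> \<and> \<bar>lam (?\<phi> z) - v\<bar> < \<eta>}"
  have "open ?U"
  proof -
    have c1: "continuous_on UNIV (\<lambda>z :: real ^ 'v ^ 'n. lam (?\<phi> z))"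
      by (intro bounded_linear.continuous_on[OF bl(1)] continuous_edge_form)
    then show ?thesis
      by (intro open_Collect_conj open_Collect_less continuous_intros continuous_edge_form)
  qed
  moreover have "z0 \<in> ?U" using \<eta> lamz0[unfolded z0(2)] by (simp add: z0(2))
  ultimately obtain \<epsilon> where \<epsilon>: "\<epsilon> > 0" "\<And>z. dist z z0 < \<epsilon> \<Longrightarrow> z \<in> ?U" unfolding open_dist by blast
  show ?thesis
  proof (rule that[of z0 \<epsilon>])
    show "z0 \<in> anchored_configs E w t0" using z0(1) A_anchored_configs by blast
    show "\<epsilon> > 0" by (rule \<epsilon>)
    fix z :: "real ^ 'v ^ 'n" assume z: "z \<in> anchored_configs E w t0" "dist z z0 < \<epsilon>"
    define u where "u = ?\<phi> z - lam (?\<phi> z) *\<^sub>R w0"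
    define s where "s = lam (?\<phi> z)"
    have zL: "?\<phi> z \<in> L" by (rule edge_form_in_L[OF z(1) z(1)])
    have uI: "u \<in> span I" unfolding u_def by (rule dec[OF zL])
    have us: "dist u u0 < \<eta>" "\<bar>s - v\<bar> < \<eta>" using \<epsilon>(2)[OF z(2)] by (auto simp: u_def s_def)
    have \<phi>z: "?\<phi> z = u + s *\<^sub>R w0" by (simp add: u_def s_def)
    obtain \<tau> \<tau>' where \<tau>: "\<tau> < \<tau>'" "dist (u + \<tau> *\<^sub>R w0) (u0 + \<tau>0 *\<^sub>R w0) < e'" "dist (u + \<tau>' *\<^sub>R w0) (u0 + \<tau>0 *\<^sub>R w0) < e'"
      "F (u + \<tau> *\<^sub>R w0) = s" "F (u + \<tau>' *\<^sub>R w0) = s" using dv[rule_format, OF _ us] uI IL by blast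
    define x where "x = G (u + \<tau> *\<^sub>R w0)"
    define y where "y = G (u + \<tau>' *\<^sub>R w0)"
    have x: "x \<in> A t" "\<kappa> x = \<tau>" "?\<phi> x = ?\<phi> z"
      using Gprops[OF uI, of \<tau>] \<tau> e'(2) \<phi>z by (auto simp: x_def F_def)
    have y: "y \<in> A t" "\<kappa> y = \<tau>'" "?\<phi> y = ?\<phi> z"
      using Gprops[OF uI, of \<tau>'] \<tau> e'(2) \<phi>z by (auto simp: y_def F_def)
    have inL: "u + k *\<^sub>R w0 \<in> L" for k using uI IL w0L subspace_L by (auto intro!: subspace_add subspace_scale)
    have "dist x a < \<rho>" "dist y a < \<rho>"
      using e1(2)[OF inL, of \<tau>] e1(2)[OF inL, of \<tau>'] \<tau>(2,3) unfolding \<Psi>a x_def y_def e'_def by auto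
    then have "x $ j $ t (rk j) * a $ j $ t (rk j) > 0" "y $ j $ t (rk j) * a $ j $ t (rk j) > 0" for j using \<rho>(2) by blast+
    then have sgn: "x $ j $ t (rk j) * y $ j $ t (rk j) > 0" for j by (metis zero_less_mult_iff less_asym)
    have "x \<noteq> y" using x(2) y(2) \<tau>(1) by auto
    then have "\<exists>s r. pair_form x x s r \<noteq> pair_form y y s r" using pinned_unique[OF x(1) y(1) sgn] by blast
    \<comment> \<open>The two preimages are not congruent to each other, so at least one of them is
      not congruent to \<open>z\<close>.\<close>
    then have "(\<exists>s r. pair_form x x s r \<noteq> pair_form z z s r) \<or> (\<exists>s r. pair_form y y s r \<noteq> pair_form z z s r)" by metis
    then show "\<exists>y :: real ^ 'v ^ 'n. edge_form E y y = edge_form E z z \<and> (\<exists>s r. pair_form y y s r \<noteq> pair_form z z s r)" using x(3) y(3) by blast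
  qed
qed

end

section \<open>Complex frameworks\<close>

definition ones :: "real ^ 'v" where
  "ones = (\<chi> t. 1)"

text \<open>Subtracting the value at \<open>t0\<close> sends the coordinate functions of
  \<open>p\<close> and \<open>f0\<close> to \<open>CARD('n) + 1\<close> independent anchored
  functions. In a relation with \<open>a j \<noteq> 0\<close>, a derivation moving only
  \<open>p $ j\<close>, arbitrarily, would put every function in the span of the constants and the
  coordinates, \<open>f0\<close> included.\<close>

lemma dim_anchored_kernel_big:
  fixes p :: "real ^ 'v::finite ^ 'n::finite"
  assumes generic_conf: "generic_conf p" and pK: "p \<in> stress_configs E w" and f0: "f0 \<in> stress_kernel E w" "f0 \<notin> span (insert ones (range (\<lambda>j. p $ j)))"
  shows "CARD('n) < dim (anchored_kernel E w t0)"
proof -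
  let ?S = "span (insert ones (range (\<lambda>j. p $ j)))"
  have "edge_form1 E ones g = 0" for g by (simp add: edge_form1_def ones_def vec_eq_iff)
  then have one: "ones \<in> stress_kernel E w" by (simp add: stress_kernel_def)
  have pj: "p $ j \<in> stress_kernel E w" for j using pK by (simp add: stress_configs_iff)
  define sh where "sh f = f - (f $ t0) *\<^sub>R ones" for f :: "real ^ 'v"
  have shV: "sh f \<in> anchored_kernel E w t0" if "f \<in> stress_kernel E w" for f
    using that one subspace_stress_kernel[of E w] by (auto simp: anchored_kernel_def sh_def ones_def intro!: subspace_diff subspace_scale)
  define q where "q j = sh (p $ j)" for j
  have qS: "q j \<in> ?S" for j unfolding q_def sh_def by (intro span_diff span_scale span_base) auto
  have spanq: "span (range q) \<subseteq> ?S" using qS by (intro span_minimal) auto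
  have backS: "f \<in> ?S" if "sh f \<in> span (range q)" for f
  proof -
    have "sh f \<in> ?S" "ones \<in> ?S" using that spanq span_base[of ones "insert ones (range (\<lambda>j. p $ j))"] by auto
    then have "sh f + (f $ t0) *\<^sub>R ones \<in> ?S" by (intro span_add span_scale)
    then show ?thesis by (simp add: sh_def)
  qed
  have ind: "a j = 0" if a: "(\<Sum>j\<in>UNIV. a j *\<^sub>R q j) = 0" for a j
  proof (rule ccontr)
    assume aj: "a j \<noteq> 0"
    have "u \<in> ?S" for u
    proof (rule backS)
      obtain D \<delta> where d: "deriv_on D \<delta>" "range a \<subseteq> D" "entries p \<subseteq> D" "map_entries \<delta> p = (\<chi> i s. if i = j then u $ s else 0)"
        by (rule generic_conf_deriv[OF generic_conf, of "range a" "\<chi> i s. if i = j then u $ s else 0"]) auto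
      note D = deriv_onD(1)[OF d(1)]
      have dp: "\<delta> (p $ i $ s) = (if i = j then u $ s else 0)" for i s using d(4) by (simp add: vec_eq_iff)
      have qi: "q i $ s = p $ i $ s - p $ i $ t0" for i s by (simp add: q_def sh_def ones_def)
      have "(\<Sum>i\<in>UNIV. \<delta> (a i) * q i $ s) + a j * (u $ s - u $ t0) = 0" for s
      proof -
        have aD: "a i \<in> D" "p $ i $ s - p $ i $ t0 \<in> D" for i using d(2,3) by (auto simp: entsD subfldD(7)[OF D])
        have "(\<Sum>i\<in>UNIV. a i * (p $ i $ s - p $ i $ t0)) = 0" using a by (simp add: vec_eq_iff qi)
        then have "0 = \<delta> (\<Sum>i\<in>UNIV. a i * (p $ i $ s - p $ i $ t0))" using deriv_onD(2)[OF d(1)] by simp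
        also have "\<dots> = (\<Sum>i\<in>UNIV. \<delta> (a i * (p $ i $ s - p $ i $ t0)))"
          using aD by (intro deriv_on_sum[OF d(1)] subfldD(4)[OF D]) auto
        also have "\<dots> = (\<Sum>i\<in>UNIV. \<delta> (a i) * q i $ s + (if i = j then a j * (u $ s - u $ t0) else 0))"
        proof (rule sum.cong[OF refl])
          fix i
          show "\<delta> (a i * (p $ i $ s - p $ i $ t0)) = \<delta> (a i) * q i $ s + (if i = j then a j * (u $ s - u $ t0) else 0)"
            using d(3) by (subst deriv_onD(6)[OF d(1) aD]) (auto simp: deriv_onD(5)[OF d(1)] entsD dp qi mult.commute)
        qed
        also have "\<dots> = (\<Sum>i\<in>UNIV. \<delta> (a i) * q i $ s) + a j * (u $ s - u $ t0)" by (simp add: sum.distrib)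
        finally show ?thesis by simp
      qed
      then have "a j *\<^sub>R sh u = - (\<Sum>i\<in>UNIV. \<delta> (a i) *\<^sub>R q i)"
        by (simp add: vec_eq_iff sh_def ones_def eq_neg_iff_add_eq_0 add.commute)
      moreover have "(\<Sum>i\<in>UNIV. \<delta> (a i) *\<^sub>R q i) \<in> span (range q)" by (intro span_sum span_scale span_base) auto
      ultimately have "a j *\<^sub>R sh u \<in> span (range q)" by (simp add: span_neg)
      then have "(1 / a j) *\<^sub>R (a j *\<^sub>R sh u) \<in> span (range q)" by (rule span_scale)
      then show "sh u \<in> span (range q)" using aj by simp
    qed
    then show False using f0(2) by blast
  qed
  have inj: "inj q"
  proof (rule injI, rule ccontr)
    fix i j assume eq: "q i = q j" and ne: "i \<noteq> j"
    have "(\<Sum>k\<in>UNIV. (if k = i then 1 else if k = j then - 1 else 0) *\<^sub>R q k)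
      = (\<Sum>k\<in>UNIV. (if k = i then q i else 0) + (if k = j then - q j else 0))"
      using ne by (intro sum.cong) auto
    also have "\<dots> = 0" using eq by (simp add: sum.distrib)
    finally show False using ind[of "\<lambda>k. if k = i then 1 else if k = j then - 1 else 0" i] by simp
  qed
  have "independent (range q)"
  proof
    assume "dependent (range q)"
    then obtain a where a: "\<exists>v\<in>range q. a v \<noteq> 0" "(\<Sum>v\<in>range q. a v *\<^sub>R v) = 0" by (auto simp: dependent_finite)
    then have "(\<Sum>j\<in>UNIV. a (q j) *\<^sub>R q j) = 0" using inj by (simp add: sum.reindex)
    then show False using ind[of "\<lambda>j. a (q j)"] a(1) by blast
  qed
  moreover have nsp: "sh f0 \<notin> span (range q)" using backS f0(2) by blast
  ultimately have ind': "independent (insert (sh f0) (range q))" by (rule independent_insertI[rotated])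
  have "insert (sh f0) (range q) \<subseteq> anchored_kernel E w t0" using shV f0(1) pj by (auto simp: q_def)
  then have "card (insert (sh f0) (range q)) \<le> dim (anchored_kernel E w t0)" using ind' by (rule independent_card_le_dim)
  moreover have "sh f0 \<notin> range q" using nsp span_superset[of "range q"] by blast
  then have "card (insert (sh f0) (range q)) = Suc CARD('n)" using inj by (simp add: card_image)
  ultimately show ?thesis by simp
qed

lemma generic_conf_line:
  fixes p q :: "'a::{field_char_0,real_normed_field} ^ 'v::finite ^ 'n::finite"
  assumes "generic_conf p"
  shows "countable {s. \<not> generic_conf (\<chi> i t. (1 - s) * p $ i $ t + s * q $ i $ t)}"
  using generic_line[OF assms[unfolded generic_conf_def], of "\<lambda>(t, i). q $ i $ t"]
  by (simp add: generic_conf_def case_prod_unfold)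

text \<open>A kernel function outside the span creates the \<open>pinning\<close> situation and with
  it a fold point whose anchored neighbours are all flexible. The line from \<open>p\<close> to that
  point contains generic configurations arbitrarily close to it, against
  \<open>rigid\<close>.\<close>

lemma stress_kernel_span:
  fixes p :: "real ^ 'v::finite ^ 'n::finite"
  assumes rigid: "\<And>(x :: real ^ 'v ^ 'n) (y :: real ^ 'v ^ 'n). generic_conf x \<Longrightarrow> edge_form E x x = edge_form E y y \<Longrightarrow> \<forall>t u. pair_form x x t u = pair_form y y t u"
    and p: "generic_conf p"
  obtains w where "p \<in> stress_configs E w" "stress_kernel E w \<subseteq> span (insert ones (range (\<lambda>j. p $ j)))"
proof -
  have IRp: "inf_rigid E p" using GGR_imp_inf_rigid[OF rigid[OF p] p] .
  obtain w where pw: "p \<in> stress_configs E w"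
    and surj: "span {edge_form E x y | x y. x \<in> (stress_configs E w :: (real ^ 'v ^ 'n) set) \<and> y \<in> (stress_configs E w :: (real ^ 'v ^ 'n) set)} \<subseteq> edge_form E p ` stress_configs E w"
    using generic_stress[OF p, of E] by blast
  have "stress_kernel E w \<subseteq> span (insert ones (range (\<lambda>j. p $ j)))"
  proof (rule ccontr)
    assume "\<not> ?thesis"
    then obtain f0 where f0: "f0 \<in> stress_kernel E w" "f0 \<notin> span (insert ones (range (\<lambda>j. p $ j)))" by blast
    fix t0 :: 'v
    obtain rk :: "'n \<Rightarrow> nat" where rk: "bij_betw rk UNIV {..<CARD('n)}"
      using ex_bij_betw_finite_nat[of "UNIV :: 'n set"] by (auto simp: atLeast0LessThan)
    interpret pinning E p w t0 rk "CARD('n)"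
      using p pw surj IRp rk dim_anchored_kernel_big[OF p pw f0] by unfold_locales auto
    obtain z0 e where z0: "z0 \<in> anchored_configs E w t0" "e > 0"
      and flex: "\<forall>z\<in>anchored_configs E w t0. dist z z0 < e \<longrightarrow>
        (\<exists>y :: real ^ 'v ^ 'n. edge_form E y y = edge_form E z z \<and> (\<exists>s r. pair_form y y s r \<noteq> pair_form (z :: real ^ 'v ^ 'n) z s r))"
      by (rule fold_point) blast
    define r where "r = e / (norm (anchored_p - z0) + 1)"
    have r: "r > 0" unfolding r_def using z0(2) by (intro divide_pos_pos add_nonneg_pos) auto
    let ?x = "\<lambda>s. \<chi> i t. (1 - s) * p $ i $ t + s * z0 $ i $ t"
    have "\<not> {1 - r<..<1} \<subseteq> {s. \<not> generic_conf (?x s)}"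
      using countable_subset[OF _ generic_conf_line[OF p, of z0]] uncountable_open_interval[of "1 - r" 1] r by auto
    then obtain s where s: "1 - r < s" "s < 1" "generic_conf (?x s)" by auto
    define X where "X = ?x s"
    have X: "X $ i $ t = (1 - s) * p $ i $ t + s * z0 $ i $ t" for i t by (simp add: X_def)
    \<comment> \<open>An anchored configuration has zero coordinates and is never generic. The
      generic \<open>X\<close> is therefore compared with its translate, which has the same
      distances and lies on the segment from \<open>anchored_p\<close> to \<open>z0\<close>.\<close>
    let ?z = "\<chi> i t. X $ i $ t - X $ i $ t0"
    have zeq: "?z = (1 - s) *\<^sub>R anchored_p + s *\<^sub>R z0"
      using z0(1) by (simp add: vec_eq_iff anchored_p_def X anchored_configs_def anchored_kernel_def algebra_simps)
    have zV: "?z \<in> anchored_configs E w t0" unfolding zeq using anchored_p_anchored_configs z0(1) subspace_anchored_configs by (intro subspace_add subspace_scale)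
    have "?z - z0 = (1 - s) *\<^sub>R (anchored_p - z0)" unfolding zeq by (simp add: algebra_simps)
    then have "dist ?z z0 = (1 - s) * norm (anchored_p - z0)" using s by (simp add: dist_norm)
    also have "\<dots> \<le> (1 - s) * (norm (anchored_p - z0) + 1)" using s by (intro mult_left_mono) auto
    also have "\<dots> < r * (norm (anchored_p - z0) + 1)" using s by (intro mult_strict_right_mono) (auto intro: add_nonneg_pos)
    also have "\<dots> = e" unfolding r_def using add_nonneg_pos[of "norm (anchored_p - z0)" 1] by simp
    finally obtain y :: "real ^ 'v ^ 'n" and t u where y: "edge_form E y y = edge_form E ?z ?z" "pair_form y y t u \<noteq> pair_form ?z ?z t u"
      using flex zV by blast
    have "edge_form E ?z ?z = edge_form E X ?z" by (rule edge_form_shift)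
    also have "\<dots> = edge_form E ?z X" by (rule edge_form_commute)
    also have "\<dots> = edge_form E X X" by (rule edge_form_shift)
    finally have e1: "edge_form E X X = edge_form E y y" using y(1) by simp
    have "pair_form ?z ?z t u = pair_form X ?z t u" by (rule pair_form_shift)
    also have "\<dots> = pair_form ?z X t u" by (rule pair_form_commute)
    also have "\<dots> = pair_form X X t u" by (rule pair_form_shift)
    finally have "pair_form X X t u \<noteq> pair_form y y t u" using y(2) by simp
    then show False using rigid[OF s(3)[folded X_def] e1] by simp
  qed
  then show ?thesis using pw that by blast
qed

section \<open>Stresses of complex frameworks\<close>

lemma hom_pair_form:
  fixes x y :: "'a::field ^ 'v ^ 'n"
  assumes h: "hom_on D h" and "entries x \<subseteq> D" "entries y \<subseteq> D"
  shows "h (pair_form x y t u) = pair_form (map_entries h x) (map_entries h y) t u" "pair_form x y t u \<in> D"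
proof -
  note D = hom_onD(1)[OF h]
  have e: "x $ j $ t - x $ j $ u \<in> D" "y $ j $ t - y $ j $ u \<in> D" for j
    using assms by (auto simp: subfldD(7)[OF D] entsD)
  show "pair_form x y t u \<in> D" unfolding pair_form_def using e by (intro subfld_sum D) (auto simp: subfldD(4)[OF D])
  have "h (pair_form x y t u) = (\<Sum>j\<in>UNIV. h ((x $ j $ t - x $ j $ u) * (y $ j $ t - y $ j $ u)))"
    unfolding pair_form_def using e by (intro hom_on_sum[OF h]) (auto simp: subfldD(4)[OF D])
  also have "\<dots> = (\<Sum>j\<in>UNIV. (h (x $ j $ t) - h (x $ j $ u)) * (h (y $ j $ t) - h (y $ j $ u)))"
    using assms e by (intro sum.cong) (auto simp: hom_onD(5,7)[OF h] entsD)
  finally show "h (pair_form x y t u) = pair_form (map_entries h x) (map_entries h y) t u" by (simp add: pair_form_def)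
qed

lemma generic_conf_hom:
  fixes p q :: "complex ^ 'v::finite ^ 'n::finite"
  assumes "generic_conf p" "generic_conf q"
  obtains h where "hom_on (fld (entries p)) h" "map_entries h p = q"
proof -
  obtain h where h: "hom_on (fld (range (\<lambda>(t, i). p $ i $ t))) h" "\<And>z. h ((\<lambda>(t, i). p $ i $ t) z) = (\<lambda>(t, i). q $ i $ t) z"
    using generic_transfer[OF assms[unfolded generic_conf_def]] by metis
  have "range (\<lambda>(t, i). p $ i $ t) = entries p" by (auto simp: entries_def)
  moreover have "map_entries h p = q" using h(2)[of "(t, i)" for t i] by (simp add: vec_eq_iff)
  ultimately show ?thesis using h(1) that by metis
qed

text \<open>Bilinear without conjugation, so that it is polynomial in the entries and compatible
  with field homomorphisms.\<close>

definition complex_pairing :: "complex ^ 'v ^ 'v \<Rightarrow> complex ^ 'v ^ 'v \<Rightarrow> complex" where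
  "complex_pairing \<theta> z = (\<Sum>k\<in>UNIV. \<theta> $ fst k $ snd k * z $ fst k $ snd k)"

definition complex_stresses :: "'v set set \<Rightarrow> complex ^ 'v::finite ^ 'n::finite \<Rightarrow> (complex ^ 'v ^ 'v) set" where
  "complex_stresses E x = {\<theta>. \<forall>y :: complex ^ 'v ^ 'n. complex_pairing \<theta> (edge_form E x y) = 0}"

definition unit_config :: "'n \<Rightarrow> 'v \<Rightarrow> 'a::zero_neq_one ^ 'v ^ 'n" where
  "unit_config j s = (\<chi> i r. if i = j \<and> r = s then 1 else 0)"

lemma complex_pairing_linear: "complex_pairing (\<theta> - \<theta>') z = complex_pairing \<theta> z - complex_pairing \<theta>' z" "complex_pairing (\<Sum>j\<in>J. f j) z = (\<Sum>j\<in>J. complex_pairing (f j) z)"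
  "complex_pairing (\<chi> i j. c * \<theta> $ i $ j) z = c * complex_pairing \<theta> z" "complex_pairing \<theta> (\<Sum>j\<in>J. g j) = (\<Sum>j\<in>J. complex_pairing \<theta> (g j))"
  "complex_pairing \<theta> (\<chi> i j. c * z $ i $ j) = c * complex_pairing \<theta> z"
proof -
  show "complex_pairing (\<theta> - \<theta>') z = complex_pairing \<theta> z - complex_pairing \<theta>' z" by (simp add: complex_pairing_def sum_subtractf left_diff_distrib)
  show "complex_pairing (\<Sum>j\<in>J. f j) z = (\<Sum>j\<in>J. complex_pairing (f j) z)"
    unfolding complex_pairing_def sum_component sum_distrib_right by (rule sum.swap)
  show "complex_pairing \<theta> (\<Sum>j\<in>J. g j) = (\<Sum>j\<in>J. complex_pairing \<theta> (g j))"
    unfolding complex_pairing_def sum_component sum_distrib_left by (rule sum.swap)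
  show "complex_pairing (\<chi> i j. c * \<theta> $ i $ j) z = c * complex_pairing \<theta> z" "complex_pairing \<theta> (\<chi> i j. c * z $ i $ j) = c * complex_pairing \<theta> z"
    by (simp_all add: complex_pairing_def sum_distrib_left mult_ac)
qed

lemma complex_stresses_iff: "\<theta> \<in> complex_stresses E (x :: complex ^ 'v::finite ^ 'n::finite) \<longleftrightarrow> (\<forall>j s. complex_pairing \<theta> (edge_form E x (unit_config j s)) = 0)"
proof
  assume H: "\<forall>j s. complex_pairing \<theta> (edge_form E x (unit_config j s)) = 0"
  have "complex_pairing \<theta> (edge_form E x y) = 0" for y :: "complex ^ 'v ^ 'n"
  proof -
    have y: "y $ j $ t = (\<Sum>js\<in>UNIV. y $ fst js $ snd js * unit_config (fst js) (snd js) $ j $ t)" for j t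
    proof -
      have "(\<Sum>js\<in>UNIV. y $ fst js $ snd js * unit_config (fst js) (snd js) $ j $ t) = (\<Sum>js\<in>UNIV. if js = (j, t) then y $ j $ t else 0)"
        by (rule sum.cong) (auto simp: unit_config_def split: if_splits)
      then show ?thesis by simp
    qed
    have "pair_form x y t u = (\<Sum>js\<in>UNIV. y $ fst js $ snd js * pair_form x (unit_config (fst js) (snd js)) t u)" for t u
    proof -
      have "pair_form x y t u = (\<Sum>j\<in>UNIV. \<Sum>js\<in>UNIV. y $ fst js $ snd js * ((x $ j $ t - x $ j $ u) * (unit_config (fst js) (snd js) $ j $ t - unit_config (fst js) (snd js) $ j $ u)))"
        unfolding pair_form_def by (subst (1 2) y) (simp add: sum_subtractf[symmetric] sum_distrib_left algebra_simps)
      also have "\<dots> = (\<Sum>js\<in>UNIV. y $ fst js $ snd js * pair_form x (unit_config (fst js) (snd js)) t u)"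
        unfolding pair_form_def sum_distrib_left by (rule sum.swap)
      finally show ?thesis .
    qed
    then have "edge_form E x y = (\<Sum>js\<in>UNIV. \<chi> t u. y $ fst js $ snd js * edge_form E x (unit_config (fst js) (snd js)) $ t $ u)"
      by (simp add: edge_form_def vec_eq_iff)
    then show ?thesis using H by (simp add: complex_pairing_linear)
  qed
  then show "\<theta> \<in> complex_stresses E x" by (simp add: complex_stresses_def)
qed (auto simp: complex_stresses_def)

lemma complex_stresses_sub: "\<theta> \<in> complex_stresses E x \<Longrightarrow> \<theta>' \<in> complex_stresses E x \<Longrightarrow> \<theta> - \<theta>' \<in> complex_stresses E x"
  by (simp add: complex_stresses_def complex_pairing_linear)

lemma complex_stresses_scale: "\<theta> \<in> complex_stresses E x \<Longrightarrow> (\<chi> i j. c * \<theta> $ i $ j) \<in> complex_stresses E x"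
  by (simp add: complex_stresses_def complex_pairing_linear)

lemma complex_stresses_sum: "(\<And>j. j \<in> J \<Longrightarrow> f j \<in> complex_stresses E x) \<Longrightarrow> (\<Sum>j\<in>J. f j) \<in> complex_stresses E x"
  by (simp add: complex_stresses_def complex_pairing_linear)

text \<open>For any velocity \<open>y\<close> of \<open>p\<close>, a derivation moves
  \<open>q\<close> along, and differentiating the equality of edge lengths gives
  \<open>edge_form E p y = edge_form E q (map_entries \<delta> q)\<close>. What annihilates the
  derivative at \<open>q\<close> therefore annihilates the one at \<open>p\<close>.\<close>

lemma equivalent_complex_stresses_subset:
  fixes p q :: "complex ^ 'v::finite ^ 'n::finite"
  assumes p: "generic_conf p" and eq: "edge_form E p p = edge_form E q q"
  shows "complex_stresses E q \<subseteq> complex_stresses E p"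
proof
  fix \<theta> assume \<theta>: "\<theta> \<in> complex_stresses E q"
  have "complex_pairing \<theta> (edge_form E p y) = 0" for y :: "complex ^ 'v ^ 'n"
  proof -
    obtain D \<delta> where d: "deriv_on D \<delta>" "entries q \<subseteq> D" "entries p \<subseteq> D" "map_entries \<delta> p = y"
      using generic_conf_deriv[OF p finite_entries[of q]] by metis
    have "map_entries \<delta> (edge_form E p p) = edge_form E p y + edge_form E p y" "map_entries \<delta> (edge_form E q q) = edge_form E q (map_entries \<delta> q) + edge_form E q (map_entries \<delta> q)"
      using deriv_edge_form(1)[OF d(1,3,3), of E] deriv_edge_form(1)[OF d(1,2,2), of E] d(4)
      by (simp_all add: edge_form_commute[of E y] edge_form_commute[of E "map_entries \<delta> q"])
    then have "edge_form E p y + edge_form E p y = edge_form E q (map_entries \<delta> q) + edge_form E q (map_entries \<delta> q)" using eq by simp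
    then have "edge_form E p y = edge_form E q (map_entries \<delta> q)" by (simp add: vec_eq_iff flip: mult_2)
    then show ?thesis using \<theta> by (simp add: complex_stresses_def)
  qed
  then show "\<theta> \<in> complex_stresses E p" by (simp add: complex_stresses_def)
qed

text \<open>The embedding taking \<open>p\<close> to \<open>x\<close> transports the linear system
  that defines stresses, enlarged by the equations of vanishing on \<open>J\<close>. Prescribed zero
  entries replace any mention of the dimension of the stress space.\<close>

lemma generic_conf_stress_transfer:
  fixes p x :: "complex ^ 'v::finite ^ 'n::finite"
  assumes p: "generic_conf p" "generic_conf x" and \<theta>: "\<theta> \<in> complex_stresses E p" "\<theta> \<noteq> 0" "\<And>k. k \<in> J \<Longrightarrow> \<theta> $ fst k $ snd k = 0"
  shows "\<exists>\<theta>'\<in>complex_stresses E x. \<theta>' \<noteq> 0 \<and> (\<forall>k\<in>J. \<theta>' $ fst k $ snd k = 0)"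
proof -
  obtain h where h: "hom_on (fld (entries p)) h" "map_entries h p = x" using generic_conf_hom[OF p] by metis
  let ?D = "fld (entries p)"
  note D = hom_onD(1)[OF h(1)]
  define M where "M i k = (case i of Inl (j, s) \<Rightarrow> edge_form E p (unit_config j s) $ fst k $ snd k | Inr k' \<Rightarrow> if k = k' then 1 else 0)"
    for i :: "('n \<times> 'v) + ('v \<times> 'v)" and k :: "'v \<times> 'v"
  have entp: "entries p \<subseteq> ?D" by (rule fld_superset)
  have entax: "entries (unit_config j s :: complex ^ 'v ^ 'n) \<subseteq> ?D" for j s using subfldD(1,2)[OF D] by (auto simp: entries_iff unit_config_def)
  have hax: "map_entries h (unit_config j s) = (unit_config j s :: complex ^ 'v ^ 'n)" for j s
    using hom_onD(2,3)[OF h(1)] by (simp add: vec_eq_iff unit_config_def)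
  have MD: "M i k \<in> ?D" for i k
    using hom_pair_form(2)[OF h(1) entp entax] subfldD(1,2)[OF D] by (auto simp: M_def edge_form_def split: sum.splits)
  have hM: "h (M (Inl (j, s)) k) = edge_form E x (unit_config j s) $ fst k $ snd k" "h (M (Inr k') k) = (if k = k' then 1 else 0)" for j s k k'
    using hom_pair_form(1)[OF h(1) entp entax] hom_onD(2,3)[OF h(1)] by (auto simp: M_def edge_form_def h(2) hax)
  let ?I = "Inl ` UNIV \<union> Inr ` J"
  let ?g = "\<lambda>k. \<theta> $ fst k $ snd k"
  have zero: "(\<Sum>k\<in>UNIV. M i k * ?g k) = 0" if "i \<in> ?I" for i
    using that
  proof
    assume "i \<in> Inl ` UNIV"
    then obtain j s where i: "i = Inl (j, s)" by auto
    have "complex_pairing \<theta> (edge_form E p (unit_config j s)) = 0" using \<theta>(1) by (simp add: complex_stresses_iff)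
    then show ?thesis by (simp add: i M_def complex_pairing_def mult.commute)
  next
    assume "i \<in> Inr ` J"
    then obtain k' where i: "i = Inr k'" "k' \<in> J" by auto
    have "(\<Sum>k\<in>UNIV. M i k * ?g k) = (\<Sum>k\<in>UNIV. if k = k' then ?g k' else 0)" by (rule sum.cong) (auto simp: i M_def)
    then show ?thesis using \<theta>(3)[OF i(2)] by simp
  qed
  have "\<exists>k0. ?g k0 \<noteq> 0"
  proof (rule ccontr)
    assume "\<nexists>k0. ?g k0 \<noteq> 0"
    then have "\<theta> $ i $ j = 0" for i j by (metis fst_conv snd_conv)
    then show False using \<theta>(2) by (simp add: vec_eq_iff)
  qed
  then obtain k0 where k0: "?g k0 \<noteq> 0" by blast
  have "countable ?D" by (intro countable_fld countable_finite finite_entries)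
  then obtain g where g: "\<And>i. i \<in> ?I \<Longrightarrow> (\<Sum>k\<in>UNIV. h (M i k) * g k) = 0" "g k0 \<noteq> 0"
    using hom_singular_system[OF h(1) _ finite[of UNIV], of ?I M ?g k0] MD zero k0 by auto
  define \<theta>' where "\<theta>' = (\<chi> i j. g (i, j))"
  have g\<theta>: "\<theta>' $ fst k $ snd k = g k" for k by (simp add: \<theta>'_def)
  show ?thesis
  proof (intro bexI[of _ \<theta>'] conjI ballI)
    show "\<theta>' \<in> complex_stresses E x"
      unfolding complex_stresses_iff
    proof (intro allI)
      fix j s
      have "(\<Sum>k\<in>UNIV. h (M (Inl (j, s)) k) * g k) = 0" by (rule g(1)) simp
      then show "complex_pairing \<theta>' (edge_form E x (unit_config j s)) = 0" by (simp add: complex_pairing_def g\<theta> hM mult.commute)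
    qed
    show "\<theta>' \<noteq> 0" using g(2) g\<theta>[of k0] by auto
    fix k' assume "k' \<in> J"
    then have "(\<Sum>k\<in>UNIV. h (M (Inr k') k) * g k) = 0" by (intro g(1)) simp
    moreover have "(\<Sum>k\<in>UNIV. h (M (Inr k') k) * g k) = (\<Sum>k\<in>UNIV. if k = k' then g k' else 0)"
      by (rule sum.cong) (auto simp: hM)
    ultimately show "\<theta>' $ fst k' $ snd k' = 0" by (simp add: g\<theta>)
  qed
qed

text \<open>Stress spaces can only grow in a limit. Along the line from \<open>p\<close> to
  \<open>q\<close> there are generic configurations converging to \<open>q\<close>; each carries a
  stress of norm one vanishing on \<open>J\<close>, and a subsequence of these converges to a
  nonzero stress of \<open>q\<close>.\<close>

lemma stress_semicontinuous:
  fixes p q :: "complex ^ 'v::finite ^ 'n::finite"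
  assumes p: "generic_conf p" and \<theta>: "\<theta> \<in> complex_stresses E p" "\<theta> \<noteq> 0" "\<And>k. k \<in> J \<Longrightarrow> \<theta> $ fst k $ snd k = 0"
  shows "\<exists>\<theta>'\<in>complex_stresses E q. \<theta>' \<noteq> 0 \<and> (\<forall>k\<in>J. \<theta>' $ fst k $ snd k = 0)"
proof -
  let ?x = "\<lambda>s :: complex. \<chi> i t. (1 - s) * p $ i $ t + s * q $ i $ t"
  have cnt: "countable (complex_of_real -` {s. \<not> generic_conf (?x s)})"
    by (rule countable_of_real_vimage[OF generic_conf_line[OF p]])
  have ex: "\<exists>s. 1 - 1 / real (Suc n) < s \<and> s < 1 \<and> generic_conf (?x (of_real s))" for n
  proof -
    have "\<not> {1 - 1 / real (Suc n)<..<1} \<subseteq> complex_of_real -` {s. \<not> generic_conf (?x s)}"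
      using countable_subset[OF _ cnt] uncountable_open_interval[of "1 - 1 / real (Suc n)" 1] by auto
    then show ?thesis by auto
  qed
  have "\<forall>n. \<exists>s. 1 - 1 / real (Suc n) < s \<and> s < 1 \<and> generic_conf (?x (of_real s))" by (rule allI, rule ex)
  from choice[OF this] obtain s
    where s0: "\<forall>n. 1 - 1 / real (Suc n) < s n \<and> s n < 1 \<and> generic_conf (?x (of_real (s n)))" by blast
  have s: "1 - 1 / real (Suc n) < s n" "s n < 1" "generic_conf (?x (of_real (s n)))" for n using s0[rule_format, of n] by auto
  have "\<exists>\<phi>. \<phi> \<in> complex_stresses E (?x (of_real (s n))) \<and> norm \<phi> = 1 \<and> (\<forall>k\<in>J. \<phi> $ fst k $ snd k = 0)" for n
  proof -
    obtain \<theta>' where t: "\<theta>' \<in> complex_stresses E (?x (of_real (s n)))" "\<theta>' \<noteq> 0" "\<And>k. k \<in> J \<Longrightarrow> \<theta>' $ fst k $ snd k = 0"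
      using generic_conf_stress_transfer[OF p s(3)[of n] \<theta>] by blast
    let ?c = "complex_of_real (1 / norm \<theta>')"
    have eq: "(\<chi> i j. ?c * \<theta>' $ i $ j) = (1 / norm \<theta>') *\<^sub>R \<theta>'" by (simp add: vec_eq_iff complex_eq_iff)
    have "norm ((1 / norm \<theta>') *\<^sub>R \<theta>') = 1" using t(2) by simp
    moreover have "(1 / norm \<theta>') *\<^sub>R \<theta>' \<in> complex_stresses E (?x (of_real (s n)))" using complex_stresses_scale[OF t(1), of ?c] eq by simp
    ultimately show ?thesis using t(3) by (intro exI[of _ "(1 / norm \<theta>') *\<^sub>R \<theta>'"]) auto
  qed
  note ex\<phi> = this
  have "\<forall>n. \<exists>\<phi>. \<phi> \<in> complex_stresses E (?x (of_real (s n))) \<and> norm \<phi> = 1 \<and> (\<forall>k\<in>J. \<phi> $ fst k $ snd k = 0)" by (rule allI, rule ex\<phi>)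
  from choice[OF this] obtain \<phi>
    where \<phi>0: "\<forall>n. \<phi> n \<in> complex_stresses E (?x (of_real (s n))) \<and> norm (\<phi> n) = 1 \<and> (\<forall>k\<in>J. \<phi> n $ fst k $ snd k = 0)" by blast
  have \<phi>: "\<phi> n \<in> complex_stresses E (?x (of_real (s n)))" "norm (\<phi> n) = 1" "k \<in> J \<Longrightarrow> \<phi> n $ fst k $ snd k = 0" for n k
    using \<phi>0[rule_format, of n] by auto
  have "compact (sphere (0 :: complex ^ 'v ^ 'v) 1)" by simp
  moreover have "\<forall>n. \<phi> n \<in> sphere 0 1" using \<phi>(2) by simp
  ultimately obtain l r where l: "l \<in> sphere 0 1" "strict_mono r" "(\<phi> \<circ> r) \<longlonglongrightarrow> l"
    unfolding compact_def by metis
  have s1: "s \<longlonglongrightarrow> 1"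
  proof (rule tendsto_sandwich[of "\<lambda>n. 1 - 1 / real (Suc n)" s sequentially "\<lambda>_. 1"])
    show "(\<lambda>n. 1 - 1 / real (Suc n)) \<longlonglongrightarrow> 1" using tendsto_diff[OF tendsto_const LIMSEQ_inverse_real_of_nat, of 1] by (simp add: inverse_eq_divide)
  qed (use s(1,2) in \<open>auto intro!: always_eventually less_imp_le\<close>)
  have "(\<lambda>n. complex_of_real ((s \<circ> r) n)) \<longlonglongrightarrow> complex_of_real 1" by (intro tendsto_of_real LIMSEQ_subseq_LIMSEQ[OF s1 l(2)])
  then have s2: "(\<lambda>n. complex_of_real (s (r n))) \<longlonglongrightarrow> 1" by simp
  have xl: "(\<lambda>n. ?x (of_real (s (r n))) $ i $ t) \<longlonglongrightarrow> q $ i $ t" for i t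
  proof -
    have "(\<lambda>n. (1 - of_real (s (r n))) * p $ i $ t + of_real (s (r n)) * q $ i $ t) \<longlonglongrightarrow> (1 - 1) * p $ i $ t + 1 * q $ i $ t"
      by (intro tendsto_intros s2)
    then show ?thesis by simp
  qed
  have \<phi>l: "(\<lambda>n. \<phi> (r n) $ i $ j) \<longlonglongrightarrow> l $ i $ j" for i j
    using l(3) by (intro tendsto_vec_nth) (simp add: comp_def)
  have "l \<in> complex_stresses E q"
    unfolding complex_stresses_def
  proof (intro CollectI allI)
    fix y :: "complex ^ 'v ^ 'n"
    have "(\<lambda>n. edge_form E (?x (of_real (s (r n)))) y $ i $ j) \<longlonglongrightarrow> edge_form E q y $ i $ j" for i j
    proof (cases "{i, j} \<in> E")
      case True
      have "(\<lambda>n. pair_form (?x (of_real (s (r n)))) y i j) \<longlonglongrightarrow> pair_form q y i j"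
        unfolding pair_form_def by (intro tendsto_intros xl)
      then show ?thesis using True by (simp add: edge_form_def)
    qed (simp add: edge_form_def)
    then have "(\<lambda>n. complex_pairing (\<phi> (r n)) (edge_form E (?x (of_real (s (r n)))) y)) \<longlonglongrightarrow> complex_pairing l (edge_form E q y)"
      unfolding complex_pairing_def by (intro tendsto_sum tendsto_mult \<phi>l)
    moreover have "complex_pairing (\<phi> (r n)) (edge_form E (?x (of_real (s (r n)))) y) = 0" for n using \<phi>(1)[of "r n"] by (simp add: complex_stresses_def)
    ultimately show "complex_pairing l (edge_form E q y) = 0" by (simp add: LIMSEQ_const_iff)
  qed
  moreover have "l \<noteq> 0" using l(1) by auto
  moreover have "l $ fst k $ snd k = 0" if "k \<in> J" for k
    using \<phi>l[of "fst k" "snd k"] \<phi>(3)[OF that] by (simp add: LIMSEQ_const_iff)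
  ultimately show ?thesis by blast
qed

text \<open>By the reverse inclusion a stress of \<open>p\<close> can be compared with stresses of
  \<open>q\<close> inside the stresses of \<open>p\<close>. A nonzero discrepancy vanishing on
  \<open>J\<close> would, by semicontinuity, produce a nonzero stress of \<open>q\<close> that also
  vanishes on \<open>J\<close>.\<close>

lemma equivalent_complex_stresses_eq:
  fixes p q :: "complex ^ 'v::finite ^ 'n::finite"
  assumes p: "generic_conf p" and eq: "edge_form E p p = edge_form E q q"
  shows "complex_stresses E p \<subseteq> complex_stresses E q"
proof
  fix \<omega> assume \<omega>: "\<omega> \<in> complex_stresses E p"
  define ok where "ok J \<longleftrightarrow> (\<forall>\<theta>\<in>complex_stresses E q. (\<forall>k\<in>J. \<theta> $ fst k $ snd k = 0) \<longrightarrow> \<theta> = 0)" for J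
  have "ok UNIV" unfolding ok_def by (auto simp: vec_eq_iff)
  \<comment> \<open>A smallest set of entries that determines the stresses of \<open>q\<close>.
    Minimality gives a dual basis \<open>\<theta>\<close>, from which \<open>\<xi>\<close>
    interpolates the entries of \<open>\<omega>\<close> on \<open>J\<close>.\<close>
  then obtain J where J: "ok J" "\<And>J'. ok J' \<Longrightarrow> card J \<le> card J'" using ex_has_least_nat[of ok UNIV card] by blast
  have "\<exists>\<theta>\<in>complex_stresses E q. \<theta> $ fst j $ snd j \<noteq> 0 \<and> (\<forall>k\<in>J - {j}. \<theta> $ fst k $ snd k = 0)" if j: "j \<in> J" for j
  proof -
    have "card (J - {j}) < card J" using j by (intro psubset_card_mono) auto
    then have "\<not> ok (J - {j})" using J(2)[of "J - {j}"] by linarith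
    then obtain \<theta> where \<theta>: "\<theta> \<in> complex_stresses E q" "\<forall>k\<in>J - {j}. \<theta> $ fst k $ snd k = 0" "\<theta> \<noteq> 0" unfolding ok_def by blast
    moreover have "\<theta> $ fst j $ snd j \<noteq> 0"
    proof
      assume "\<theta> $ fst j $ snd j = 0"
      then have "\<forall>k\<in>J. \<theta> $ fst k $ snd k = 0" using \<theta>(2) by blast
      then show False using J(1) \<theta>(1,3) unfolding ok_def by blast
    qed
    ultimately show ?thesis by blast
  qed
  then obtain \<theta> where \<theta>: "\<And>j. j \<in> J \<Longrightarrow> \<theta> j \<in> complex_stresses E q" "\<And>j. j \<in> J \<Longrightarrow> \<theta> j $ fst j $ snd j \<noteq> 0"
    "\<And>j k. j \<in> J \<Longrightarrow> k \<in> J \<Longrightarrow> k \<noteq> j \<Longrightarrow> \<theta> j $ fst k $ snd k = 0" by (metis DiffI singletonD)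
  define \<xi> where "\<xi> = (\<Sum>j\<in>J. \<chi> a b. (\<omega> $ fst j $ snd j / \<theta> j $ fst j $ snd j) * \<theta> j $ a $ b)"
  have \<xi>q: "\<xi> \<in> complex_stresses E q" unfolding \<xi>_def using \<theta>(1) by (intro complex_stresses_sum complex_stresses_scale)
  have "\<omega> - \<xi> \<in> complex_stresses E p" using \<omega> \<xi>q equivalent_complex_stresses_subset[OF p eq] by (intro complex_stresses_sub) auto
  moreover have "(\<omega> - \<xi>) $ fst k $ snd k = 0" if k: "k \<in> J" for k
  proof -
    have "\<xi> $ fst k $ snd k = (\<Sum>j\<in>J. if j = k then \<omega> $ fst k $ snd k else 0)"
      unfolding \<xi>_def sum_component using \<theta>(2,3) k by (intro sum.cong) auto
    then show ?thesis using k by simp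
  qed
  ultimately have "\<omega> - \<xi> = 0" using stress_semicontinuous[OF p, of "\<omega> - \<xi>" E J q] J(1) unfolding ok_def by blast
  then show "\<omega> \<in> complex_stresses E q" using \<xi>q by simp
qed

section \<open>From equal stresses to congruence\<close>

lemma span_affine:
  fixes p :: "real ^ 'v::finite ^ 'n::finite"
  assumes "f \<in> span (insert ones (range (\<lambda>j. p $ j)))"
  shows "\<exists>a A. \<forall>t. f $ t = a + (\<Sum>l\<in>UNIV. A l * p $ l $ t)"
  using assms
proof (induction rule: span_induct_alt)
  case base
  show ?case by (rule exI[of _ 0], rule exI[of _ "\<lambda>_. 0"]) simp
next
  case (step c b f)
  then obtain a A where aA: "\<forall>t. f $ t = a + (\<Sum>l\<in>UNIV. A l * p $ l $ t)" by blast
  from step(1) consider "b = ones" | j where "b = p $ j" by auto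
  then show ?case
  proof cases
    case 1
    then show ?thesis using aA by (intro exI[of _ "a + c"] exI[of _ A]) (simp add: ones_def)
  next
    case 2
    have "(\<Sum>l\<in>UNIV. (A l + (if l = j then c else 0)) * p $ l $ t) = (\<Sum>l\<in>UNIV. A l * p $ l $ t) + c * p $ j $ t" for t
    proof -
      have "(\<Sum>l\<in>UNIV. (A l + (if l = j then c else 0)) * p $ l $ t) = (\<Sum>l\<in>UNIV. A l * p $ l $ t + (if l = j then c * p $ j $ t else 0))"
        by (rule sum.cong) (auto simp: distrib_right)
      then show ?thesis by (simp add: sum.distrib)
    qed
    then show ?thesis using aA 2 by (intro exI[of _ a] exI[of _ "\<lambda>l. A l + (if l = j then c else 0)"]) simp
  qed
qed

lemma pair_form_map_entries_of_real: "pair_form (map_entries complex_of_real x) (map_entries complex_of_real y) t u = of_real (pair_form x y t u)"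
  by (simp add: pair_form_def)

lemma edge_form_map_entries_of_real: "edge_form E (map_entries complex_of_real x) (map_entries complex_of_real y) = map_entries complex_of_real (edge_form E x y)"
  by (simp add: edge_form_def vec_eq_iff pair_form_map_entries_of_real)

lemma generic_conf_map_entries_of_real: "generic_conf (map_entries complex_of_real x) \<longleftrightarrow> generic_conf x"
  using generic_of_real[of "\<lambda>(t, i). x $ i $ t"] by (simp add: generic_conf_def case_prod_unfold)

text \<open>Since \<open>q\<close> inherits the real stress \<open>w\<close>, the real and imaginary
  parts of its coordinates lie in the real stress kernel, and \<open>q\<close> is a complex affine
  image of \<open>p\<close>. Whether an affine map that preserves edge lengths preserves all
  distances is then a linear question, answered by infinitesimal rigidity.\<close>

lemma complex_rigid:
  fixes p :: "real ^ 'v::finite ^ 'n::finite" and q :: "complex ^ 'v ^ 'n"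
  assumes p: "generic_conf p" and IRp: "inf_rigid E p" and pw: "p \<in> stress_configs E w" and K: "stress_kernel E w \<subseteq> span (insert ones (range (\<lambda>j. p $ j)))"
    and eq: "edge_form E (map_entries of_real p) (map_entries of_real p) = edge_form E q q"
  shows "pair_form (map_entries of_real p) (map_entries of_real p) t u = pair_form q q t u"
proof -
  let ?p = "map_entries complex_of_real p"
  have "map_entries of_real w \<in> complex_stresses E ?p"
    unfolding complex_stresses_iff
  proof (intro allI)
    fix j s
    have "map_entries complex_of_real (unit_config j s :: real ^ 'v ^ 'n) = unit_config j s" by (simp add: vec_eq_iff unit_config_def)
    then have "edge_form E ?p (unit_config j s) = map_entries complex_of_real (edge_form E p (unit_config j s))" using edge_form_map_entries_of_real[of E p "unit_config j s"] by simp
    then have "complex_pairing (map_entries of_real w) (edge_form E ?p (unit_config j s)) = of_real (\<Sum>k\<in>UNIV. w $ fst k $ snd k * edge_form E p (unit_config j s) $ fst k $ snd k)"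
      by (simp add: complex_pairing_def)
    also have "(\<Sum>k\<in>UNIV. w $ fst k $ snd k * edge_form E p (unit_config j s) $ fst k $ snd k) = w \<bullet> edge_form E p (unit_config j s)"
      by (simp add: inner_mat sum.cartesian_product case_prod_beta)
    also have "\<dots> = 0" using pw by (simp add: stress_configs_def)
    finally show "complex_pairing (map_entries of_real w) (edge_form E ?p (unit_config j s)) = 0" by simp
  qed
  then have wq: "map_entries of_real w \<in> complex_stresses E q" using equivalent_complex_stresses_eq[OF _ eq] p by (auto simp: generic_conf_map_entries_of_real)
  have comp: "(\<chi> t. f (q $ j $ t)) \<in> stress_kernel E w" if f: "linear f" "\<And>r z. f (of_real r * z) = r * f z" for f :: "complex \<Rightarrow> real" and j
    unfolding stress_kernel_def
  proof (intro CollectI allI)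
    fix g :: "real ^ 'v"
    let ?y = "\<chi> i t. if i = j then complex_of_real (g $ t) else 0 :: complex ^ 'v ^ 'n"
    have pdy: "pair_form q ?y a b = of_real (g $ a - g $ b) * (q $ j $ a - q $ j $ b)" for a b
    proof -
      have "pair_form q ?y a b = (\<Sum>i\<in>UNIV. if i = j then of_real (g $ a - g $ b) * (q $ j $ a - q $ j $ b) else 0)"
        unfolding pair_form_def by (rule sum.cong) auto
      then show ?thesis by simp
    qed
    have fk: "f (map_entries of_real w $ a $ b * edge_form E q ?y $ a $ b) = w $ a $ b * edge_form1 E (\<chi> t. f (q $ j $ t)) g $ a $ b" for a b
      by (simp add: edge_form_def edge_form1_def pdy f(2) linear_diff[OF f(1)] linear_0[OF f(1)] mult.commute del: of_real_diff)
    have "0 = f (complex_pairing (map_entries of_real w) (edge_form E q ?y))" using wq linear_0[OF f(1)] by (simp add: complex_stresses_def)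
    also have "\<dots> = (\<Sum>k\<in>UNIV. w $ fst k $ snd k * edge_form1 E (\<chi> t. f (q $ j $ t)) g $ fst k $ snd k)"
      unfolding complex_pairing_def linear_sum[OF f(1)] fk ..
    also have "\<dots> = w \<bullet> edge_form1 E (\<chi> t. f (q $ j $ t)) g"
      by (simp add: inner_mat sum.cartesian_product case_prod_beta)
    finally show "w \<bullet> edge_form1 E (\<chi> t. f (q $ j $ t)) g = 0" by simp
  qed
  have "\<exists>a A. \<forall>t. q $ j $ t = a + (\<Sum>l\<in>UNIV. A l * of_real (p $ l $ t))" for j
  proof -
    have "(\<chi> t. Re (q $ j $ t)) \<in> stress_kernel E w" "(\<chi> t. Im (q $ j $ t)) \<in> stress_kernel E w" by (rule comp; auto intro!: linearI)+
    then obtain a A b B where 1: "\<forall>t. Re (q $ j $ t) = a + (\<Sum>l\<in>UNIV. A l * p $ l $ t)"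
      and 2: "\<forall>t. Im (q $ j $ t) = b + (\<Sum>l\<in>UNIV. B l * p $ l $ t)" using span_affine[OF subsetD[OF K]] by fastforce
    then show ?thesis
      by (intro exI[of _ "Complex a b"] exI[of _ "\<lambda>l. Complex (A l) (B l)"]) (simp add: complex_eq_iff)
  qed
  then obtain \<alpha> A where q: "\<And>j t. q $ j $ t = \<alpha> j + (\<Sum>l\<in>UNIV. A j l * of_real (p $ l $ t))" by metis
  \<comment> \<open>With \<open>A\<close> the linear part of the affine map, \<open>Y\<close> is
    \<open>(transpose A * A - 1) p\<close>. Its pairing with \<open>p\<close> measures the change of
    squared length, so equal edge lengths make the real and imaginary parts of \<open>Y\<close>
    flexes of \<open>p\<close>.\<close>
  define Y :: "complex ^ 'v ^ 'n" where "Y = (\<chi> l t. (\<Sum>m\<in>UNIV. (\<Sum>j\<in>UNIV. A j l * A j m) * of_real (p $ m $ t)) - of_real (p $ l $ t))"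
  have Y: "pair_form ?p Y a b = pair_form q q a b - pair_form ?p ?p a b" for a b
  proof -
    define P where "P l = complex_of_real (p $ l $ a - p $ l $ b)" for l
    have qd: "q $ j $ a - q $ j $ b = (\<Sum>l\<in>UNIV. A j l * P l)" for j
      by (simp add: q P_def sum_subtractf algebra_simps)
    have Yd: "Y $ l $ a - Y $ l $ b = (\<Sum>m\<in>UNIV. (\<Sum>j\<in>UNIV. A j l * A j m) * P m) - P l" for l
      by (simp add: Y_def P_def sum_subtractf right_diff_distrib)
    have "pair_form q q a b = (\<Sum>j\<in>UNIV. \<Sum>l\<in>UNIV. \<Sum>m\<in>UNIV. P l * (A j l * A j m * P m))"
      unfolding pair_form_def qd sum_product by (simp add: mult_ac)
    also have "\<dots> = (\<Sum>l\<in>UNIV. \<Sum>j\<in>UNIV. \<Sum>m\<in>UNIV. P l * (A j l * A j m * P m))" by (rule sum.swap)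
    also have "\<dots> = (\<Sum>l\<in>UNIV. \<Sum>m\<in>UNIV. \<Sum>j\<in>UNIV. P l * (A j l * A j m * P m))" by (rule sum.cong[OF refl], rule sum.swap)
    also have "\<dots> = (\<Sum>l\<in>UNIV. P l * (\<Sum>m\<in>UNIV. (\<Sum>j\<in>UNIV. A j l * A j m) * P m))"
      by (simp add: sum_distrib_left sum_distrib_right)
    finally have qq: "pair_form q q a b = (\<Sum>l\<in>UNIV. P l * (\<Sum>m\<in>UNIV. (\<Sum>j\<in>UNIV. A j l * A j m) * P m))" .
    have "pair_form ?p Y a b = (\<Sum>l\<in>UNIV. P l * ((\<Sum>m\<in>UNIV. (\<Sum>j\<in>UNIV. A j l * A j m) * P m) - P l))"
      unfolding pair_form_def Yd by (simp add: P_def)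
    also have "\<dots> = pair_form q q a b - (\<Sum>l\<in>UNIV. P l * P l)" unfolding qq by (simp add: right_diff_distrib sum_subtractf)
    also have "(\<Sum>l\<in>UNIV. P l * P l) = pair_form ?p ?p a b" by (simp add: pair_form_def P_def)
    finally show ?thesis .
  qed
  have part: "f (pair_form q q t u - pair_form ?p ?p t u) = 0" if f: "linear f" "\<And>r z. f (of_real r * z) = r * f z" for f :: "complex \<Rightarrow> real"
  proof -
    have pf: "pair_form p (map_entries f Y) a b = f (pair_form ?p Y a b)" for a b
      by (simp add: pair_form_def linear_sum[OF f(1)] linear_diff[OF f(1)] f(2) flip: of_real_diff)
    have "edge_form E p (map_entries f Y) = 0"
    proof -
      have "pair_form p (map_entries f Y) a b = 0" if "{a, b} \<in> E" for a b
      proof -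
        have "edge_form E ?p ?p $ a $ b = edge_form E q q $ a $ b" using eq by simp
        then have "pair_form ?p ?p a b = pair_form q q a b" using that by (simp add: edge_form_def)
        then show ?thesis using pf[of a b] Y[of a b] linear_0[OF f(1)] by simp
      qed
      then show ?thesis by (simp add: edge_form_def vec_eq_iff)
    qed
    then have "pair_form p (map_entries f Y) t u = 0" using IRp by (simp add: inf_rigid_def)
    then show ?thesis using pf Y by simp
  qed
  have "Re (pair_form q q t u - pair_form ?p ?p t u) = 0" "Im (pair_form q q t u - pair_form ?p ?p t u) = 0"
    by (rule part; auto intro!: linearI)+
  then show ?thesis by (simp add: complex_eq_iff)
qed

theorem mainTheorem1:
  fixes E :: "'v::finite set set"
  assumes "is_graph E"
  shows "GGR E TYPE('v \<Rightarrow> complex ^ 'n) \<longleftrightarrow> GGR E TYPE('v \<Rightarrow> real ^ 'n)"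
proof
  assume C: "GGR E TYPE('v \<Rightarrow> complex ^ 'n)"
  show "GGR E TYPE('v \<Rightarrow> real ^ 'n)"
    unfolding GGR_iff
  proof (intro allI impI)
    fix x y :: "real ^ 'v ^ 'n" and t u
    assume x: "generic_conf x" "edge_form E x x = edge_form E y y"
    \<comment> \<open>A generic real framework is also generic as a complex one, and its real
      competitors are complex competitors.\<close>
    have "edge_form E (map_entries complex_of_real x) (map_entries complex_of_real x) = edge_form E (map_entries complex_of_real y) (map_entries complex_of_real y)"
      unfolding edge_form_map_entries_of_real using x(2) by simp
    moreover have "generic_conf (map_entries complex_of_real x)" using x(1) by (simp add: generic_conf_map_entries_of_real)
    ultimately have "pair_form (map_entries complex_of_real x) (map_entries complex_of_real x) t u = pair_form (map_entries complex_of_real y) (map_entries complex_of_real y) t u"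
      using C unfolding GGR_iff by blast
    then show "pair_form x x t u = pair_form y y t u" by (simp add: pair_form_map_entries_of_real)
  qed
next
  assume "GGR E TYPE('v \<Rightarrow> real ^ 'n)"
  then have R: "\<And>(x :: real ^ 'v ^ 'n) (y :: real ^ 'v ^ 'n). generic_conf x \<Longrightarrow> edge_form E x x = edge_form E y y \<Longrightarrow> \<forall>t u. pair_form x x t u = pair_form y y t u"
    unfolding GGR_iff by blast
  \<comment> \<open>A single generic real framework is enough, because every generic complex one can
    be embedded onto it.\<close>
  obtain f :: "'v \<times> 'n \<Rightarrow> real" where "generic_family f" using exists_generic_real by blast
  then have p: "generic_conf (\<chi> i t. f (t, i))" by (simp add: generic_conf_def case_prod_unfold)
  define p where "p = (\<chi> i t. f (t, i))"
  have genp: "generic_conf p" using p by (simp add: p_def)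
  have IRp: "inf_rigid E p" using GGR_imp_inf_rigid[OF R[OF genp] genp] .
  obtain w where w: "p \<in> stress_configs E w" "stress_kernel E w \<subseteq> span (insert ones (range (\<lambda>j. p $ j)))"
    using stress_kernel_span[OF R genp] by blast
  show "GGR E TYPE('v \<Rightarrow> complex ^ 'n)"
    unfolding GGR_iff
  proof (intro allI impI)
    fix x y :: "complex ^ 'v ^ 'n" and t u
    assume x: "generic_conf x" and eq: "edge_form E x x = edge_form E y y"
    let ?p = "map_entries complex_of_real p"
    have "generic_conf ?p" using genp by (simp add: generic_conf_map_entries_of_real)
    then obtain h0 where h0: "hom_on (fld (entries x)) h0" "map_entries h0 x = ?p" using generic_conf_hom[OF x] by metis
    have "countable (fld (entries x))" by (intro countable_fld countable_finite finite_entries)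
    \<comment> \<open>The embedding has to be defined on the competitor \<open>y\<close> as well.
      Its values there are complex in general, which is why \<open>complex_rigid\<close> admits a
      complex \<open>q\<close>.\<close>
    then obtain T h where h: "hom_on T h" "fld (entries x) \<union> entries y \<subseteq> T" "\<And>z. z \<in> fld (entries x) \<Longrightarrow> h z = h0 z"
      using hom_extend_complex[OF h0(1) _ finite_entries[of y]] by metis
    have ex: "entries x \<subseteq> T" "entries y \<subseteq> T" using h(2) fld_superset[of "entries x"] by auto
    have hx: "map_entries h x = ?p"
      using h0(2) h(3) entsD[OF fld_superset[of "entries x"]] by (simp add: vec_eq_iff)
    have hpx: "h (pair_form x x a b) = pair_form ?p ?p a b" and hpy: "h (pair_form y y a b) = pair_form (map_entries h y) (map_entries h y) a b" for a b
      using hom_pair_form(1)[OF h(1) ex(1) ex(1)] hom_pair_form(1)[OF h(1) ex(2) ex(2)] hx by simp_all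
    have "pair_form ?p ?p a b = pair_form (map_entries h y) (map_entries h y) a b" if "{a, b} \<in> E" for a b
    proof -
      have "edge_form E x x $ a $ b = edge_form E y y $ a $ b" using eq by simp
      then have "pair_form x x a b = pair_form y y a b" using that by (simp add: edge_form_def)
      then show ?thesis using hpx[of a b] hpy[of a b] by simp
    qed
    then have "edge_form E ?p ?p = edge_form E (map_entries h y) (map_entries h y)" by (simp add: edge_form_def vec_eq_iff)
    then have "pair_form ?p ?p t u = pair_form (map_entries h y) (map_entries h y) t u" by (rule complex_rigid[OF genp IRp w])
    \<comment> \<open>Congruence holds after applying \<open>h\<close>; injectivity of field
      homomorphisms returns it to \<open>x\<close> and \<open>y\<close>.\<close>
    then have "h (pair_form x x t u - pair_form y y t u) = 0"
      using hom_pair_form(2)[OF h(1) ex(1) ex(1)] hom_pair_form(2)[OF h(1) ex(2) ex(2)] by (simp add: hom_onD(7)[OF h(1)] hpx hpy)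
    moreover have "pair_form x x t u - pair_form y y t u \<in> T"
      using hom_pair_form(2)[OF h(1) ex(1) ex(1)] hom_pair_form(2)[OF h(1) ex(2) ex(2)] by (intro subfldD(7)[OF hom_onD(1)[OF h(1)]])
    ultimately have "pair_form x x t u - pair_form y y t u = 0" using hom_on_inj[OF h(1)] by blast
    then show "pair_form x x t u = pair_form y y t u" by simp
  qed
qed

end
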